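(* Assume all of the following. (1) $\mathcal H_K\hookrightarrow\mathcal H^{\phi}$ and $\mathcal H^{\phi}\hookrightarrow\mathcal H^{\psi}$ with both embeddings compact, and $\mathcal H^{\psi}$ is weakly embedded in $L^\infty(\mathcal X)$. (2) $\frac{t}{\phi(t)}$ and $\frac{\phi(t)}{\psi(t)}$ are nondecreasing, $\frac{t}{\psi(t)}$ is concave, and $\phi,\psi$ satisfy the $\Delta_2$ condition with constants $D_1^\phi,D_2^\phi,D_1^\psi,D_2^\psi>1$. (3) $\sup\{\|\sum_{i=1}^n c_ie_i\|_\infty:\sum_{i=1}^n c_i^2=1\}\asymp\sqrt{s(n)}$ for an increasing function $s$ satisfying the $\Delta_2$ condition with constants $D_1^s,D_2^s>1$. (4) $\mathcal X\subset\mathbb R^d$ is connected and relatively compact, with $\epsilon_n(\bar{\mathcal X})\asymp n^{-1/d}$ as $n\to\infty$. (5) $K(x,y)=\kappa(\|x-y\|)$ for a strictly positive definite $\kappa\in L^1(\mathbb R)$ such that $\mathcal F_d\kappa(t)$ is nonincreasing and continuous with $\alpha_{\mathcal F_d\kappa},\beta_{\mathcal F_d\kappa}\in(-\infty,\infty)$. (6) $\psi\Big(\frac{t\,\mathcal F_d\kappa(t^{1/d})}{s(t)}\Big)\asymp\frac1{s(t)}$ as $t\to\infty$. Then for all $\epsilon>0$, as $n\to\infty$, $$\psi^{-1}\big(s(n)^{-1}\big)\preceq\mu_n\preceq\psi^{-1}\big(s(n)^{-\frac1{1+\epsilon}}\big).$$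
   Context: Setting. $\nu$ is a Radon probability measure on $\mathcal X\subset\mathbb R^d$, absolutely continuous with respect to Lebesgue measure, with support $\bar{\mathcal X}$. $\mathcal H_K$ is a separable reproducing kernel Hilbert space on $\mathcal X$ with kernel $K$. The embedding $I_\nu:\mathcal H_K\to L^2(\nu)$ is assumed injective, $S_\nu=I_\nu^*$, $S_\nu f(x)=\int K(x,y)f(y)\,d\nu(y)$, and $T_\nu=I_\nu S_\nu$ is nuclear with spectral representation $T_\nu=\sum_j\mu_je_j\langle e_j,\cdot\rangle_{L^2(\nu)}$, where $\mu_1\ge\mu_2\ge\dots>0$ and $\{e_j\}$ is orthonormal in $L^2(\nu)$. Index functions and Hilbert scales. $\phi,\psi$ are index functions: nondecreasing, nonnegative, continuous, $\phi(0)=\psi(0)=0$. $\mathcal H^\phi$ is the completion of $\{f\in L^2(\nu):\sum_i\langle f,e_i\rangle^2_{L^2(\nu)}/\phi(\mu_i)<\infty\}$ under $\langle f,g\rangle_\phi=\sum_i\langle f,e_i\rangle\langle g,e_i\rangle/\phi(\mu_i)$. $\mathcal H^\psi$ is weakly embedded in a Banach space $\mathcal B$ if $\mathcal H^{\psi^{1+\epsilon}}\hookrightarrow\mathcal B$ compactly for all $\epsilon>0$, where $\psi^{1+\epsilon}(t)=(\psi(t))^{1+\epsilon}$. Other notation. $\xi$ satisfies the $\Delta_2$ condition with constants $D_1,D_2$ if $D_1\xi(\lambda)\le\xi(2\lambda)\le D_2\xi(\lambda)$ for all $\lambda>0$. For a positive monotone $h$ on $(0,\infty)$ put $d_h(t)=\sup_{s>1}h(st)/h(s)$,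 $\alpha_h=\lim_{t\to0}\frac{\log d_h(t)}{\log t}$, $\beta_h=\lim_{t\to\infty}\frac{\log d_h(t)}{\log t}$. $\epsilon_n(\bar{\mathcal X})$ is the infimum of $\epsilon>0$ such that $\bar{\mathcal X}$ is covered by $n$ balls of radius $\epsilon$ centered in it. $\mathcal F_d\kappa$ is the $d$-dimensional Fourier transform of the radial function $x\mapsto\kappa(\|x\|)$, viewed as a function of the radius. $\psi^{-1}$ is the (generalized) inverse, while $s(n)^{-1}=1/s(n)$. $a\preceq b$ means $a\le Cb$ asymptotically in the indicated limit with $C>0$ depending only on problem parameters and not on the limiting variable; $a\asymp b$ means $a\preceq b$ and $b\preceq a$. *)

theory Defs
  imports "HOL-Probability.Probability"
begin

text \<open>
  Elements of the spaces \<open>L\<^sup>2(\<nu>)\<close> and \<open>L\<^sup>\<infinity>(\<nu>)\<close> are represented by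
  functions, and all inner products and norms below only see the class modulo \<open>\<nu>\<close>-null sets.
  Function spaces are pairs of a carrier set and a (semi)norm; two functions at seminorm distance
  \<open>0\<close> represent the same element.  Sequences \<open>\<mu>\<close>, \<open>e\<close> are indexed from \<open>1\<close>; the
  value at \<open>0\<close> is never used.
\<close>

definition radon_prob_on :: "'a::euclidean_space set \<Rightarrow> 'a measure \<Rightarrow> bool" where
  "radon_prob_on X \<nu> \<longleftrightarrow>
     prob_space \<nu> \<and>
     sets \<nu> = sets (restrict_space borel X) \<and>
     (\<forall>A\<in>sets \<nu>. emeasure \<nu> A = (SUP C\<in>{C. compact C \<and> C \<subseteq> A}. emeasure \<nu> C))"

definition measure_support :: "'a::euclidean_space measure \<Rightarrow> 'a set" where
  "measure_support M = {x. \<forall>U. open U \<and> x \<in> U \<longrightarrow> emeasure M (U \<inter> space M) > 0}"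

definition L2_space :: "'a measure \<Rightarrow> ('a \<Rightarrow> real) set" where
  "L2_space \<nu> = {f \<in> borel_measurable \<nu>. integrable \<nu> (\<lambda>x. (f x)\<^sup>2)}"

definition L2_inner :: "'a measure \<Rightarrow> ('a \<Rightarrow> real) \<Rightarrow> ('a \<Rightarrow> real) \<Rightarrow> real" where
  "L2_inner \<nu> f g = (\<integral>x. f x * g x \<partial>\<nu>)"

definition L2_norm :: "'a measure \<Rightarrow> ('a \<Rightarrow> real) \<Rightarrow> real" where
  "L2_norm \<nu> f = sqrt (L2_inner \<nu> f f)"

definition Linf_enorm :: "'a measure \<Rightarrow> ('a \<Rightarrow> real) \<Rightarrow> ereal" where
  "Linf_enorm \<nu> f = esssup \<nu> (\<lambda>x. ereal \<bar>f x\<bar>)"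

definition Linf_space :: "'a measure \<Rightarrow> ('a \<Rightarrow> real) set" where
  "Linf_space \<nu> = {f \<in> borel_measurable \<nu>. Linf_enorm \<nu> f < \<infinity>}"

definition Linf_norm :: "'a measure \<Rightarrow> ('a \<Rightarrow> real) \<Rightarrow> real" where
  "Linf_norm \<nu> f = real_of_ereal (Linf_enorm \<nu> f)"

definition bounded_embedding ::
  "('a \<Rightarrow> real) set \<Rightarrow> (('a \<Rightarrow> real) \<Rightarrow> real) \<Rightarrow>
   ('a \<Rightarrow> real) set \<Rightarrow> (('a \<Rightarrow> real) \<Rightarrow> real) \<Rightarrow> bool" where
  "bounded_embedding V N W M \<longleftrightarrow> V \<subseteq> W \<and> (\<exists>C. \<forall>f\<in>V. M f \<le> C * N f)"

definition compact_embedding ::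
  "('a \<Rightarrow> real) set \<Rightarrow> (('a \<Rightarrow> real) \<Rightarrow> real) \<Rightarrow>
   ('a \<Rightarrow> real) set \<Rightarrow> (('a \<Rightarrow> real) \<Rightarrow> real) \<Rightarrow> bool" where
  "compact_embedding V N W M \<longleftrightarrow>
     bounded_embedding V N W M \<and>
     (\<forall>f :: nat \<Rightarrow> 'a \<Rightarrow> real. \<forall>B. (\<forall>n. f n \<in> V \<and> N (f n) \<le> B) \<longrightarrow>
        (\<exists>r g. strict_mono r \<and> g \<in> W \<and> (\<lambda>n. M (\<lambda>x. f (r n) x - g x)) \<longlonglongrightarrow> 0))"

text \<open>
  Functions on \<open>X\<close> are represented by their extension by \<open>0\<close>, so that equality of
  functions on \<open>X\<close> is HOL equality.
\<close>

definition kernel_section :: "'a set \<Rightarrow> ('a \<Rightarrow> 'a \<Rightarrow> real) \<Rightarrow> 'a \<Rightarrow> 'a \<Rightarrow> real" where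
  "kernel_section X K x = (\<lambda>y. if y \<in> X then K x y else 0)"

definition hilbert_function_space ::
  "'a set \<Rightarrow> ('a \<Rightarrow> real) set \<Rightarrow> (('a \<Rightarrow> real) \<Rightarrow> ('a \<Rightarrow> real) \<Rightarrow> real) \<Rightarrow> bool" where
  "hilbert_function_space X H ip \<longleftrightarrow>
     (\<forall>f\<in>H. \<forall>x. x \<notin> X \<longrightarrow> f x = 0) \<and>
     (\<lambda>x. 0) \<in> H \<and>
     (\<forall>f\<in>H. \<forall>g\<in>H. (\<lambda>x. f x + g x) \<in> H) \<and>
     (\<forall>c. \<forall>f\<in>H. (\<lambda>x. c * f x) \<in> H) \<and>
     (\<forall>f\<in>H. \<forall>g\<in>H. ip f g = ip g f) \<and>
     (\<forall>f\<in>H. \<forall>g\<in>H. \<forall>h\<in>H. ip (\<lambda>x. f x + g x) h = ip f h + ip g h) \<and>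
     (\<forall>c. \<forall>f\<in>H. \<forall>g\<in>H. ip (\<lambda>x. c * f x) g = c * ip f g) \<and>
     (\<forall>f\<in>H. ip f f \<ge> 0 \<and> (ip f f = 0 \<longrightarrow> f = (\<lambda>x. 0))) \<and>
     (\<forall>f :: nat \<Rightarrow> 'a \<Rightarrow> real.
        (\<forall>n. f n \<in> H) \<and>
        (\<forall>r>0. \<exists>N. \<forall>m\<ge>N. \<forall>n\<ge>N.
           sqrt (ip (\<lambda>x. f m x - f n x) (\<lambda>x. f m x - f n x)) < r) \<longrightarrow>
        (\<exists>g\<in>H. (\<lambda>n. sqrt (ip (\<lambda>x. f n x - g x) (\<lambda>x. f n x - g x))) \<longlonglongrightarrow> 0))"

definition rkhs ::
  "'a set \<Rightarrow> ('a \<Rightarrow> 'a \<Rightarrow> real) \<Rightarrow> ('a \<Rightarrow> real) set \<Rightarrow>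
   (('a \<Rightarrow> real) \<Rightarrow> ('a \<Rightarrow> real) \<Rightarrow> real) \<Rightarrow> bool" where
  "rkhs X K H ip \<longleftrightarrow>
     hilbert_function_space X H ip \<and>
     (\<forall>x\<in>X. kernel_section X K x \<in> H \<and> (\<forall>f\<in>H. ip f (kernel_section X K x) = f x))"

definition separable_fun_space ::
  "('a \<Rightarrow> real) set \<Rightarrow> (('a \<Rightarrow> real) \<Rightarrow> ('a \<Rightarrow> real) \<Rightarrow> real) \<Rightarrow> bool" where
  "separable_fun_space H ip \<longleftrightarrow>
     (\<exists>D. countable D \<and> D \<subseteq> H \<and>
        (\<forall>f\<in>H. \<forall>r>0. \<exists>g\<in>D. sqrt (ip (\<lambda>x. f x - g x) (\<lambda>x. f x - g x)) < r))"

definition strictly_pos_def_radial :: "'a::euclidean_space itself \<Rightarrow> (real \<Rightarrow> real) \<Rightarrow> bool" where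
  "strictly_pos_def_radial _ \<kappa> \<longleftrightarrow>
     (\<forall>(S :: 'a set) c. finite S \<and> (\<exists>x\<in>S. c x \<noteq> 0) \<longrightarrow>
        (\<Sum>x\<in>S. \<Sum>y\<in>S. c x * c y * \<kappa> (norm (x - y))) > 0)"

text \<open>
  \<open>S\<^sub>\<nu>\<close> and \<open>T\<^sub>\<nu> = I\<^sub>\<nu> S\<^sub>\<nu>\<close> are given by the same formula; they differ only in
  whether the result is viewed in the RKHS or in \<open>L\<^sup>2(\<nu>)\<close>.
\<close>

definition integral_operator ::
  "'a measure \<Rightarrow> ('a \<Rightarrow> 'a \<Rightarrow> real) \<Rightarrow> ('a \<Rightarrow> real) \<Rightarrow> 'a \<Rightarrow> real" where
  "integral_operator \<nu> K f = (\<lambda>x. \<integral>y. K x y * f y \<partial>\<nu>)"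

definition L2_nuclear :: "'a measure \<Rightarrow> (('a \<Rightarrow> real) \<Rightarrow> 'a \<Rightarrow> real) \<Rightarrow> bool" where
  "L2_nuclear \<nu> T \<longleftrightarrow>
     (\<exists>a b :: nat \<Rightarrow> 'a \<Rightarrow> real.
        (\<forall>j. a j \<in> L2_space \<nu> \<and> b j \<in> L2_space \<nu>) \<and>
        summable (\<lambda>j. L2_norm \<nu> (a j) * L2_norm \<nu> (b j)) \<and>
        (\<forall>f\<in>L2_space \<nu>. T f \<in> L2_space \<nu> \<and>
           (\<lambda>n. L2_norm \<nu> (\<lambda>x. T f x - (\<Sum>j<n. L2_inner \<nu> (a j) f * b j x))) \<longlonglongrightarrow> 0))"

definition spectral_representation ::
  "'a measure \<Rightarrow> (('a \<Rightarrow> real) \<Rightarrow> 'a \<Rightarrow> real) \<Rightarrow> (nat \<Rightarrow> real) \<Rightarrow> (nat \<Rightarrow> 'a \<Rightarrow> real) \<Rightarrow> bool" where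
  "spectral_representation \<nu> T \<mu> e \<longleftrightarrow>
     (\<forall>j\<ge>1. \<mu> j > 0) \<and>
     antimono_on {1..} \<mu> \<and>
     (\<forall>j\<ge>1. e j \<in> L2_space \<nu>) \<and>
     (\<forall>i\<ge>1. \<forall>j\<ge>1. L2_inner \<nu> (e i) (e j) = (if i = j then 1 else 0)) \<and>
     (\<forall>f\<in>L2_space \<nu>. T f \<in> L2_space \<nu> \<and>
        (\<lambda>n. L2_norm \<nu> (\<lambda>x. T f x - (\<Sum>j=1..n. \<mu> j * L2_inner \<nu> (e j) f * e j x))) \<longlonglongrightarrow> 0)"

definition index_function :: "(real \<Rightarrow> real) \<Rightarrow> bool" where
  "index_function \<phi> \<longleftrightarrow>
     mono_on {0..} \<phi> \<and> (\<forall>t\<ge>0. \<phi> t \<ge> 0) \<and> continuous_on {0..} \<phi> \<and> \<phi> 0 = 0"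

definition Delta2 :: "(real \<Rightarrow> real) \<Rightarrow> real \<Rightarrow> real \<Rightarrow> bool" where
  "Delta2 \<xi> D1 D2 \<longleftrightarrow> (\<forall>t>0. D1 * \<xi> t \<le> \<xi> (2 * t) \<and> \<xi> (2 * t) \<le> D2 * \<xi> t)"

text \<open>
  For \<open>\<phi>\<close> nondecreasing and positive on the eigenvalues the weights \<open>1 / \<phi> (\<mu> i)\<close> are
  bounded below, so the space below is already complete for its seminorm; identifying functions at
  seminorm distance \<open>0\<close> thus yields its completion.
\<close>

definition scale_space ::
  "'a measure \<Rightarrow> (nat \<Rightarrow> real) \<Rightarrow> (nat \<Rightarrow> 'a \<Rightarrow> real) \<Rightarrow> (real \<Rightarrow> real) \<Rightarrow> ('a \<Rightarrow> real) set" where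
  "scale_space \<nu> \<mu> e \<phi> =
     {f \<in> L2_space \<nu>. (\<lambda>i. (L2_inner \<nu> f (e i))\<^sup>2 / \<phi> (\<mu> i)) summable_on {1..}}"

definition scale_inner ::
  "'a measure \<Rightarrow> (nat \<Rightarrow> real) \<Rightarrow> (nat \<Rightarrow> 'a \<Rightarrow> real) \<Rightarrow> (real \<Rightarrow> real) \<Rightarrow>
   ('a \<Rightarrow> real) \<Rightarrow> ('a \<Rightarrow> real) \<Rightarrow> real" where
  "scale_inner \<nu> \<mu> e \<phi> f g =
     (\<Sum>\<^sub>\<infinity>i\<in>{1..}. L2_inner \<nu> f (e i) * L2_inner \<nu> g (e i) / \<phi> (\<mu> i))"

definition scale_norm ::
  "'a measure \<Rightarrow> (nat \<Rightarrow> real) \<Rightarrow> (nat \<Rightarrow> 'a \<Rightarrow> real) \<Rightarrow> (real \<Rightarrow> real) \<Rightarrow> ('a \<Rightarrow> real) \<Rightarrow> real" where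
  "scale_norm \<nu> \<mu> e \<phi> f = sqrt (scale_inner \<nu> \<mu> e \<phi> f f)"

definition weakly_embedded ::
  "'a measure \<Rightarrow> (nat \<Rightarrow> real) \<Rightarrow> (nat \<Rightarrow> 'a \<Rightarrow> real) \<Rightarrow> (real \<Rightarrow> real) \<Rightarrow>
   ('a \<Rightarrow> real) set \<Rightarrow> (('a \<Rightarrow> real) \<Rightarrow> real) \<Rightarrow> bool" where
  "weakly_embedded \<nu> \<mu> e \<psi> W M \<longleftrightarrow>
     (\<forall>\<epsilon>>0. compact_embedding
        (scale_space \<nu> \<mu> e (\<lambda>t. \<psi> t powr (1 + \<epsilon>)))
        (scale_norm \<nu> \<mu> e (\<lambda>t. \<psi> t powr (1 + \<epsilon>))) W M)"

definition generalized_inverse :: "(real \<Rightarrow> real) \<Rightarrow> real \<Rightarrow> real" where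
  "generalized_inverse \<psi> y = Inf {t. t \<ge> 0 \<and> \<psi> t \<ge> y}"

definition sup_norm_growth :: "'a measure \<Rightarrow> (nat \<Rightarrow> 'a \<Rightarrow> real) \<Rightarrow> nat \<Rightarrow> ereal" where
  "sup_norm_growth \<nu> e n =
     (SUP c \<in> {c :: nat \<Rightarrow> real. (\<Sum>i=1..n. (c i)\<^sup>2) = 1}.
        Linf_enorm \<nu> (\<lambda>x. \<Sum>i=1..n. c i * e i x))"

definition covering_radius :: "'a::metric_space set \<Rightarrow> nat \<Rightarrow> real" where
  "covering_radius Y n =
     Inf {\<epsilon>. \<epsilon> > 0 \<and> (\<exists>c :: nat \<Rightarrow> 'a. (\<forall>i<n. c i \<in> Y) \<and> Y \<subseteq> (\<Union>i<n. cball (c i) \<epsilon>))}"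

text \<open>
  \<open>F\<close> is the Fourier transform of \<open>x \<mapsto> \<kappa> \<parallel>x\<parallel>\<close> on \<open>'a\<close> as a function of the
  radius, with the convention \<open>\<integral> f(x) exp (- \<i> \<langle>\<xi>, x\<rangle>) dx\<close>.  Only the values of
  \<open>F\<close> on \<open>[0, \<infinity>)\<close> are determined.
\<close>

definition radial_fourier :: "'a::euclidean_space itself \<Rightarrow> (real \<Rightarrow> real) \<Rightarrow> (real \<Rightarrow> real) \<Rightarrow> bool" where
  "radial_fourier _ \<kappa> F \<longleftrightarrow>
     integrable lebesgue (\<lambda>x::'a. \<kappa> (norm x)) \<and>
     (\<forall>\<xi>::'a. complex_of_real (F (norm \<xi>)) =
        (\<integral>x. complex_of_real (\<kappa> (norm x)) * exp (- \<i> * complex_of_real (\<xi> \<bullet> x)) \<partial>lebesgue))"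

definition dilation_fun :: "(real \<Rightarrow> real) \<Rightarrow> real \<Rightarrow> real" where
  "dilation_fun h t = (SUP s\<in>{1<..}. h (s * t) / h s)"

text \<open>
  The index of \<open>h\<close> along the filter \<open>A\<close> (\<open>at_right 0\<close> for \<open>\<alpha>\<^sub>h\<close>, \<open>at_top\<close>
  for \<open>\<beta>\<^sub>h\<close>) exists and equals the real number \<open>a\<close>.  The boundedness clause says
  that the real-valued supremum in \<open>dilation_fun\<close> is a genuine one.
\<close>

definition has_dilation_index :: "(real \<Rightarrow> real) \<Rightarrow> real filter \<Rightarrow> real \<Rightarrow> bool" where
  "has_dilation_index h A a \<longleftrightarrow>
     (\<forall>\<^sub>F t in A. bdd_above ((\<lambda>s. h (s * t) / h s) ` {1<..})) \<and>
     ((\<lambda>t. ln (dilation_fun h t) / ln t) \<longlongrightarrow> a) A"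

end

theory Submission
  imports Defs
begin

text \<open>
  The upper bound is elementary. If \<open>f\<close> lies in the span of \<open>e 1, \<dots>, e n\<close> and has unit
  \<open>L\<^sup>2\<close>-norm, its norm in the space of index \<open>\<psi> powr (1 + \<epsilon>)\<close> is at most
  \<open>\<psi> (\<mu> n) powr (- (1 + \<epsilon>) / 2)\<close>, so the embedding into \<open>L\<^sup>\<infinity>\<close> bounds its sup-norm by a
  multiple of that (\<open>sup_norm_growth_le_of_embedding\<close>). Comparing with the assumed growth
  \<open>sqrt (s n)\<close> gives \<open>\<psi> (\<mu> n) \<le> C * s n powr (- 1 / (1 + \<epsilon>))\<close>, and since \<open>\<psi>\<close> grows by a
  definite factor under doubling, the constant can be moved inside the inverse of \<open>\<psi>\<close>.

  For the lower bound the condition linking \<open>\<psi>\<close>, \<open>s\<close> and \<open>F\<close> says that \<open>\<psi>\<^sup>-\<^sup>1 (1 / s n)\<close> is of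
  order \<open>n * F (n powr (1 / d)) / s n\<close>. Moreover \<open>s n\<close> is at least of order \<open>n\<close>, because
  \<open>\<Sum>i\<le>n. (e i)\<^sup>2\<close> has integral \<open>n\<close> and is bounded by the square of the sup-norm growth
  (\<open>dim_le_sup_norm_growth_squared\<close>). Hence it suffices to show that \<open>\<mu> n\<close> is at least of order
  \<open>F (n powr (1 / d))\<close>. This is \<open>eigenvalue_ge_fourier\<close>, a min-max argument with test functions
  adapted to the density \<open>p\<close> of \<open>\<nu>\<close>:

  \<^item> On some compact set \<open>A\<close> of positive Lebesgue measure the density is at least some \<open>\<delta> > 0\<close>. A
  cover of \<open>closure X\<close> by \<open>N\<close> balls of radius \<open>\<sigma>\<close> of order \<open>N powr (- 1 / d)\<close> contains a number
  of balls proportional to \<open>N\<close> that are pairwise \<open>L * \<sigma>\<close>-separated and meet \<open>A\<close> in sets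
  \<open>E j\<close> of measure at least of order \<open>\<sigma> ^ d\<close> (\<open>ex_separated_balls_with_mass\<close>).

  \<^item> For \<open>h = (\<Sum>j. c j * indicator (E j))\<close> and \<open>f = h / p\<close>, the density cancels:
  \<open>\<langle>T f, f\<rangle>\<close> is the double integral of \<open>\<kappa> \<bar>x - y\<bar> * h x * h y\<close> against Lebesgue measure, while
  the squared norm of \<open>f\<close> is at most \<open>1 / \<delta>\<close> times that of \<open>h\<close>.

  \<^item> Finiteness of the lower dilation index of \<open>F\<close> gives polynomial decay at most, hence
  \<open>F r \<ge> b * F R * exp (- (r / R)\<^sup>2 / 2)\<close> (\<open>ex_gaussian_minorant\<close>). Subtracting the Gaussian with
  this Fourier transform from the kernel leaves a function with nonnegative Fourier transform, which
  defines a positive semidefinite form. So the form of the kernel dominates a multiple of a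
  Gaussian form of width \<open>\<sigma> = 1 / R\<close> (\<open>quadratic_form_ge_gauss\<close>).

  \<^item> The Gaussian form is diagonally dominant on functions that are constant on well separated
  sets, so it is at least a multiple of \<open>\<Sum>j. (c j)\<^sup>2 * (measure lborel (E j))\<^sup>2\<close>
  (\<open>gauss_form_step_ge\<close>).

  \<^item> With at least \<open>n\<close> sets \<open>E j\<close> the coefficients \<open>c\<close> can be chosen so that \<open>f\<close> is
  nonzero and orthogonal to \<open>e 1, \<dots>, e (n - 1)\<close>, and then \<open>\<langle>T f, f\<rangle> \<le> \<mu> n * \<langle>f, f\<rangle>\<close>
  (\<open>rayleigh_quotient_le_eigenvalue\<close>).
\<close>

section \<open>Homogeneous linear systems\<close>

text \<open>
  Gaussian elimination: an unknown \<open>q\<close> with nonzero coefficient in the equation \<open>k\<close> is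
  expressed through the others, which removes one equation and one unknown.
\<close>

lemma homogeneous_system_has_nonzero_solution:
  fixes a :: "'i \<Rightarrow> 'j \<Rightarrow> real"
  assumes "finite I" "finite J" "card I < card J"
  shows "\<exists>c. (\<exists>j\<in>J. c j \<noteq> 0) \<and> (\<forall>i\<in>I. (\<Sum>j\<in>J. a i j * c j) = 0)"
  using assms
proof (induction I arbitrary: J a rule: finite_induct)
  case empty
  then obtain j where "j \<in> J" by fastforce
  then show ?case by (intro exI[of _ "\<lambda>_. 1"]) auto
next
  case (insert k I)
  show ?case
  proof (cases "\<forall>j\<in>J. a k j = 0")
    case True
    from insert have "card I < card J" by simp
    from insert.IH[OF insert.prems(1) this, of a] obtain c where
      c: "\<exists>j\<in>J. c j \<noteq> 0" "\<forall>i\<in>I. (\<Sum>j\<in>J. a i j * c j) = 0" by blast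
    with True show ?thesis by (intro exI[of _ c]) auto
  next
    case False
    then obtain q where q: "q \<in> J" "a k q \<noteq> 0" by blast
    define J' where "J' = J - {q}"
    have J': "finite J'" "card I < card J'" "q \<notin> J'" "J = insert q J'"
      using insert q by (auto simp: J'_def)
    from insert.IH[OF J'(1,2), of "\<lambda>i j. a i j - a i q * a k j / a k q"] obtain c where
      c: "\<exists>j\<in>J'. c j \<noteq> 0" "\<forall>i\<in>I. (\<Sum>j\<in>J'. (a i j - a i q * a k j / a k q) * c j) = 0" by blast
    define c' where "c' = c(q := - (\<Sum>j\<in>J'. a k j * c j) / a k q)"
    have s: "(\<Sum>j\<in>J'. a i j * c' j) = (\<Sum>j\<in>J'. a i j * c j)" for i
      using J' by (intro sum.cong) (auto simp: c'_def)
    have *: "(\<Sum>j\<in>J. a i j * c' j) = (\<Sum>j\<in>J'. (a i j - a i q * a k j / a k q) * c j)" for i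
    proof -
      have "(\<Sum>j\<in>J. a i j * c' j) = a i q * c' q + (\<Sum>j\<in>J'. a i j * c j)"
        using J' s by simp
      also have "a i q * c' q = - (\<Sum>j\<in>J'. a i q * a k j / a k q * c j)"
        unfolding c'_def by (simp add: sum_distrib_left sum_divide_distrib mult_ac)
      finally show ?thesis
        by (simp add: left_diff_distrib sum_subtractf)
    qed
    have "(\<Sum>j\<in>J. a k j * c' j) = 0"
      unfolding * using q by simp
    moreover have "\<exists>j\<in>J. c' j \<noteq> 0"
      using c(1) J' by (auto simp: c'_def)
    ultimately show ?thesis using c(2) * by (intro exI[of _ c']) auto
  qed
qed

section \<open>Fourier transforms of Gaussians\<close>

text \<open>
  A Gaussian of width \<open>1 / R\<close>, normalised to \<open>1\<close> at the origin: with this normalisation its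
  Fourier transform is a multiple of \<open>gauss (1 / R)\<close>, and it multiplies over orthogonal coordinates.
\<close>

definition gauss :: "real \<Rightarrow> 'a::euclidean_space \<Rightarrow> real" where
  "gauss R x = exp (- ((R * norm x)\<^sup>2 / 2))"

lemma borel_measurable_cis [measurable]: "cis \<in> borel_measurable borel"
  unfolding cis_conv_exp by measurable

lemma borel_measurable_gauss [measurable]: "gauss R \<in> borel_measurable borel"
  unfolding gauss_def by measurable

lemma gauss_pos: "0 < gauss R x"
  by (simp add: gauss_def)

text \<open>
  Up to scaling this is the characteristic function of the standard normal distribution.
\<close>

lemma fourier_gauss_real:
  assumes "R > 0"
  shows "integrable lborel (\<lambda>x. exp (- ((R * x)\<^sup>2 / 2)) *\<^sub>R cis (- (t * x)))"
    and "(\<integral>x. exp (- ((R * x)\<^sup>2 / 2)) *\<^sub>R cis (- (t * x)) \<partial>lborel)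
           = of_real (sqrt (2 * pi) / R * exp (- ((t / R)\<^sup>2 / 2)))"
proof -
  have i: "integrable lborel (\<lambda>x::real. exp (- (x\<^sup>2 / 2)))"
  proof -
    have "integrable lborel (\<lambda>x. sqrt (2 * pi) * std_normal_density x)"
      by (intro integrable_mult_right) (simp add: integrable_normal_density)
    then show ?thesis by (simp add: std_normal_density_def)
  qed
  have i1: "integrable lborel (\<lambda>x. exp (- ((R * x)\<^sup>2 / 2)))"
    using lborel_integrable_real_affine[OF i, of R 0] assms by simp
  have "integrable lborel (\<lambda>x. norm (exp (- ((R * x)\<^sup>2 / 2)) *\<^sub>R cis (- (t * x))))"
    using i1 by simp
  then show "integrable lborel (\<lambda>x. exp (- ((R * x)\<^sup>2 / 2)) *\<^sub>R cis (- (t * x)))"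
    by (rule integrable_norm_cancel) (auto simp: cis_conv_exp)
  have "(\<integral>x. exp (- (x\<^sup>2 / 2)) *\<^sub>R cis (u * x) \<partial>lborel) = of_real (sqrt (2 * pi) * exp (- (u\<^sup>2 / 2)))" for u
  proof -
    have "of_real (exp (- (u\<^sup>2 / 2))) = char std_normal_distribution u"
      by (simp add: char_std_normal_distribution)
    also have "\<dots> = (\<integral>x. std_normal_density x *\<^sub>R iexp (u * x) \<partial>lborel)"
      unfolding char_def by (subst integral_density) auto
    also have "\<dots> = (1 / sqrt (2 * pi)) *\<^sub>R (\<integral>x. exp (- (x\<^sup>2 / 2)) *\<^sub>R cis (u * x) \<partial>lborel)"
      by (subst integral_scaleR_right[symmetric])
         (auto intro!: Bochner_Integration.integral_cong simp: std_normal_density_def cis_conv_exp)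
    finally have "sqrt (2 * pi) *\<^sub>R complex_of_real (exp (- (u\<^sup>2 / 2))) =
        (sqrt (2 * pi) * (1 / sqrt (2 * pi))) *\<^sub>R (\<integral>x. exp (- (x\<^sup>2 / 2)) *\<^sub>R cis (u * x) \<partial>lborel)"
      by (simp only: scaleR_scaleR)
    then show ?thesis
      by (simp add: scaleR_conv_of_real)
  qed
  note * = this
  have "(\<integral>x. exp (- ((R * x)\<^sup>2 / 2)) *\<^sub>R cis (- (t * x)) \<partial>lborel) =
      (1 / R) *\<^sub>R (\<integral>x. exp (- (x\<^sup>2 / 2)) *\<^sub>R cis (- (t / R) * x) \<partial>lborel)"
    by (subst lborel_integral_real_affine[of "1 / R" _ 0]) (use assms in auto)
  then show "(\<integral>x. exp (- ((R * x)\<^sup>2 / 2)) *\<^sub>R cis (- (t * x)) \<partial>lborel)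
           = of_real (sqrt (2 * pi) / R * exp (- ((t / R)\<^sup>2 / 2)))"
    unfolding * by (simp add: scaleR_conv_of_real)
qed

lemma gauss_eq_prod: "gauss R x = (\<Prod>b\<in>Basis. exp (- ((R * (x \<bullet> b))\<^sup>2 / 2)))"
proof -
  have "(norm x)\<^sup>2 = (\<Sum>b\<in>Basis. (x \<bullet> b)\<^sup>2)"
    unfolding power2_norm_eq_inner by (subst euclidean_inner) (simp add: power2_eq_square)
  then show ?thesis
    by (simp add: gauss_def exp_sum[symmetric] power_mult_distrib sum_distrib_left sum_divide_distrib sum_negf)
qed

text \<open>
  Gaussian and character both factor over the coordinates, so the integral is a product of
  one-dimensional ones.
\<close>

lemma fourier_gauss:
  fixes t :: "'a::euclidean_space"
  assumes "R > 0"
  shows "integrable lborel (\<lambda>x::'a. gauss R x *\<^sub>R cis (- (t \<bullet> x)))"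
    and "(\<integral>x. gauss R x *\<^sub>R cis (- (t \<bullet> x)) \<partial>lborel)
           = of_real ((sqrt (2 * pi) / R) ^ DIM('a) * gauss (1 / R) t)"
proof -
  interpret P: product_sigma_finite "\<lambda>_::'a. lborel :: real measure" ..
  have cis_sum: "cis (sum f A) = (\<Prod>b\<in>A. cis (f b))" if "finite A" for f and A :: "'a set"
    using that by (induction A rule: finite_induct) (auto simp: cis_mult[symmetric])
  have eq: "gauss R x *\<^sub>R cis (- (t \<bullet> x)) =
     (\<Prod>b\<in>Basis. exp (- ((R * (x \<bullet> b))\<^sup>2 / 2)) *\<^sub>R cis (- ((t \<bullet> b) * (x \<bullet> b))))" for x
    unfolding scaleR_conv_of_real
    by (subst euclidean_inner) (simp add: gauss_eq_prod prod.distrib cis_sum sum_negf[symmetric])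
  have *: "((\<Sum>b\<in>Basis. f b *\<^sub>R b) \<bullet> c) = f c" if "c \<in> Basis" for f and c :: 'a
    using that by (simp add: inner_sum_left inner_Basis if_distrib sum.delta cong: if_cong)
  have int: "integrable lborel (\<lambda>x. exp (- ((R * x)\<^sup>2 / 2)) *\<^sub>R cis (- ((t \<bullet> b) * x)))" for b
    using fourier_gauss_real[OF assms] by blast
  show "integrable lborel (\<lambda>x::'a. gauss R x *\<^sub>R cis (- (t \<bullet> x)))"
    unfolding eq
    by (subst lborel_eq, subst integrable_distr_eq)
       (auto simp: * intro!: P.product_integrable_prod int cong: prod.cong)
  show "(\<integral>x. gauss R x *\<^sub>R cis (- (t \<bullet> x)) \<partial>lborel)
           = of_real ((sqrt (2 * pi) / R) ^ DIM('a) * gauss (1 / R) t)"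
    unfolding eq
    apply (subst lborel_eq, subst integral_distr)
      apply (simp_all add: * cong: prod.cong)
    apply (subst P.product_integral_prod)
      apply (simp_all add: int fourier_gauss_real(2)[OF assms] del: of_real_mult of_real_divide)
    apply (simp add: prod.distrib prod_dividef gauss_eq_prod power_divide)
    done
qed

lemma integrable_gauss:
  assumes "R > 0"
  shows "integrable lborel (gauss R :: 'a::euclidean_space \<Rightarrow> real)"
proof -
  have "integrable lborel (\<lambda>x::'a. norm (gauss R x *\<^sub>R cis (- (0 \<bullet> x))))"
    using fourier_gauss(1)[OF assms] by (rule integrable_norm)
  then show ?thesis by (simp add: gauss_pos less_imp_le)
qed

lemma integral_gauss:
  assumes "R > 0"
  shows "(\<integral>x. gauss R x \<partial>(lborel :: 'a::euclidean_space measure)) = (sqrt (2 * pi) / R) ^ DIM('a)"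
proof -
  have "complex_of_real (\<integral>x. gauss R x \<partial>(lborel::'a measure)) =
      (\<integral>x. gauss R x *\<^sub>R cis (- (0 \<bullet> x)) \<partial>(lborel::'a measure))"
    by (simp add: scaleR_conv_of_real flip: integral_complex_of_real)
  also have "\<dots> = of_real ((sqrt (2 * pi) / R) ^ DIM('a))"
    by (subst fourier_gauss(2)[OF assms]) (simp add: gauss_def)
  finally show ?thesis by (simp only: of_real_eq_iff)
qed

section \<open>Forms with nonnegative Fourier transform are positive semidefinite\<close>

lemma lborel_integral_affine:
  fixes f :: "'a::euclidean_space \<Rightarrow> 'b::{banach, second_countable_topology}"
  assumes "c \<noteq> 0" and f: "integrable lborel f"
  shows "integrable lborel (\<lambda>x. f (t + c *\<^sub>R x))"
    and "(\<integral>x. f (t + c *\<^sub>R x) \<partial>lborel) = (1 / \<bar>c\<bar> ^ DIM('a)) *\<^sub>R integral\<^sup>L lborel f"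
proof -
  have [measurable]: "f \<in> borel_measurable borel"
    using borel_measurable_integrable[OF f] by simp
  have e: "lborel = density (distr lborel borel (\<lambda>x. t + c *\<^sub>R x)) (\<lambda>_. ennreal (\<bar>c\<bar> ^ DIM('a)))"
    using lborel_affine[OF assms(1), of t] by (simp add: ennreal_power)
  have "integrable (density (distr lborel borel (\<lambda>x. t + c *\<^sub>R x)) (\<lambda>_. ennreal (\<bar>c\<bar> ^ DIM('a)))) f"
    using f e by simp
  then have "integrable lborel (\<lambda>x. \<bar>c\<bar> ^ DIM('a) *\<^sub>R f (t + c *\<^sub>R x))"
    by (subst (asm) integrable_density) (auto simp: integrable_distr_eq)
  then show "integrable lborel (\<lambda>x. f (t + c *\<^sub>R x))"
    using assms(1) integrable_scaleR_right[of "1 / \<bar>c\<bar> ^ DIM('a)" lborel "\<lambda>x. \<bar>c\<bar> ^ DIM('a) *\<^sub>R f (t + c *\<^sub>R x)"]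
    by simp
  have "integral\<^sup>L lborel f = integral\<^sup>L (density (distr lborel borel (\<lambda>x. t + c *\<^sub>R x)) (\<lambda>_. ennreal (\<bar>c\<bar> ^ DIM('a)))) f"
    using e by simp
  also have "\<dots> = \<bar>c\<bar> ^ DIM('a) *\<^sub>R (\<integral>x. f (t + c *\<^sub>R x) \<partial>lborel)"
    by (subst integral_density) (auto simp: integral_distr)
  finally show "(\<integral>x. f (t + c *\<^sub>R x) \<partial>lborel) = (1 / \<bar>c\<bar> ^ DIM('a)) *\<^sub>R integral\<^sup>L lborel f"
    using assms(1) by simp
qed

text \<open>
  A weak form of Fourier inversion. Averaging \<open>D\<close> over a
  Gaussian of small width \<open>r\<close> gives, by self-duality of the Gaussian and Fubini, a Gaussian
  average of \<open>V\<close>, hence a nonnegative number; as \<open>r\<close> tends to \<open>0\<close> these averages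
  tend to a positive multiple of \<open>D 0\<close> by continuity.
\<close>

lemma nonneg_at_0_if_fourier_nonneg:
  fixes D V :: "'a::euclidean_space \<Rightarrow> real"
  assumes D: "integrable lborel D" and bound: "\<And>t. \<bar>D t\<bar> \<le> B" and cont: "isCont D 0"
    and fourier: "\<And>\<xi>. (\<integral>t. D t *\<^sub>R cis (- (\<xi> \<bullet> t)) \<partial>lborel) = of_real (V \<xi>)"
    and nonneg: "\<And>\<xi>. 0 \<le> V \<xi>"
  shows "0 \<le> D 0"
proof -
  note [measurable] = borel_measurable_integrable[OF D, simplified]
  let ?G = "gauss 1 :: 'a \<Rightarrow> real"
  define c where "c = sqrt (2 * pi) ^ DIM('a)"
  have c: "c > 0" by (simp add: c_def)
  have G: "(\<integral>x. ?G x *\<^sub>R cis (- (t \<bullet> x)) \<partial>lborel) = of_real (c * ?G t)" for t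
    using fourier_gauss(2)[of 1 t] by (simp add: c_def)
  have intG: "integrable lborel ?G" by (rule integrable_gauss) simp
  \<comment> \<open>the Gaussian weight is itself written as a Fourier transform, which moves the integral to the
    Fourier side\<close>
  have nonneg_J: "0 \<le> (\<integral>u. ?G u * D (r *\<^sub>R u) \<partial>lborel)" if r: "r > 0" for r :: real
  proof -
    have Dr: "integrable lborel (\<lambda>u. D (r *\<^sub>R u))"
      using lborel_integral_affine(1)[OF _ D, of r 0] r by simp
    have inner: "(\<integral>u. D (r *\<^sub>R u) *\<^sub>R cis (- (\<xi> \<bullet> u)) \<partial>lborel) = of_real (V (\<xi> /\<^sub>R r) / r ^ DIM('a))" for \<xi>
    proof -
      have i: "integrable lborel (\<lambda>t. D t *\<^sub>R cis (- ((\<xi> /\<^sub>R r) \<bullet> t)))"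
        by (rule integrable_norm_cancel) (use D in auto)
      have "(\<integral>u. D (0 + r *\<^sub>R u) *\<^sub>R cis (- ((\<xi> /\<^sub>R r) \<bullet> (0 + r *\<^sub>R u))) \<partial>lborel) =
          (1 / \<bar>r\<bar> ^ DIM('a)) *\<^sub>R (\<integral>t. D t *\<^sub>R cis (- ((\<xi> /\<^sub>R r) \<bullet> t)) \<partial>lborel)"
        using r by (intro lborel_integral_affine(2)[OF _ i]) simp
      moreover have "(\<xi> /\<^sub>R r) \<bullet> (0 + r *\<^sub>R u) = \<xi> \<bullet> u" for u
        using r by simp
      ultimately show ?thesis
        unfolding fourier using r by (simp only:) (simp add: scaleR_conv_of_real)
    qed
    have int2: "integrable (lborel \<Otimes>\<^sub>M lborel)
        (\<lambda>(\<xi>, u). (?G \<xi> * D (r *\<^sub>R u)) *\<^sub>R cis (- (\<xi> \<bullet> u)))"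
    proof (rule lborel_pair.Fubini_integrable)
      show "integrable lborel (\<lambda>\<xi>. \<integral>u. norm (case (\<xi>, u) of (\<xi>, u) \<Rightarrow> (?G \<xi> * D (r *\<^sub>R u)) *\<^sub>R cis (- (\<xi> \<bullet> u))) \<partial>lborel)"
        using intG by (simp add: abs_mult)
      show "AE \<xi> in lborel. integrable lborel (\<lambda>u. case (\<xi>, u) of (\<xi>, u) \<Rightarrow> (?G \<xi> * D (r *\<^sub>R u)) *\<^sub>R cis (- (\<xi> \<bullet> u)))"
        by (intro AE_I2, rule integrable_norm_cancel) (use Dr in \<open>auto simp: abs_mult\<close>)
    qed measurable
    have "complex_of_real (c * (\<integral>u. ?G u * D (r *\<^sub>R u) \<partial>lborel)) =
        (\<integral>u. complex_of_real (D (r *\<^sub>R u)) * of_real (c * ?G u) \<partial>lborel)"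
      by (simp add: mult_ac flip: integral_complex_of_real)
    also have "\<dots> = (\<integral>u. (\<integral>\<xi>. (?G \<xi> * D (r *\<^sub>R u)) *\<^sub>R cis (- (\<xi> \<bullet> u)) \<partial>lborel) \<partial>lborel)"
      unfolding G[symmetric]
      by (intro Bochner_Integration.integral_cong)
         (auto simp: scaleR_conv_of_real mult_ac inner_commute simp flip: integral_mult_right_zero)
    also have "\<dots> = (\<integral>\<xi>. (\<integral>u. (?G \<xi> * D (r *\<^sub>R u)) *\<^sub>R cis (- (\<xi> \<bullet> u)) \<partial>lborel) \<partial>lborel)"
      by (rule lborel_pair.Fubini_integral[OF int2])
    also have "\<dots> = (\<integral>\<xi>. complex_of_real (?G \<xi> * (V (\<xi> /\<^sub>R r) / r ^ DIM('a))) \<partial>lborel)"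
      by (intro Bochner_Integration.integral_cong refl)
         (simp only: inner scaleR_scaleR[symmetric] integral_scaleR_right, simp add: scaleR_conv_of_real)
    also have "\<dots> = of_real (\<integral>\<xi>. ?G \<xi> * (V (\<xi> /\<^sub>R r) / r ^ DIM('a)) \<partial>lborel)"
      by (rule integral_complex_of_real)
    finally have "c * (\<integral>u. ?G u * D (r *\<^sub>R u) \<partial>lborel) = (\<integral>\<xi>. ?G \<xi> * (V (\<xi> /\<^sub>R r) / r ^ DIM('a)) \<partial>lborel)"
      by (simp only: of_real_eq_iff)
    also have "\<dots> \<ge> 0"
      using r by (intro Bochner_Integration.integral_nonneg)
        (auto intro!: mult_nonneg_nonneg divide_nonneg_nonneg nonneg simp: gauss_pos less_imp_le)
    finally show ?thesis using c by (simp add: zero_le_mult_iff)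
  qed
  have lim: "(\<lambda>n. \<integral>u. ?G u * D (inverse (real (Suc n)) *\<^sub>R u) \<partial>lborel) \<longlonglongrightarrow> (\<integral>u. ?G u * D 0 \<partial>lborel)"
  proof (rule integral_dominated_convergence[where w = "\<lambda>u. ?G u * B"])
    show "AE u in lborel. (\<lambda>n. ?G u * D (inverse (real (Suc n)) *\<^sub>R u)) \<longlonglongrightarrow> ?G u * D 0"
    proof (intro AE_I2 tendsto_mult tendsto_const)
      fix u :: 'a
      have "(\<lambda>n. inverse (real (Suc n)) *\<^sub>R u) \<longlonglongrightarrow> 0 *\<^sub>R u"
        by (intro tendsto_scaleR LIMSEQ_inverse_real_of_nat tendsto_const)
      then show "(\<lambda>n. D (inverse (real (Suc n)) *\<^sub>R u)) \<longlonglongrightarrow> D 0"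
        using isCont_tendsto_compose[OF cont] by simp
    qed
    show "AE u in lborel. norm (?G u * D (inverse (real (Suc n)) *\<^sub>R u)) \<le> ?G u * B" for n
      using bound by (auto simp: abs_mult gauss_pos less_imp_le intro!: mult_left_mono)
  qed (use intG in auto)
  have "0 \<le> (\<integral>u. ?G u * D 0 \<partial>lborel)"
    by (rule LIMSEQ_le_const[OF lim]) (auto intro!: exI[of _ 0] nonneg_J)
  also have "\<dots> = c * D 0"
    by (simp add: integral_gauss c_def)
  finally show ?thesis using c by (simp add: zero_le_mult_iff)
qed

lemma integrable_product_fun:
  fixes f :: "'a::euclidean_space \<Rightarrow> real" and g :: "'b::euclidean_space \<Rightarrow> real"
  assumes "integrable lborel f" "integrable lborel g"
  shows "integrable (lborel \<Otimes>\<^sub>M lborel) (\<lambda>p. f (fst p) * g (snd p))"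
proof (rule lborel_pair.Fubini_integrable)
  note [measurable] = assms[THEN borel_measurable_integrable, simplified]
  show "(\<lambda>p. f (fst p) * g (snd p)) \<in> borel_measurable (lborel \<Otimes>\<^sub>M lborel)"
    by measurable
qed (use assms in \<open>auto simp: abs_mult\<close>)

lemma integrable_difference_kernel:
  fixes w f g :: "'a::euclidean_space \<Rightarrow> real"
  assumes w: "integrable lborel w" and f: "integrable lborel f"
    and g [measurable]: "g \<in> borel_measurable borel" and B: "\<And>x. \<bar>g x\<bar> \<le> B"
  shows "integrable (lborel \<Otimes>\<^sub>M lborel) (\<lambda>p. w (fst p - snd p) * (f (fst p) * g (snd p)))"
proof (rule lborel_pair.Fubini_integrable)
  note [measurable] = w[THEN borel_measurable_integrable, simplified] f[THEN borel_measurable_integrable, simplified]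
  show m [measurable]: "(\<lambda>p. w (fst p - snd p) * (f (fst p) * g (snd p))) \<in> borel_measurable (lborel \<Otimes>\<^sub>M lborel)"
    by measurable
  have wx: "integrable lborel (\<lambda>y. w (x - y))" and wx': "(\<integral>y. \<bar>w (x - y)\<bar> \<partial>lborel) = (\<integral>y. \<bar>w y\<bar> \<partial>lborel)" for x
    using lborel_integral_affine[OF _ w, of "-1" x] lborel_integral_affine[OF _ integrable_abs[OF w], of "-1" x]
    by simp_all
  have i: "integrable lborel (\<lambda>y. w (x - y) * (f x * g y))" for x
  proof (rule Bochner_Integration.integrable_bound)
    show "integrable lborel (\<lambda>y. w (x - y) * (f x * B))" using wx by simp
    show "AE y in lborel. norm (w (x - y) * (f x * g y)) \<le> norm (w (x - y) * (f x * B))"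
      using B by (intro AE_I2) (auto simp: abs_mult intro!: mult_left_mono intro: order_trans[OF _ abs_ge_self])
  qed measurable
  then show "AE x in lborel. integrable lborel (\<lambda>y. w (fst (x, y) - snd (x, y)) * (f (fst (x, y)) * g (snd (x, y))))"
    by simp
  show "integrable lborel (\<lambda>x. \<integral>y. norm (w (fst (x, y) - snd (x, y)) * (f (fst (x, y)) * g (snd (x, y)))) \<partial>lborel)"
  proof (rule Bochner_Integration.integrable_bound)
    show "integrable lborel (\<lambda>x. \<bar>f x\<bar> * (B * (\<integral>y. \<bar>w y\<bar> \<partial>lborel)))" using f by simp
    show "AE x in lborel. norm (\<integral>y. norm (w (fst (x, y) - snd (x, y)) * (f (fst (x, y)) * g (snd (x, y)))) \<partial>lborel)
       \<le> norm (\<bar>f x\<bar> * (B * (\<integral>y. \<bar>w y\<bar> \<partial>lborel)))"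
    proof (rule AE_I2)
      fix x
      have "(\<integral>y. \<bar>w (x - y) * (f x * g y)\<bar> \<partial>lborel) \<le> (\<integral>y. \<bar>w (x - y)\<bar> * (\<bar>f x\<bar> * B) \<partial>lborel)"
        using B integrable_abs[OF i[of x]] wx[of x] by (intro integral_mono) (auto simp: abs_mult intro!: mult_left_mono)
      also have "\<dots> = \<bar>f x\<bar> * (B * (\<integral>y. \<bar>w y\<bar> \<partial>lborel))"
        using wx' by simp
      finally show "norm (\<integral>y. norm (w (fst (x, y) - snd (x, y)) * (f (fst (x, y)) * g (snd (x, y)))) \<partial>lborel)
       \<le> norm (\<bar>f x\<bar> * (B * (\<integral>y. \<bar>w y\<bar> \<partial>lborel)))"
        by simp
    qed
  qed measurable
qed

text \<open>
  The form is the value at \<open>0\<close> of \<open>D\<close>, the convolution of \<open>w\<close> with the autocorrelation of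
  \<open>h\<close>, whose Fourier transform is \<open>W\<close> times the squared modulus of that of \<open>h\<close>. Continuity of
  \<open>h\<close> makes \<open>D\<close> continuous.
\<close>

lemma fourier_nonneg_imp_quadratic_form_nonneg_continuous:
  fixes w W h :: "'a::euclidean_space \<Rightarrow> real"
  assumes w: "integrable lborel w"
    and fourier: "\<And>\<xi>. (\<integral>z. w z *\<^sub>R cis (- (\<xi> \<bullet> z)) \<partial>lborel) = of_real (W \<xi>)" "\<And>\<xi>. 0 \<le> W \<xi>"
    and h: "continuous_on UNIV h" "integrable lborel h" and B: "\<And>x. \<bar>h x\<bar> \<le> B"
  shows "0 \<le> (\<integral>p. w (fst p - snd p) * (h (fst p) * h (snd p)) \<partial>(lborel \<Otimes>\<^sub>M lborel))"
proof -
  note [measurable] = w[THEN borel_measurable_integrable, simplified] h(2)[THEN borel_measurable_integrable, simplified]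
  define D where "D t = (\<integral>p. w (fst p) * (h (fst p + snd p - t) * h (snd p)) \<partial>(lborel :: ('a \<times> 'a) measure))" for t
  have dom: "integrable (lborel :: ('a \<times> 'a) measure) (\<lambda>p. B * (\<bar>w (fst p)\<bar> * \<bar>h (snd p)\<bar>))"
    unfolding lborel_prod[symmetric]
    using integrable_product_fun[OF integrable_abs[OF w] integrable_abs[OF h(2)]] by simp
  have le: "\<bar>w x * (h z * h y)\<bar> \<le> B * (\<bar>w x\<bar> * \<bar>h y\<bar>)" for x y z
  proof -
    have "\<bar>h z\<bar> * (\<bar>w x\<bar> * \<bar>h y\<bar>) \<le> B * (\<bar>w x\<bar> * \<bar>h y\<bar>)"
      using B by (intro mult_right_mono) auto
    then show ?thesis by (simp add: abs_mult mult_ac)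
  qed
  have meas [measurable]: "(\<lambda>p. w (fst p) * (h (fst p + snd p - t) * h (snd p))) \<in> borel_measurable (borel :: ('a \<times> 'a) measure)" for t
    unfolding borel_prod[symmetric] by measurable
  have intD: "integrable (lborel :: ('a \<times> 'a) measure) (\<lambda>p. w (fst p) * (h (fst p + snd p - t) * h (snd p)))" for t
    by (rule Bochner_Integration.integrable_bound[OF dom]) (use le in \<open>auto intro!: AE_I2 intro: order_trans[OF _ abs_ge_self]\<close>)
  have "0 \<le> D 0"
  proof (rule nonneg_at_0_if_fourier_nonneg)
    have pair: "integrable (lborel \<Otimes>\<^sub>M lborel)
      (\<lambda>q. (w (fst (fst q)) * (h (fst (fst q) + snd (fst q) - snd q) * h (snd (fst q)))) *\<^sub>R cis (- (\<xi> \<bullet> snd q)))" for \<xi>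
    proof (rule lborel_pair.Fubini_integrable)
      have ht: "integrable lborel (\<lambda>t. h (x - t))" and ht': "(\<integral>t. \<bar>h (x - t)\<bar> \<partial>lborel) = (\<integral>t. \<bar>h t\<bar> \<partial>lborel)" for x
        using lborel_integral_affine[OF _ h(2), of "-1" x] lborel_integral_affine[OF _ integrable_abs[OF h(2)], of "-1" x]
        by simp_all
      show "integrable lborel (\<lambda>p. \<integral>t. norm ((w (fst (fst (p, t))) * (h (fst (fst (p, t)) + snd (fst (p, t)) - snd (p, t)) *
          h (snd (fst (p, t))))) *\<^sub>R cis (- (\<xi> \<bullet> snd (p, t)))) \<partial>lborel)"
        using integrable_mult_right[OF integrable_product_fun[OF integrable_abs[OF w] integrable_abs[OF h(2)]], of "\<integral>t. \<bar>h t\<bar> \<partial>lborel"]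
        unfolding lborel_prod by (simp add: abs_mult ht' mult_ac)
      show "AE p in lborel. integrable lborel (\<lambda>t. (w (fst (fst (p, t))) * (h (fst (fst (p, t)) + snd (fst (p, t)) - snd (p, t)) *
          h (snd (fst (p, t))))) *\<^sub>R cis (- (\<xi> \<bullet> snd (p, t))))"
        by (intro AE_I2, rule integrable_norm_cancel) (use ht in \<open>auto simp: abs_mult\<close>)
    qed (unfold lborel_prod[symmetric], measurable)
    show "integrable lborel D"
    proof -
      have "integrable lborel (\<lambda>t. \<integral>p. (w (fst p) * (h (fst p + snd p - t) * h (snd p))) *\<^sub>R cis (- (0 \<bullet> t)) \<partial>(lborel :: ('a \<times> 'a) measure))"
        using lborel_pair.integrable_snd[of "\<lambda>p t. (w (fst p) * (h (fst p + snd p - t) * h (snd p))) *\<^sub>R cis (- (0 \<bullet> t))"] pair[of 0]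
        by (simp add: case_prod_beta')
      then have "integrable lborel (\<lambda>t. complex_of_real (D t))"
        by (simp add: D_def scaleR_conv_of_real flip: integral_complex_of_real)
      then show ?thesis by (simp only: complex_of_real_integrable_eq)
    qed
    show "\<bar>D t\<bar> \<le> (\<integral>p. B * (\<bar>w (fst p)\<bar> * \<bar>h (snd p)\<bar>) \<partial>(lborel :: ('a \<times> 'a) measure))" for t
      unfolding D_def by (rule integral_abs_bound[THEN order_trans])
        (intro integral_mono integrable_abs intD dom le)
    show "isCont D 0"
    proof (subst continuous_at_sequentially, intro allI impI)
      fix u :: "nat \<Rightarrow> 'a" assume u: "u \<longlonglongrightarrow> 0"
      have h': "isCont h x" for x using h(1) by (simp add: continuous_on_eq_continuous_at)
      have "(\<lambda>n. D (u n)) \<longlonglongrightarrow> D 0"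
        unfolding D_def
      proof (rule integral_dominated_convergence[OF _ _ dom])
        show "AE p in (lborel :: ('a \<times> 'a) measure). (\<lambda>n. w (fst p) * (h (fst p + snd p - u n) * h (snd p))) \<longlonglongrightarrow> w (fst p) * (h (fst p + snd p - 0) * h (snd p))"
          by (intro AE_I2 tendsto_intros u isCont_tendsto_compose[OF h'])
      qed (use le meas[of 0] in auto)
      then show "(D \<circ> u) \<longlonglongrightarrow> D 0" by (simp add: o_def)
    qed
    show "(\<integral>t. D t *\<^sub>R cis (- (\<xi> \<bullet> t)) \<partial>lborel) = of_real (W \<xi> * (cmod (\<integral>x. h x *\<^sub>R cis (\<xi> \<bullet> x) \<partial>lborel))\<^sup>2)" for \<xi>
    proof -
      define H where "H = (\<integral>x. h x *\<^sub>R cis (\<xi> \<bullet> x) \<partial>lborel)"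
      have "integrable lborel (\<lambda>x. h x *\<^sub>R cis (\<xi> \<bullet> x))"
        by (rule integrable_norm_cancel) (use h in auto)
      then have H: "(\<integral>t. h (x - t) *\<^sub>R cis (- (\<xi> \<bullet> t)) \<partial>lborel) = cis (- (\<xi> \<bullet> x)) * H" for x
      proof -
        assume i: "integrable lborel (\<lambda>x. h x *\<^sub>R cis (\<xi> \<bullet> x))"
        have "H = (\<integral>t. h (x + (-1) *\<^sub>R t) *\<^sub>R cis (\<xi> \<bullet> (x + (-1) *\<^sub>R t)) \<partial>lborel)"
          using lborel_integral_affine(2)[OF _ i, of "-1" x] by (simp add: H_def)
        also have "\<dots> = (\<integral>t. cis (\<xi> \<bullet> x) * (h (x - t) *\<^sub>R cis (- (\<xi> \<bullet> t))) \<partial>lborel)"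
          by (intro Bochner_Integration.integral_cong) (simp_all add: inner_diff_right cis_mult scaleR_conv_of_real)
        also have "\<dots> = cis (\<xi> \<bullet> x) * (\<integral>t. (h (x - t) *\<^sub>R cis (- (\<xi> \<bullet> t))) \<partial>lborel)"
          by (rule integral_mult_right_zero)
        finally have "cis (- (\<xi> \<bullet> x)) * H = (cis (- (\<xi> \<bullet> x)) * cis (\<xi> \<bullet> x)) * (\<integral>t. (h (x - t) *\<^sub>R cis (- (\<xi> \<bullet> t))) \<partial>lborel)"
          by simp
        then show ?thesis by (simp add: cis_mult)
      qed
      have cnjH: "cnj H = (\<integral>x. h x *\<^sub>R cis (- (\<xi> \<bullet> x)) \<partial>lborel)"
        unfolding H_def Bochner_Integration.integral_cnj[symmetric]
        by (intro Bochner_Integration.integral_cong) (auto simp: cis_cnj scaleR_conv_of_real)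
      have "(\<integral>t. D t *\<^sub>R cis (- (\<xi> \<bullet> t)) \<partial>lborel) =
          (\<integral>t. (\<integral>p. (w (fst p) * (h (fst p + snd p - t) * h (snd p))) *\<^sub>R cis (- (\<xi> \<bullet> t)) \<partial>(lborel :: ('a \<times> 'a) measure)) \<partial>lborel)"
        unfolding D_def by (intro Bochner_Integration.integral_cong refl) (rule integral_scaleR_left[OF intD, symmetric])
      also have "\<dots> = (\<integral>p. (\<integral>t. (w (fst p) * (h (fst p + snd p - t) * h (snd p))) *\<^sub>R cis (- (\<xi> \<bullet> t)) \<partial>lborel) \<partial>(lborel :: ('a \<times> 'a) measure))"
        using pair[of \<xi>] by (intro lborel_pair.Fubini_integral) (simp add: case_prod_beta')
      also have "\<dots> = (\<integral>p. H * ((w (fst p) *\<^sub>R cis (- (\<xi> \<bullet> fst p))) * (h (snd p) *\<^sub>R cis (- (\<xi> \<bullet> snd p)))) \<partial>(lborel :: ('a \<times> 'a) measure))"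
      proof (intro Bochner_Integration.integral_cong refl)
        fix p :: "'a \<times> 'a"
        have "(\<integral>t. (w (fst p) * (h (fst p + snd p - t) * h (snd p))) *\<^sub>R cis (- (\<xi> \<bullet> t)) \<partial>lborel) =
            (\<integral>t. (w (fst p) * h (snd p)) *\<^sub>R (h (fst p + snd p - t) *\<^sub>R cis (- (\<xi> \<bullet> t))) \<partial>lborel)"
          by (simp add: mult_ac)
        also have "\<dots> = (w (fst p) * h (snd p)) *\<^sub>R (cis (- (\<xi> \<bullet> (fst p + snd p))) * H)"
          unfolding integral_scaleR_right H ..
        also have "\<dots> = H * ((w (fst p) *\<^sub>R cis (- (\<xi> \<bullet> fst p))) * (h (snd p) *\<^sub>R cis (- (\<xi> \<bullet> snd p))))"
        proof -
          have "- (\<xi> \<bullet> (fst p + snd p)) = - (\<xi> \<bullet> fst p) + - (\<xi> \<bullet> snd p)" by (simp add: inner_add_right)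
          then show ?thesis by (simp only: cis_mult[symmetric]) (simp add: scaleR_conv_of_real mult_ac)
        qed
        finally show "(\<integral>t. (w (fst p) * (h (fst p + snd p - t) * h (snd p))) *\<^sub>R cis (- (\<xi> \<bullet> t)) \<partial>lborel) = \<dots>" .
      qed
      also have "\<dots> = H * (\<integral>p. ((w (fst p) *\<^sub>R cis (- (\<xi> \<bullet> fst p))) * (h (snd p) *\<^sub>R cis (- (\<xi> \<bullet> snd p)))) \<partial>(lborel :: ('a \<times> 'a) measure))"
        by (rule integral_mult_right_zero)
      also have "(\<integral>p. ((w (fst p) *\<^sub>R cis (- (\<xi> \<bullet> fst p))) * (h (snd p) *\<^sub>R cis (- (\<xi> \<bullet> snd p)))) \<partial>(lborel :: ('a \<times> 'a) measure)) =
          (\<integral>x. (\<integral>y. ((w x *\<^sub>R cis (- (\<xi> \<bullet> x))) * (h y *\<^sub>R cis (- (\<xi> \<bullet> y)))) \<partial>lborel) \<partial>lborel)"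
      proof -
        have "integrable (lborel \<Otimes>\<^sub>M lborel :: ('a \<times> 'a) measure) (\<lambda>p. ((w (fst p) *\<^sub>R cis (- (\<xi> \<bullet> fst p))) * (h (snd p) *\<^sub>R cis (- (\<xi> \<bullet> snd p)))))"
          by (rule integrable_norm_cancel)
            (use integrable_abs[OF integrable_product_fun[OF w h(2)]] in \<open>auto simp: abs_mult norm_mult mult_ac\<close>)
        from lborel_pair.integral_fst'[OF this] show ?thesis by (simp add: lborel_prod)
      qed
      also have "\<dots> = of_real (W \<xi>) * cnj H"
        by (simp only: cnjH integral_mult_right_zero integral_mult_left_zero fourier(1))
      finally show ?thesis
        by (simp only: H_def[symmetric] of_real_mult complex_norm_square mult_ac)
    qed
    show "0 \<le> W \<xi> * (cmod (\<integral>x. h x *\<^sub>R cis (\<xi> \<bullet> x) \<partial>lborel))\<^sup>2" for \<xi>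
      using fourier(2) by simp
  qed
  also have "D 0 = (\<integral>y. (\<integral>z. w z * (h (z + y) * h y) \<partial>lborel) \<partial>lborel)"
    using lborel_pair.integral_snd[of "\<lambda>z y. w z * (h (z + y) * h y)"] intD[of 0]
    by (simp add: D_def lborel_prod case_prod_beta')
  also have "\<dots> = (\<integral>y. (\<integral>x. w (x - y) * (h x * h y) \<partial>lborel) \<partial>lborel)"
  proof (rule Bochner_Integration.integral_cong[OF refl])
    fix y
    have i: "integrable lborel (\<lambda>z. w z * (h (z + y) * h y))"
    proof (rule Bochner_Integration.integrable_bound)
      show "integrable lborel (\<lambda>z. B * (\<bar>w z\<bar> * \<bar>h y\<bar>))" using w by simp
    qed (use le in \<open>auto intro!: AE_I2 intro: order_trans[OF _ abs_ge_self]\<close>)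
    show "(\<integral>z. w z * (h (z + y) * h y) \<partial>lborel) = (\<integral>x. w (x - y) * (h x * h y) \<partial>lborel)"
      using lborel_integral_affine(2)[OF _ i, of 1 "- y"] by simp
  qed
  also have "\<dots> = (\<integral>p. w (fst p - snd p) * (h (fst p) * h (snd p)) \<partial>(lborel \<Otimes>\<^sub>M lborel))"
    using lborel_pair.integral_snd[of "\<lambda>x y. w (x - y) * (h x * h y)"]
      integrable_difference_kernel[OF w h(2), of h B] B
    by (simp add: case_prod_beta')
  finally show ?thesis .
qed

lemma integrable_indicator_compact:
  "compact C \<Longrightarrow> integrable lborel (indicat_real (C :: 'a::euclidean_space set))"
  by (intro integrable_real_indicator)
     (auto simp: borel_compact intro!: emeasure_compact_finite[unfolded infinity_ennreal_def])

text \<open>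
  Compactness of the sets \<open>E j\<close> lets their indicators be decreasing limits of continuous functions of
  bounded support, cut off by the distance to \<open>E j\<close>; the form passes to the limit by dominated
  convergence. Continuous test functions would not do below, because the density of \<open>\<nu>\<close> may come
  arbitrarily close to \<open>0\<close> on every open set.
\<close>

lemma fourier_nonneg_imp_quadratic_form_nonneg_step:
  fixes w W :: "'a::euclidean_space \<Rightarrow> real" and E :: "'j \<Rightarrow> 'a set"
  assumes w: "integrable lborel w"
    and fourier: "\<And>\<xi>. (\<integral>z. w z *\<^sub>R cis (- (\<xi> \<bullet> z)) \<partial>lborel) = of_real (W \<xi>)" "\<And>\<xi>. 0 \<le> W \<xi>"
    and J: "finite J" and E: "\<And>j. j \<in> J \<Longrightarrow> compact (E j)"
    and h: "h = (\<lambda>x. \<Sum>j\<in>J. c j * indicator (E j) x)"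
  shows "0 \<le> (\<integral>p. w (fst p - snd p) * (h (fst p) * h (snd p)) \<partial>(lborel \<Otimes>\<^sub>M lborel))"
proof -
  note [measurable] = w[THEN borel_measurable_integrable, simplified]
  have Em [measurable]: "E j \<in> sets borel" if "j \<in> J" for j
    using E[OF that] by (simp add: borel_compact)
  define b where "b k j x = (if E j = {} then 0 else max 0 (1 - real (Suc k) * infdist x (E j)))" for k j x
  define N where "N j = (if E j = {} then {} else {x. infdist x (E j) \<le> 1})" for j
  have N: "compact (N j)" if "j \<in> J" for j
    using E[OF that] by (auto simp: N_def intro!: compact_infdist_le)
  have b_le: "\<bar>b k j x\<bar> \<le> indicator (N j) x" for k j x
  proof (cases "E j = {} \<or> x \<in> N j")
    case True
    then consider "E j = {}" | "x \<in> N j" by blast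
    then show ?thesis by cases (simp_all add: b_def N_def infdist_nonneg)
  next
    case False
    then have "E j \<noteq> {}" "x \<notin> N j" by auto
    then have "1 \<le> infdist x (E j)" by (simp add: N_def)
    then have "1 * 1 \<le> real (Suc k) * infdist x (E j)" by (intro mult_mono) auto
    then show ?thesis by (simp add: b_def)
  qed
  have b_lim: "(\<lambda>k. b k j x) \<longlonglongrightarrow> indicator (E j) x" if "j \<in> J" for j x
  proof (cases "E j = {} \<or> x \<in> E j")
    case True
    then have "b k j x = indicator (E j) x" for k by (auto simp: b_def)
    then show ?thesis by simp
  next
    case False
    then have "0 < infdist x (E j)"
      using infdist_pos_not_in_closed[of "E j" x] compact_imp_closed[OF E[OF that]] by blast
    then obtain n where n: "1 / infdist x (E j) < real n" using reals_Archimedean2 by blast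
    have "b k j x = 0" if "k \<ge> n" for k
    proof -
      have "1 \<le> real n * infdist x (E j)" using n \<open>0 < infdist x (E j)\<close> by (simp add: field_simps)
      also have "\<dots> \<le> real (Suc k) * infdist x (E j)" using that \<open>0 < infdist x (E j)\<close>
        by (intro mult_right_mono) auto
      finally show ?thesis by (simp add: b_def)
    qed
    then have "(\<lambda>k. b k j x) \<longlonglongrightarrow> 0" by (intro tendsto_eventually eventually_sequentiallyI)
    with False show ?thesis by simp
  qed
  define hk where "hk k x = (\<Sum>j\<in>J. c j * b k j x)" for k x
  define Hd where "Hd x = (\<Sum>j\<in>J. \<bar>c j\<bar> * indicator (N j) x)" for x
  have cont: "continuous_on UNIV (hk k)" for k
  proof -
    have "continuous_on UNIV (b k j)" for j
      unfolding b_def by (cases "E j = {}") (auto intro!: continuous_intros)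
    then show ?thesis unfolding hk_def by (intro continuous_intros)
  qed
  have [measurable]: "hk k \<in> borel_measurable borel" for k
    by (rule borel_measurable_continuous_onI[OF cont])
  have le: "\<bar>hk k x\<bar> \<le> Hd x" for k x
    unfolding hk_def Hd_def
    by (rule order_trans[OF sum_abs]) (auto simp: abs_mult intro!: sum_mono mult_left_mono b_le)
  have Nm [measurable]: "N j \<in> sets borel" if "j \<in> J" for j
    using N[OF that] by (simp add: borel_compact)
  have intHd: "integrable lborel Hd"
    unfolding Hd_def using N
    by (intro Bochner_Integration.integrable_sum integrable_mult_right integrable_indicator_compact)
  note [measurable] = intHd[THEN borel_measurable_integrable, simplified]
  have Hd_le: "\<bar>Hd x\<bar> \<le> (\<Sum>j\<in>J. \<bar>c j\<bar>)" for x
    unfolding Hd_def by (rule order_trans[OF sum_abs]) (auto simp: abs_mult indicator_def intro!: sum_mono)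
  have Hd0: "0 \<le> Hd x" for x
    by (auto simp: Hd_def intro!: sum_nonneg)
  have inthk: "integrable lborel (hk k)" for k
    by (rule Bochner_Integration.integrable_bound[OF intHd]) (use le Hd0 in auto)
  have "0 \<le> (\<integral>p. w (fst p - snd p) * (hk k (fst p) * hk k (snd p)) \<partial>(lborel \<Otimes>\<^sub>M lborel))" for k
    by (rule fourier_nonneg_imp_quadratic_form_nonneg_continuous[OF w fourier cont inthk])
       (rule order_trans[OF le order_trans[OF abs_ge_self Hd_le]])
  moreover have "(\<lambda>k. \<integral>p. w (fst p - snd p) * (hk k (fst p) * hk k (snd p)) \<partial>(lborel \<Otimes>\<^sub>M lborel))
     \<longlonglongrightarrow> (\<integral>p. w (fst p - snd p) * (h (fst p) * h (snd p)) \<partial>(lborel \<Otimes>\<^sub>M lborel))"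
  proof (rule integral_dominated_convergence)
    show "(\<lambda>p. w (fst p - snd p) * (h (fst p) * h (snd p))) \<in> borel_measurable (lborel \<Otimes>\<^sub>M lborel)"
      unfolding h by measurable
    show "integrable (lborel \<Otimes>\<^sub>M lborel) (\<lambda>p. \<bar>w (fst p - snd p)\<bar> * (Hd (fst p) * Hd (snd p)))"
      using integrable_difference_kernel[OF integrable_abs[OF w] intHd, of Hd "\<Sum>j\<in>J. \<bar>c j\<bar>"] Hd_le by simp
    show "AE p in lborel \<Otimes>\<^sub>M lborel. (\<lambda>k. w (fst p - snd p) * (hk k (fst p) * hk k (snd p)))
       \<longlonglongrightarrow> w (fst p - snd p) * (h (fst p) * h (snd p))"
      unfolding h hk_def by (intro AE_I2 tendsto_intros b_lim)
    show "AE p in lborel \<Otimes>\<^sub>M lborel. norm (w (fst p - snd p) * (hk k (fst p) * hk k (snd p)))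
        \<le> \<bar>w (fst p - snd p)\<bar> * (Hd (fst p) * Hd (snd p))" for k
      using le Hd0 by (auto simp: abs_mult intro!: AE_I2 mult_left_mono mult_mono)
  qed measurable
  ultimately show ?thesis by (intro LIMSEQ_le_const) auto
qed

lemma integrable_step:
  fixes E :: "'j \<Rightarrow> 'a::euclidean_space set"
  assumes "\<And>j. j \<in> J \<Longrightarrow> compact (E j)"
  shows "integrable lborel (\<lambda>x. \<Sum>j\<in>J. c j * indicator (E j) x :: real)"
  using assms
  by (intro Bochner_Integration.integrable_sum integrable_mult_right integrable_indicator_compact)

lemma integrable_step_quadratic_form:
  fixes E :: "'j \<Rightarrow> 'a::euclidean_space set"
  assumes w: "integrable lborel w" and E: "\<And>j. j \<in> J \<Longrightarrow> compact (E j)"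
    and h: "h = (\<lambda>x. \<Sum>j\<in>J. c j * indicator (E j) x :: real)"
  shows "integrable (lborel \<Otimes>\<^sub>M lborel) (\<lambda>p. w (fst p - snd p) * (h (fst p) * h (snd p)))"
proof (rule integrable_difference_kernel[OF w])
  show "integrable lborel h" unfolding h by (rule integrable_step[OF E])
  then show "h \<in> borel_measurable borel" using borel_measurable_integrable by fastforce
  show "\<bar>h x\<bar> \<le> (\<Sum>j\<in>J. \<bar>c j\<bar>)" for x
    unfolding h by (rule order_trans[OF sum_abs]) (auto simp: abs_mult indicator_def intro!: sum_mono)
qed

text \<open>
  The function \<open>k - a * gauss R\<close>, with \<open>a\<close> chosen to make the Fourier transform of
  \<open>a * gauss R\<close> equal to \<open>b * gauss (1 / R)\<close>, has nonnegative Fourier transform.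
\<close>

lemma quadratic_form_ge_gauss:
  fixes k :: "'a::euclidean_space \<Rightarrow> real" and E :: "'j \<Rightarrow> 'a set"
  assumes k: "integrable lborel k"
    and fourier: "\<And>\<xi>. (\<integral>z. k z *\<^sub>R cis (- (\<xi> \<bullet> z)) \<partial>lborel) = of_real (F (norm \<xi>))"
    and R: "R > 0" and F: "\<And>r. r \<ge> 0 \<Longrightarrow> F r \<ge> b * exp (- ((r / R)\<^sup>2 / 2))"
    and J: "finite J" and E: "\<And>j. j \<in> J \<Longrightarrow> compact (E j)"
    and h: "h = (\<lambda>x. \<Sum>j\<in>J. c j * indicator (E j) x)"
  shows "b * (R / sqrt (2 * pi)) ^ DIM('a) * (\<integral>p. gauss R (fst p - snd p) * (h (fst p) * h (snd p)) \<partial>(lborel \<Otimes>\<^sub>M lborel))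
     \<le> (\<integral>p. k (fst p - snd p) * (h (fst p) * h (snd p)) \<partial>(lborel \<Otimes>\<^sub>M lborel))"
proof -
  define a where "a = b * (R / sqrt (2 * pi)) ^ DIM('a)"
  define w where "w z = k z - a * gauss R z" for z
  have a: "a * (sqrt (2 * pi) / R) ^ DIM('a) = b"
    using R by (simp add: a_def power_divide)
  have intw: "integrable lborel w"
    unfolding w_def using k integrable_gauss[OF R] by auto
  have "(\<integral>z. w z *\<^sub>R cis (- (\<xi> \<bullet> z)) \<partial>lborel) = of_real (F (norm \<xi>) - b * gauss (1 / R) \<xi>)" for \<xi>
  proof -
    have "integrable lborel (\<lambda>z. k z *\<^sub>R cis (- (\<xi> \<bullet> z)))"
      by (rule integrable_norm_cancel) (use k borel_measurable_integrable[OF k] in auto)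
    moreover note fourier_gauss(1)[OF R, of \<xi>]
    moreover have "w z *\<^sub>R cis (- (\<xi> \<bullet> z)) = k z *\<^sub>R cis (- (\<xi> \<bullet> z)) - a *\<^sub>R (gauss R z *\<^sub>R cis (- (\<xi> \<bullet> z)))" for z
      by (simp add: w_def scaleR_diff_left)
    ultimately have "(\<integral>z. w z *\<^sub>R cis (- (\<xi> \<bullet> z)) \<partial>lborel) =
      of_real (F (norm \<xi>)) - a *\<^sub>R of_real ((sqrt (2 * pi) / R) ^ DIM('a) * gauss (1 / R) \<xi>)"
      by (simp only: Bochner_Integration.integral_diff integrable_scaleR_right integral_scaleR_right fourier fourier_gauss(2)[OF R])
    also have "\<dots> = of_real (F (norm \<xi>) - (a * (sqrt (2 * pi) / R) ^ DIM('a)) * gauss (1 / R) \<xi>)"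
      by (simp add: scaleR_conv_of_real)
    finally show ?thesis unfolding a .
  qed
  moreover have "0 \<le> F (norm \<xi>) - b * gauss (1 / R) \<xi>" for \<xi> :: 'a
    using F[of "norm \<xi>"] by (simp add: gauss_def)
  ultimately have "0 \<le> (\<integral>p. w (fst p - snd p) * (h (fst p) * h (snd p)) \<partial>(lborel \<Otimes>\<^sub>M lborel))"
    by (rule fourier_nonneg_imp_quadratic_form_nonneg_step[OF intw _ _ J E h])
  also have "\<dots> = (\<integral>p. k (fst p - snd p) * (h (fst p) * h (snd p)) - a * (gauss R (fst p - snd p) * (h (fst p) * h (snd p))) \<partial>(lborel \<Otimes>\<^sub>M lborel))"
    by (simp add: w_def algebra_simps)
  also have "\<dots> = (\<integral>p. k (fst p - snd p) * (h (fst p) * h (snd p)) \<partial>(lborel \<Otimes>\<^sub>M lborel)) -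
      a * (\<integral>p. gauss R (fst p - snd p) * (h (fst p) * h (snd p)) \<partial>(lborel \<Otimes>\<^sub>M lborel))"
    using integrable_step_quadratic_form[OF k E h] integrable_step_quadratic_form[OF integrable_gauss[OF R] E h]
    by (subst Bochner_Integration.integral_diff) auto
  finally show ?thesis by (simp add: a_def)
qed

section \<open>Gaussian forms on separated sets\<close>

text \<open>
  Diagonal dominance. Within a ball of radius \<open>\<sigma>\<close> the Gaussian of width \<open>\<sigma>\<close> is at least
  \<open>exp (- 2)\<close>, while between different balls the distance is at least \<open>(L - 2) * \<sigma>\<close>, so that
  summing the Gaussian over all other sets costs at most its tail integral, which \<open>L\<close> makes
  small compared with the measure of each single \<open>E j\<close>.
\<close>

lemma gauss_form_step_ge:
  fixes E :: "'j \<Rightarrow> 'a::euclidean_space set" and z :: "'j \<Rightarrow> 'a"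
  assumes \<sigma>: "\<sigma> > 0" and L: "L > 2"
    and J: "finite J" and E: "\<And>j. j \<in> J \<Longrightarrow> compact (E j)"
    and sub: "\<And>j. j \<in> J \<Longrightarrow> E j \<subseteq> cball (z j) \<sigma>"
    and sep: "\<And>i j. i \<in> J \<Longrightarrow> j \<in> J \<Longrightarrow> i \<noteq> j \<Longrightarrow> dist (z i) (z j) \<ge> L * \<sigma>"
    and mass: "\<And>j. j \<in> J \<Longrightarrow>
       2 * exp 2 * (exp (- ((L - 2)\<^sup>2 / 4)) * (sqrt (4 * pi) * \<sigma>) ^ DIM('a)) \<le> measure lborel (E j)"
    and h: "h = (\<lambda>x. \<Sum>j\<in>J. c j * indicator (E j) x)"
  shows "exp (-2) / 2 * (\<Sum>j\<in>J. (c j)\<^sup>2 * (measure lborel (E j))\<^sup>2)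
     \<le> (\<integral>p. gauss (1 / \<sigma>) (fst p - snd p) * (h (fst p) * h (snd p)) \<partial>(lborel \<Otimes>\<^sub>M lborel))"
proof -
  define R where "R = 1 / \<sigma>"
  have R: "R > 0" using \<sigma> by (simp add: R_def)
  define \<tau> where "\<tau> = exp (- ((L - 2)\<^sup>2 / 4)) * (sqrt (4 * pi) * \<sigma>) ^ DIM('a)"
  define m where "m j = measure lborel (E j)" for j
  have Em [measurable]: "E j \<in> sets borel" if "j \<in> J" for j
    using E[OF that] by (simp add: borel_compact)
  have intE: "integrable lborel (indicator (E j) :: 'a \<Rightarrow> real)" if "j \<in> J" for j
    by (rule integrable_indicator_compact[OF E[OF that]])
  define f where "f i j p = gauss R (fst p - snd p) * (indicator (E i) (fst p) * indicator (E j) (snd p))"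
    for i j and p :: "'a \<times> 'a"
  define g where "g i j = (\<integral>p. f i j p \<partial>(lborel \<Otimes>\<^sub>M lborel))" for i j
  have intf: "integrable (lborel \<Otimes>\<^sub>M lborel) (f i j)" if "i \<in> J" "j \<in> J" for i j
    unfolding f_def
    by (rule integrable_difference_kernel[OF integrable_gauss[OF R] intE[OF that(1)], of _ 1])
       (use that in \<open>auto simp: indicator_def\<close>)
  have g0: "0 \<le> g i j" for i j
    unfolding g_def by (rule Bochner_Integration.integral_nonneg) (auto simp: f_def gauss_pos less_imp_le)
  have sym: "g i j = g j i" if "i \<in> J" "j \<in> J" for i j
  proof -
    have "(\<lambda>(x, y). f i j (y, x)) = f j i"
      by (auto simp: f_def gauss_def norm_minus_commute fun_eq_iff)
    then show ?thesis
      using lborel_pair.integral_product_swap[of "f i j"] borel_measurable_integrable[OF intf[OF that]]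
      by (simp add: g_def)
  qed
  \<comment> \<open>two points of the same ball are at distance at most \<open>2\<sigma>\<close>\<close>
  have diag: "exp (-2) * (m j)\<^sup>2 \<le> g j j" if j: "j \<in> J" for j
  proof -
    have "exp (-2) * (m j)\<^sup>2 = exp (-2) * (\<integral>x. (\<integral>y. indicator (E j) x * indicator (E j) y \<partial>lborel) \<partial>lborel)"
      using j by (simp add: m_def power2_eq_square)
    also have "(\<integral>x. (\<integral>y. indicat_real (E j) x * indicator (E j) y \<partial>lborel) \<partial>lborel) =
        (\<integral>p. indicator (E j) (fst p) * indicator (E j) (snd p) \<partial>(lborel \<Otimes>\<^sub>M lborel))"
      using lborel_pair.integral_fst'[OF integrable_product_fun[OF intE[OF j] intE[OF j]]] by simp
    also have "exp (-2) * \<dots> = (\<integral>p. exp (-2) * (indicator (E j) (fst p) * indicator (E j) (snd p)) \<partial>(lborel \<Otimes>\<^sub>M lborel))"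
      by simp
    also have "\<dots> \<le> g j j"
      unfolding g_def
    proof (rule integral_mono)
      show "integrable (lborel \<Otimes>\<^sub>M lborel) (\<lambda>p. exp (-2) * (indicator (E j) (fst p) * indicator (E j) (snd p)) :: real)"
        using integrable_product_fun[OF intE[OF j] intE[OF j]] by simp
      show "exp (-2) * (indicator (E j) (fst p) * indicator (E j) (snd p)) \<le> f j j p" for p
      proof (cases "fst p \<in> E j \<and> snd p \<in> E j")
        case True
        then have "dist (z j) (fst p) \<le> \<sigma>" "dist (z j) (snd p) \<le> \<sigma>"
          using sub[OF j] by auto
        then have "dist (fst p) (snd p) \<le> 2 * \<sigma>"
          using dist_triangle3[of "fst p" "snd p" "z j"] by linarith
        then have "norm (fst p - snd p) / \<sigma> \<le> 2" using \<sigma> by (simp add: dist_norm field_simps)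
        then have "(norm (fst p - snd p) / \<sigma>)\<^sup>2 \<le> 2\<^sup>2" using \<sigma> by (intro power_mono) auto
        then show ?thesis using True by (simp add: f_def gauss_def R_def)
      qed (auto simp: f_def)
    qed (rule intf[OF j j])
    finally show ?thesis .
  qed
  \<comment> \<open>off the diagonal the Gaussian is at most the constant \<open>exp (- (L - 2)\<^sup>2 / 4)\<close> times a Gaussian
    that is wider by the factor \<open>sqrt 2\<close>, whose integral is known\<close>
  have off: "(\<Sum>i\<in>J - {j}. g i j) \<le> \<tau> * m j" if j: "j \<in> J" for j
  proof -
    define q where "q = R / sqrt 2"
    have q: "q > 0" using R by (simp add: q_def)
    define G where "G x = exp (- ((L - 2)\<^sup>2 / 4)) * gauss q x" for x :: 'a
    have intG: "integrable lborel G" unfolding G_def using integrable_gauss[OF q] by simp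
    have bound: "gauss R x \<le> G x" if "norm x \<ge> (L - 2) * \<sigma>" for x :: 'a
    proof -
      have "(L - 2) \<le> R * norm x" using that \<sigma> by (simp add: R_def field_simps)
      then have "(L - 2)\<^sup>2 \<le> (R * norm x)\<^sup>2" using L by (intro power_mono) auto
      then show ?thesis by (simp add: gauss_def G_def q_def power_divide power_mult_distrib flip: exp_add)
    qed
    have "(\<Sum>i\<in>J - {j}. g i j) = (\<integral>p. (\<Sum>i\<in>J - {j}. f i j p) \<partial>(lborel \<Otimes>\<^sub>M lborel))"
      unfolding g_def using j by (intro Bochner_Integration.integral_sum[symmetric] intf) auto
    also have "\<dots> \<le> (\<integral>p. G (fst p - snd p) * indicator (E j) (snd p) \<partial>(lborel \<Otimes>\<^sub>M lborel))"
    proof (rule integral_mono)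
      show "integrable (lborel \<Otimes>\<^sub>M lborel) (\<lambda>p. \<Sum>i\<in>J - {j}. f i j p)"
        using j by (intro Bochner_Integration.integrable_sum intf) auto
      show "integrable (lborel \<Otimes>\<^sub>M lborel) (\<lambda>p. G (fst p - snd p) * indicator (E j) (snd p) :: real)"
      proof -
        have "integrable (lborel \<Otimes>\<^sub>M lborel) (\<lambda>p. G (fst p - snd p) * (indicator (E j) (fst p) * 1))"
          by (rule integrable_difference_kernel[OF intG intE[OF j], of _ 1]) auto
        from lborel_pair.integrable_product_swap[OF this]
        show ?thesis by (simp add: case_prod_beta' G_def gauss_def norm_minus_commute)
      qed
      fix p :: "'a \<times> 'a"
      have G0: "0 \<le> G x" for x by (simp add: G_def gauss_pos less_imp_le)
      show "(\<Sum>i\<in>J - {j}. f i j p) \<le> G (fst p - snd p) * indicator (E j) (snd p)"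
      proof (cases "snd p \<in> E j \<and> (\<exists>i\<in>J - {j}. fst p \<in> E i)")
        case True
        then obtain i where i: "i \<in> J" "i \<noteq> j" "fst p \<in> E i" by blast
        have "fst p \<notin> E i'" if "i' \<in> J - {i}" for i'
        proof
          assume "fst p \<in> E i'"
          then have "dist (z i) (fst p) \<le> \<sigma>" "dist (z i') (fst p) \<le> \<sigma>"
            using i that sub[of i] sub[of i'] by auto
          then have "dist (z i) (z i') \<le> 2 * \<sigma>"
            using dist_triangle2[of "z i" "z i'" "fst p"] by linarith
          moreover have "L * \<sigma> \<le> dist (z i) (z i')" using that i by (intro sep) auto
          moreover have "2 * \<sigma> < L * \<sigma>" using L \<sigma> by simp
          ultimately show False by linarith
        qed
        then have "(\<Sum>i'\<in>J - {j}. f i' j p) = (\<Sum>i'\<in>{i}. f i' j p)"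
          using i J by (intro sum.mono_neutral_right) (auto simp: f_def)
        also have "\<dots> = gauss R (fst p - snd p)" using i True by (simp add: f_def)
        also have "\<dots> \<le> G (fst p - snd p)"
        proof (rule bound)
          have "L * \<sigma> \<le> dist (z i) (z j)" using i j by (intro sep) auto
          also have "\<dots> \<le> dist (z i) (fst p) + dist (fst p) (snd p) + dist (snd p) (z j)"
            using dist_triangle[of "z i" "z j" "fst p"] dist_triangle[of "fst p" "z j" "snd p"] by linarith
          also have "\<dots> \<le> \<sigma> + dist (fst p) (snd p) + \<sigma>"
            using i j sub[of i] sub[of j] True by (intro add_mono) (auto simp: subset_iff dist_commute)
          finally show "(L - 2) * \<sigma> \<le> norm (fst p - snd p)" by (simp add: dist_norm algebra_simps)
        qed
        finally show ?thesis using True by simp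
      next
        case False
        then have "(\<Sum>i\<in>J - {j}. f i j p) = 0" by (intro sum.neutral) (auto simp: f_def indicator_def)
        then show ?thesis using G0 by simp
      qed
    qed
    also have "\<dots> = \<tau> * m j"
    proof -
      have "integrable (lborel \<Otimes>\<^sub>M lborel) (\<lambda>p. G (fst p - snd p) * (indicator (E j) (fst p) * 1))"
        by (rule integrable_difference_kernel[OF intG intE[OF j], of _ 1]) auto
      then have i: "integrable (lborel \<Otimes>\<^sub>M lborel) (\<lambda>(x, y). G (x - y) * indicator (E j) y)"
        by (drule_tac lborel_pair.integrable_product_swap)
           (simp add: case_prod_beta' G_def gauss_def norm_minus_commute)
      have "(\<integral>p. G (fst p - snd p) * indicator (E j) (snd p) \<partial>(lborel \<Otimes>\<^sub>M lborel)) =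
          (\<integral>y. (\<integral>x. G (x - y) * indicator (E j) y \<partial>lborel) \<partial>lborel)"
        using lborel_pair.integral_snd[OF i] by (simp add: case_prod_beta')
      also have "\<dots> = (\<integral>y. integral\<^sup>L lborel G * indicator (E j) y \<partial>lborel)"
      proof (rule Bochner_Integration.integral_cong[OF refl])
        fix y
        show "(\<integral>x. G (x - y) * indicator (E j) y \<partial>lborel) = integral\<^sup>L lborel G * indicator (E j) y"
          using lborel_integral_affine(2)[OF _ intG, of 1 "- y"] by simp
      qed
      also have "\<dots> = integral\<^sup>L lborel G * m j" using j by (simp add: m_def)
      also have "integral\<^sup>L lborel G = \<tau>"
      proof -
        have "sqrt (2 * pi) / q = sqrt (4 * pi) * \<sigma>"
          using \<sigma> by (simp add: q_def R_def real_sqrt_mult[symmetric])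
        then show ?thesis unfolding G_def \<tau>_def by (simp add: integral_gauss[OF q])
      qed
      finally show ?thesis .
    qed
    finally show ?thesis .
  qed
  have off': "(\<Sum>i\<in>J - {j}. g i j) \<le> exp (-2) / 2 * (m j)\<^sup>2" if j: "j \<in> J" for j
  proof -
    have "\<tau> \<le> exp (-2) / 2 * m j"
      using mass[OF j] by (simp add: \<tau>_def m_def exp_minus field_simps)
    then have "\<tau> * m j \<le> exp (-2) / 2 * m j * m j" by (intro mult_right_mono) (auto simp: m_def)
    with off[OF j] show ?thesis by (simp add: power2_eq_square)
  qed
  have "exp (-2) / 2 * (\<Sum>j\<in>J. (c j)\<^sup>2 * (m j)\<^sup>2) \<le> (\<Sum>j\<in>J. (c j)\<^sup>2 * (g j j - (\<Sum>i\<in>J - {j}. g i j)))"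
    unfolding sum_distrib_left
  proof (rule sum_mono)
    fix j assume j: "j \<in> J"
    have "exp (-2) / 2 * (m j)\<^sup>2 \<le> g j j - (\<Sum>i\<in>J - {j}. g i j)"
      using diag[OF j] off'[OF j] by simp
    then have "(c j)\<^sup>2 * (exp (-2) / 2 * (m j)\<^sup>2) \<le> (c j)\<^sup>2 * (g j j - (\<Sum>i\<in>J - {j}. g i j))"
      by (intro mult_left_mono) auto
    then show "exp (-2) / 2 * ((c j)\<^sup>2 * (m j)\<^sup>2) \<le> (c j)\<^sup>2 * (g j j - (\<Sum>i\<in>J - {j}. g i j))"
      by (simp add: mult_ac)
  qed
  also have "\<dots> = (\<Sum>j\<in>J. (c j)\<^sup>2 * g j j) - (\<Sum>j\<in>J. \<Sum>i\<in>J - {j}. (c j)\<^sup>2 * g i j)"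
    by (simp add: right_diff_distrib sum_subtractf sum_distrib_left)
  also have "\<dots> \<le> (\<Sum>j\<in>J. (c j)\<^sup>2 * g j j) + (\<Sum>j\<in>J. \<Sum>i\<in>J - {j}. c i * c j * g i j)"
  proof -
    have swap: "(\<Sum>j\<in>J. \<Sum>i\<in>J - {j}. u i j) = (\<Sum>j\<in>J. \<Sum>i\<in>J - {j}. u j i)" for u :: "'j \<Rightarrow> 'j \<Rightarrow> real"
    proof -
      have eq: "(\<Sum>j\<in>J. \<Sum>i\<in>J - {j}. v i j) = (\<Sum>j\<in>J. \<Sum>i\<in>J. if i = j then 0 else v i j)" for v :: "'j \<Rightarrow> 'j \<Rightarrow> real"
        using J by (intro sum.cong refl sum.mono_neutral_cong_left) auto
      show ?thesis
        unfolding eq by (subst sum.swap) (auto intro!: sum.cong)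
    qed
    have "2 * - (\<Sum>j\<in>J. \<Sum>i\<in>J - {j}. (c j)\<^sup>2 * g i j) =
       - (\<Sum>j\<in>J. \<Sum>i\<in>J - {j}. (c j)\<^sup>2 * g i j) - (\<Sum>j\<in>J. \<Sum>i\<in>J - {j}. (c i)\<^sup>2 * g i j)"
    proof -
      have "(\<Sum>j\<in>J. \<Sum>i\<in>J - {j}. (c j)\<^sup>2 * g i j) = (\<Sum>j\<in>J. \<Sum>i\<in>J - {j}. (c i)\<^sup>2 * g j i)"
        by (rule swap)
      also have "\<dots> = (\<Sum>j\<in>J. \<Sum>i\<in>J - {j}. (c i)\<^sup>2 * g i j)"
        using sym by (intro sum.cong refl) auto
      finally show ?thesis by simp
    qed
    also have "\<dots> = (\<Sum>j\<in>J. \<Sum>i\<in>J - {j}. - ((c j)\<^sup>2 + (c i)\<^sup>2) * g i j)"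
      by (simp add: sum_subtractf[symmetric] sum_negf[symmetric] algebra_simps)
    also have "\<dots> \<le> (\<Sum>j\<in>J. \<Sum>i\<in>J - {j}. (2 * (c i * c j)) * g i j)"
    proof (intro sum_mono mult_right_mono g0)
      fix i j
      have "0 \<le> (c j + c i)\<^sup>2" by simp
      then show "- ((c j)\<^sup>2 + (c i)\<^sup>2) \<le> 2 * (c i * c j)" unfolding power2_sum by (simp add: mult_ac)
    qed
    also have "\<dots> = 2 * (\<Sum>j\<in>J. \<Sum>i\<in>J - {j}. c i * c j * g i j)"
      by (simp add: sum_distrib_left mult_ac)
    finally show ?thesis by simp
  qed
  also have "\<dots> = (\<Sum>j\<in>J. \<Sum>i\<in>J. c i * c j * g i j)"
    unfolding sum.distrib[symmetric]
    using J by (intro sum.cong refl) (simp add: sum.remove power2_eq_square)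
  also have "\<dots> = (\<integral>p. (\<Sum>j\<in>J. \<Sum>i\<in>J. c i * c j * f i j p) \<partial>(lborel \<Otimes>\<^sub>M lborel))"
    unfolding g_def using intf
    by (subst Bochner_Integration.integral_sum; (intro Bochner_Integration.integrable_sum)?) 
       (auto intro!: sum.cong simp: Bochner_Integration.integral_sum)
  also have "\<dots> = (\<integral>p. gauss (1 / \<sigma>) (fst p - snd p) * (h (fst p) * h (snd p)) \<partial>(lborel \<Otimes>\<^sub>M lborel))"
  proof (rule Bochner_Integration.integral_cong[OF refl])
    fix p
    have "h (fst p) * h (snd p) = (\<Sum>j\<in>J. \<Sum>i\<in>J. (c i * indicator (E i) (fst p)) * (c j * indicator (E j) (snd p)))"
      unfolding h sum_product by (rule sum.swap)
    then show "(\<Sum>j\<in>J. \<Sum>i\<in>J. c i * c j * f i j p) = gauss (1 / \<sigma>) (fst p - snd p) * (h (fst p) * h (snd p))"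
      by (simp add: f_def R_def sum_distrib_left mult_ac)
  qed
  finally show ?thesis by (simp add: m_def)
qed

section \<open>Square-integrable functions and Rayleigh quotients\<close>

lemma L2_mult_integrable:
  assumes "f \<in> L2_space \<nu>" "g \<in> L2_space \<nu>"
  shows "integrable \<nu> (\<lambda>x. f x * g x)"
proof (rule Bochner_Integration.integrable_bound)
  have [measurable]: "f \<in> borel_measurable \<nu>" "g \<in> borel_measurable \<nu>"
    using assms by (auto simp: L2_space_def)
  show "integrable \<nu> (\<lambda>x. (f x)\<^sup>2 + (g x)\<^sup>2)" using assms by (auto simp: L2_space_def)
  show "AE x in \<nu>. norm (f x * g x) \<le> norm ((f x)\<^sup>2 + (g x)\<^sup>2)"
  proof (rule AE_I2)
    fix x
    have "0 \<le> (\<bar>f x\<bar> - \<bar>g x\<bar>)\<^sup>2" "0 \<le> \<bar>f x * g x\<bar>" by simp_all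
    then have "\<bar>f x * g x\<bar> \<le> (f x)\<^sup>2 + (g x)\<^sup>2"
      unfolding power2_diff power2_abs abs_mult by linarith
    then show "norm (f x * g x) \<le> norm ((f x)\<^sup>2 + (g x)\<^sup>2)" by simp
  qed
  show "(\<lambda>x. f x * g x) \<in> borel_measurable \<nu>" by measurable
qed

lemma L2_add: "f \<in> L2_space \<nu> \<Longrightarrow> g \<in> L2_space \<nu> \<Longrightarrow> (\<lambda>x. f x + g x) \<in> L2_space \<nu>"
  using L2_mult_integrable[of f \<nu> g] by (auto simp: L2_space_def power2_sum mult.assoc)

lemma L2_cmult: "f \<in> L2_space \<nu> \<Longrightarrow> (\<lambda>x. c * f x) \<in> L2_space \<nu>"
  by (auto simp: L2_space_def power_mult_distrib)

lemma L2_diff: "f \<in> L2_space \<nu> \<Longrightarrow> g \<in> L2_space \<nu> \<Longrightarrow> (\<lambda>x. f x - g x) \<in> L2_space \<nu>"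
  using L2_add[of f \<nu> "\<lambda>x. - 1 * g x"] L2_cmult[of g \<nu> "- 1"] by simp

lemma L2_sum: "(\<And>i. i \<in> I \<Longrightarrow> f i \<in> L2_space \<nu>) \<Longrightarrow> (\<lambda>x. \<Sum>i\<in>I. f i x) \<in> L2_space \<nu>"
  by (induction I rule: infinite_finite_induct) (auto simp: L2_add, auto simp: L2_space_def)

lemma L2_inner_commute: "L2_inner \<nu> f g = L2_inner \<nu> g f"
  by (simp add: L2_inner_def mult.commute)

lemma L2_inner_diff_left:
  "f \<in> L2_space \<nu> \<Longrightarrow> g \<in> L2_space \<nu> \<Longrightarrow> h \<in> L2_space \<nu> \<Longrightarrow>
     L2_inner \<nu> (\<lambda>x. f x - g x) h = L2_inner \<nu> f h - L2_inner \<nu> g h"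
  by (simp add: L2_inner_def left_diff_distrib L2_mult_integrable)

lemma L2_inner_sum_left:
  assumes "\<And>i. i \<in> I \<Longrightarrow> f i \<in> L2_space \<nu>" "h \<in> L2_space \<nu>"
  shows "L2_inner \<nu> (\<lambda>x. \<Sum>i\<in>I. c i * f i x) h = (\<Sum>i\<in>I. c i * L2_inner \<nu> (f i) h)"
  using assms by (simp add: L2_inner_def sum_distrib_right mult.assoc L2_mult_integrable)

lemma L2_inner_self_nonneg: "0 \<le> L2_inner \<nu> f f"
  by (simp add: L2_inner_def)

lemma L2_Cauchy_Schwarz:
  assumes f: "f \<in> L2_space \<nu>" and g: "g \<in> L2_space \<nu>"
  shows "\<bar>L2_inner \<nu> f g\<bar> \<le> L2_norm \<nu> f * L2_norm \<nu> g"
proof -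
  have "0 \<le> L2_inner \<nu> f f + 2 * t * L2_inner \<nu> f g + t\<^sup>2 * L2_inner \<nu> g g" for t
  proof -
    have "0 \<le> L2_inner \<nu> (\<lambda>x. f x + t * g x) (\<lambda>x. f x + t * g x)" by (rule L2_inner_self_nonneg)
    also have "\<dots> = (\<integral>x. f x * f x + 2 * t * (f x * g x) + t\<^sup>2 * (g x * g x) \<partial>\<nu>)"
      by (simp add: L2_inner_def algebra_simps power2_eq_square)
    also have "\<dots> = L2_inner \<nu> f f + 2 * t * L2_inner \<nu> f g + t\<^sup>2 * L2_inner \<nu> g g"
      using f g by (simp add: L2_inner_def L2_mult_integrable)
    finally show ?thesis .
  qed
  note * = this
  have "(L2_inner \<nu> f g)\<^sup>2 \<le> L2_inner \<nu> f f * L2_inner \<nu> g g"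
  proof (cases "L2_inner \<nu> g g = 0")
    case True
    have "L2_inner \<nu> f g = 0"
    proof (rule ccontr)
      assume "L2_inner \<nu> f g \<noteq> 0"
      then show False
        using *[of "- (L2_inner \<nu> f f + 1) / (2 * L2_inner \<nu> f g)"] True
        by (simp add: field_simps)
    qed
    with True show ?thesis by simp
  next
    case False
    then have "L2_inner \<nu> g g > 0" using L2_inner_self_nonneg[of \<nu> g] by simp
    then show ?thesis
      using *[of "- L2_inner \<nu> f g / L2_inner \<nu> g g"]
      by (simp add: field_simps power2_eq_square)
  qed
  then have "sqrt ((L2_inner \<nu> f g)\<^sup>2) \<le> sqrt (L2_inner \<nu> f f * L2_inner \<nu> g g)"
    by (rule real_sqrt_le_mono)
  then show ?thesis by (simp add: L2_norm_def real_sqrt_mult)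
qed

lemma L2_Bessel:
  assumes e: "\<And>j. j \<in> J \<Longrightarrow> e j \<in> L2_space \<nu>" and J: "finite J"
    and on: "\<And>i j. i \<in> J \<Longrightarrow> j \<in> J \<Longrightarrow> L2_inner \<nu> (e i) (e j) = (if i = j then 1 else 0)"
    and f: "f \<in> L2_space \<nu>"
  shows "(\<Sum>j\<in>J. (L2_inner \<nu> (e j) f)\<^sup>2) \<le> L2_inner \<nu> f f"
proof -
  define a where "a j = L2_inner \<nu> (e j) f" for j
  define S where "S = (\<lambda>x. \<Sum>j\<in>J. a j * e j x)"
  have S: "S \<in> L2_space \<nu>" unfolding S_def by (intro L2_sum L2_cmult e)
  have Sf: "L2_inner \<nu> S f = (\<Sum>j\<in>J. (a j)\<^sup>2)"
    unfolding S_def using e f by (subst L2_inner_sum_left) (auto simp: a_def power2_eq_square)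
  have eS: "L2_inner \<nu> (e i) S = a i" if "i \<in> J" for i
  proof -
    have "L2_inner \<nu> (e i) S = (\<Sum>j\<in>J. a j * L2_inner \<nu> (e j) (e i))"
      unfolding S_def by (subst L2_inner_commute, rule L2_inner_sum_left) (use e that in auto)
    also have "\<dots> = (\<Sum>j\<in>J. if j = i then a j else 0)"
      using that by (intro sum.cong) (auto simp: on)
    finally show ?thesis using that J by simp
  qed
  have SS: "L2_inner \<nu> S S = (\<Sum>j\<in>J. (a j)\<^sup>2)"
  proof -
    have "L2_inner \<nu> S S = (\<Sum>j\<in>J. a j * L2_inner \<nu> (e j) S)"
      by (subst (1) S_def, rule L2_inner_sum_left) (use e S in auto)
    then show ?thesis by (simp add: eS power2_eq_square)
  qed
  have "0 \<le> L2_inner \<nu> (\<lambda>x. f x - S x) (\<lambda>x. f x - S x)" by (rule L2_inner_self_nonneg)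
  also have "\<dots> = L2_inner \<nu> f (\<lambda>x. f x - S x) - L2_inner \<nu> S (\<lambda>x. f x - S x)"
    by (intro L2_inner_diff_left L2_diff f S)
  also have "L2_inner \<nu> f (\<lambda>x. f x - S x) = L2_inner \<nu> f f - L2_inner \<nu> S f"
    by (subst L2_inner_commute, rule L2_inner_diff_left) (auto intro: f S)
  also have "L2_inner \<nu> S (\<lambda>x. f x - S x) = L2_inner \<nu> f S - L2_inner \<nu> S S"
    by (subst L2_inner_commute, rule L2_inner_diff_left) (auto intro: f S)
  finally show ?thesis
    using Sf SS L2_inner_commute[of \<nu> f S] by (simp add: a_def)
qed

text \<open>
  The easy half of the min-max principle: only eigenvalues from the \<open>n\<close>-th on contribute to
  \<open>\<langle>T f, f\<rangle>\<close>, and Bessel's inequality bounds the sum of the squared coefficients.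
\<close>

lemma rayleigh_quotient_le_eigenvalue:
  assumes spec: "spectral_representation \<nu> T \<mu> e" and n: "n \<ge> 1"
    and f: "f \<in> L2_space \<nu>" and orth: "\<And>i. i \<in> {1..<n} \<Longrightarrow> L2_inner \<nu> (e i) f = 0"
  shows "L2_inner \<nu> (T f) f \<le> \<mu> n * L2_inner \<nu> f f"
proof -
  define S where "S m = (\<lambda>x. \<Sum>j=1..m. (\<mu> j * L2_inner \<nu> (e j) f) * e j x)" for m
  have e: "e j \<in> L2_space \<nu>" if "j \<ge> 1" for j
    using spec that by (auto simp: spectral_representation_def)
  have S: "S m \<in> L2_space \<nu>" for m
    unfolding S_def by (intro L2_sum L2_cmult e) auto
  have T: "T f \<in> L2_space \<nu>" and lim: "(\<lambda>m. L2_norm \<nu> (\<lambda>x. T f x - S m x)) \<longlonglongrightarrow> 0"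
    using spec f by (auto simp: spectral_representation_def S_def)
  have pos: "0 < \<mu> n" using spec n by (auto simp: spectral_representation_def)
  have S_le: "L2_inner \<nu> (S m) f \<le> \<mu> n * L2_inner \<nu> f f" for m
  proof -
    have "L2_inner \<nu> (S m) f = (\<Sum>j=1..m. (\<mu> j * L2_inner \<nu> (e j) f) * L2_inner \<nu> (e j) f)"
      unfolding S_def by (rule L2_inner_sum_left) (use e f in auto)
    also have "\<dots> \<le> (\<Sum>j=1..m. \<mu> n * (L2_inner \<nu> (e j) f)\<^sup>2)"
    proof (rule sum_mono)
      fix j assume j: "j \<in> {1..m}"
      show "(\<mu> j * L2_inner \<nu> (e j) f) * L2_inner \<nu> (e j) f \<le> \<mu> n * (L2_inner \<nu> (e j) f)\<^sup>2"
      proof (cases "j < n")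
        case True
        then show ?thesis using orth[of j] j by simp
      next
        case False
        then have "\<mu> j \<le> \<mu> n"
          using spec n j by (auto simp: spectral_representation_def monotone_on_def)
        then have "\<mu> j * (L2_inner \<nu> (e j) f)\<^sup>2 \<le> \<mu> n * (L2_inner \<nu> (e j) f)\<^sup>2"
          by (intro mult_right_mono) auto
        then show ?thesis by (simp add: power2_eq_square mult_ac)
      qed
    qed
    also have "\<dots> = \<mu> n * (\<Sum>j=1..m. (L2_inner \<nu> (e j) f)\<^sup>2)"
      by (simp add: sum_distrib_left)
    also have "\<dots> \<le> \<mu> n * L2_inner \<nu> f f"
      using spec f pos by (intro mult_left_mono L2_Bessel) (auto simp: spectral_representation_def)
    finally show ?thesis .
  qed
  have "L2_inner \<nu> (T f) f \<le> L2_norm \<nu> (\<lambda>x. T f x - S m x) * L2_norm \<nu> f + \<mu> n * L2_inner \<nu> f f" for m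
  proof -
    have "L2_inner \<nu> (\<lambda>x. T f x - S m x) f = L2_inner \<nu> (T f) f - L2_inner \<nu> (S m) f"
      by (intro L2_inner_diff_left T S f)
    moreover have "\<bar>L2_inner \<nu> (\<lambda>x. T f x - S m x) f\<bar> \<le> L2_norm \<nu> (\<lambda>x. T f x - S m x) * L2_norm \<nu> f"
      by (intro L2_Cauchy_Schwarz L2_diff T S f)
    ultimately show ?thesis using S_le[of m] by linarith
  qed
  moreover have "(\<lambda>m. L2_norm \<nu> (\<lambda>x. T f x - S m x) * L2_norm \<nu> f + \<mu> n * L2_inner \<nu> f f)
      \<longlonglongrightarrow> 0 * L2_norm \<nu> f + \<mu> n * L2_inner \<nu> f f"
    by (intro tendsto_intros lim)
  ultimately have "L2_inner \<nu> (T f) f \<le> 0 * L2_norm \<nu> f + \<mu> n * L2_inner \<nu> f f"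
    by (intro LIMSEQ_le_const) auto
  then show ?thesis by simp
qed

section \<open>Separated balls that carry mass\<close>

lemma ex_maximal_separated_subset:
  fixes z :: "'i \<Rightarrow> 'a::metric_space"
  assumes "finite I"
  shows "\<exists>Z\<subseteq>I. (\<forall>i\<in>Z. \<forall>j\<in>Z. i \<noteq> j \<longrightarrow> r \<le> dist (z i) (z j)) \<and> (\<forall>i\<in>I. \<exists>j\<in>Z. i = j \<or> dist (z i) (z j) < r)"
  using assms
proof (induction I rule: finite_induct)
  case (insert k I)
  then obtain Z where Z: "Z \<subseteq> I" "\<forall>i\<in>Z. \<forall>j\<in>Z. i \<noteq> j \<longrightarrow> r \<le> dist (z i) (z j)"
      "\<forall>i\<in>I. \<exists>j\<in>Z. i = j \<or> dist (z i) (z j) < r" by blast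
  show ?case
  proof (cases "\<exists>j\<in>Z. dist (z k) (z j) < r")
    case True
    with Z show ?thesis by (intro exI[of _ Z]) auto
  next
    case False
    then have "r \<le> dist (z k) (z j)" "r \<le> dist (z j) (z k)" if "j \<in> Z" for j
      using that by (auto simp: dist_commute not_less)
    with Z show ?thesis by (intro exI[of _ "insert k Z"]) auto
  qed
qed auto

text \<open>
  Balls that meet \<open>A\<close> in less than \<open>\<theta>\<close> cover at most half of \<open>A\<close>. Among the others take a maximal
  separated family \<open>Z\<close>: by maximality the balls about \<open>Z\<close> enlarged by the factor \<open>L + 1\<close> contain the
  rest of \<open>A\<close>, which bounds the number of elements of \<open>Z\<close> from below.
\<close>

lemma ex_separated_balls_with_mass:
  fixes A :: "'a::euclidean_space set" and z :: "nat \<Rightarrow> 'a"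
  assumes A: "compact A" and cover: "A \<subseteq> (\<Union>i<N. cball (z i) \<sigma>)" and \<sigma>: "\<sigma> > 0" and L: "L > 0"
    and \<theta>: "real N * \<theta> \<le> measure lborel A / 2"
  shows "\<exists>Z\<subseteq>{..<N}. (\<forall>i\<in>Z. \<forall>j\<in>Z. i \<noteq> j \<longrightarrow> L * \<sigma> \<le> dist (z i) (z j)) \<and>
     (\<forall>j\<in>Z. \<theta> \<le> measure lborel (A \<inter> cball (z j) \<sigma>)) \<and>
     measure lborel A / 2 \<le> real (card Z) * (unit_ball_vol (real DIM('a)) * ((L + 1) * \<sigma>) ^ DIM('a))"
proof -
  define I where "I = {i. i < N \<and> \<theta> \<le> measure lborel (A \<inter> cball (z i) \<sigma>)}"
  have fI: "finite I" by (simp add: I_def)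
  obtain Z where Z: "Z \<subseteq> I" "\<forall>i\<in>Z. \<forall>j\<in>Z. i \<noteq> j \<longrightarrow> L * \<sigma> \<le> dist (z i) (z j)"
      "\<forall>i\<in>I. \<exists>j\<in>Z. i = j \<or> dist (z i) (z j) < L * \<sigma>"
    using ex_maximal_separated_subset[OF fI, of "L * \<sigma>" z] by blast
  have fZ: "finite Z" using Z(1) fI by (rule finite_subset)
  have fm: "C \<in> fmeasurable lborel" if "compact C" for C :: "'a set"
    using that by (auto simp: fmeasurable_def borel_compact intro!: emeasure_compact_finite[unfolded infinity_ennreal_def])
  define G where "G = (\<Union>j\<in>Z. cball (z j) ((L + 1) * \<sigma>))"
  define S where "S = (\<Union>i\<in>{..<N} - I. A \<inter> cball (z i) \<sigma>)"
  have Sc: "compact S" unfolding S_def by (intro compact_UN) (auto intro: A compact_Int)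
  have Gc: "compact G" unfolding G_def using fZ by (intro compact_UN) auto
  have "A \<subseteq> S \<union> G"
  proof
    fix x assume x: "x \<in> A"
    then obtain i where i: "i < N" "x \<in> cball (z i) \<sigma>" using cover by auto
    show "x \<in> S \<union> G"
    proof (cases "i \<in> I")
      case True
      then obtain j where j: "j \<in> Z" "i = j \<or> dist (z i) (z j) < L * \<sigma>" using Z(3) by blast
      moreover have "0 < L * \<sigma>" using L \<sigma> by simp
      ultimately have "dist (z i) (z j) < L * \<sigma>" by auto
      then have "dist (z j) x \<le> (L + 1) * \<sigma>"
        using i(2) dist_triangle[of "z j" x "z i"] by (simp add: dist_commute algebra_simps)
      then show ?thesis using j by (auto simp: G_def)
    qed (use x i in \<open>auto simp: S_def\<close>)
  qed
  then have "measure lborel A \<le> measure lborel (S \<union> G)"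
    by (intro measure_mono_fmeasurable fm compact_Un Sc Gc) (auto simp: borel_compact A)
  also have "\<dots> \<le> measure lborel S + measure lborel G"
    using Sc Gc by (intro measure_Un_le) (auto simp: borel_compact)
  also have "measure lborel S \<le> (\<Sum>i\<in>{..<N} - I. measure lborel (A \<inter> cball (z i) \<sigma>))"
    unfolding S_def by (intro measure_UNION_le) (auto intro!: borel_compact compact_Int A)
  also have "\<dots> \<le> (\<Sum>i\<in>{..<N} - I. \<theta>)"
    by (intro sum_mono) (auto simp: I_def)
  also have "\<dots> \<le> measure lborel A / 2"
  proof (cases "\<theta> \<le> 0")
    case True
    then have "(\<Sum>i\<in>{..<N} - I. \<theta>) \<le> 0" by (intro sum_nonpos)
    also have "0 \<le> measure lborel A / 2" by simp
    finally show ?thesis .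
  next
    case False
    have "card ({..<N} - I) \<le> card {..<N}" by (intro card_mono) auto
    with False have "(\<Sum>i\<in>{..<N} - I. \<theta>) \<le> real N * \<theta>" by (auto intro!: mult_right_mono)
    with \<theta> show ?thesis by simp
  qed
  also have "measure lborel G \<le> (\<Sum>j\<in>Z. measure lborel (cball (z j) ((L + 1) * \<sigma>)))"
    unfolding G_def using fZ by (intro measure_UNION_le) auto
  also have "\<dots> = real (card Z) * (unit_ball_vol (real DIM('a)) * ((L + 1) * \<sigma>) ^ DIM('a))"
    using L \<sigma> by (simp add: content_cball)
  finally have "measure lborel A / 2 \<le> real (card Z) * (unit_ball_vol (real DIM('a)) * ((L + 1) * \<sigma>) ^ DIM('a))"
    by simp
  moreover have "Z \<subseteq> {..<N}" "\<forall>j\<in>Z. \<theta> \<le> measure lborel (A \<inter> cball (z j) \<sigma>)"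
    using Z(1) by (auto simp: I_def)
  ultimately show ?thesis using Z(2) by blast
qed

section \<open>Measures with a density\<close>

lemma radon_prob_on_basic:
  assumes "radon_prob_on X \<nu>"
  shows "space \<nu> = X" "(\<lambda>x. x) \<in> measurable \<nu> borel" "prob_space \<nu>"
proof -
  have sets: "sets \<nu> = sets (restrict_space borel X)" and "prob_space \<nu>"
    using assms by (auto simp: radon_prob_on_def)
  then show "space \<nu> = X" "prob_space \<nu>"
    using sets_eq_imp_space_eq[OF sets] by (simp_all add: space_restrict_space)
  show "(\<lambda>x. x) \<in> measurable \<nu> borel"
    unfolding measurable_cong_sets[OF sets refl] by (intro measurable_restrict_space1) simp
qed

lemma radon_prob_on_density:
  fixes X :: "'a::euclidean_space set"
  assumes radon: "radon_prob_on X \<nu>"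
    and ac: "absolutely_continuous lborel (distr \<nu> borel (\<lambda>x. x))"
  obtains p where "p \<in> borel_measurable borel" "\<And>x. 0 \<le> p x"
    "distr \<nu> borel (\<lambda>x. x) = density lborel (\<lambda>x. ennreal (p x))"
proof -
  define M where "M = distr \<nu> borel (\<lambda>x. x)"
  note id = radon_prob_on_basic(2)[OF radon] and prob = radon_prob_on_basic(3)[OF radon]
  interpret M: prob_space M unfolding M_def by (rule prob_space.prob_space_distr[OF prob id])
  have setsM: "sets M = sets lborel" by (simp add: M_def)
  have fin: "AE x in lborel. RN_deriv lborel M x \<noteq> \<infinity>"
    by (rule sigma_finite_measure.RN_deriv_finite[OF sigma_finite_lborel]) (use ac setsM in \<open>auto simp: M_def[symmetric] M.sigma_finite_measure_axioms\<close>)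
  have "M = density lborel (RN_deriv lborel M)"
    using sigma_finite_measure.density_RN_deriv[OF sigma_finite_lborel, of M] ac setsM by (simp add: M_def)
  also have "\<dots> = density lborel (\<lambda>x. ennreal (enn2real (RN_deriv lborel M x)))"
    using fin by (intro density_cong) (auto simp: less_top)
  finally show ?thesis
    by (intro that[of "\<lambda>x. enn2real (RN_deriv lborel M x)"]) (auto simp: M_def[symmetric])
qed

text \<open>
  The set where \<open>p\<close> is positive carries the measure, so one of the sets \<open>{x. p x \<ge> 1 / n}\<close> has
  positive measure, and inner regularity provides a compact subset.
\<close>

lemma ex_compact_positive_density:
  fixes X :: "'a::euclidean_space set"
  assumes radon: "radon_prob_on X \<nu>"
    and p [measurable]: "p \<in> borel_measurable borel" and p0: "\<And>x. 0 \<le> p x"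
    and M: "distr \<nu> borel (\<lambda>x. x) = density lborel (\<lambda>x. ennreal (p x))"
  obtains A \<delta> where "compact A" "A \<subseteq> closure X" "0 < \<delta>" "\<And>x. x \<in> A \<Longrightarrow> \<delta> \<le> p x" "0 < measure lborel A"
proof -
  define M where "M = distr \<nu> borel (\<lambda>x. x)"
  note space = radon_prob_on_basic(1)[OF radon] and id = radon_prob_on_basic(2)[OF radon]
    and prob = radon_prob_on_basic(3)[OF radon]
  interpret M: prob_space M unfolding M_def by (rule prob_space.prob_space_distr[OF prob id])
  have [simp]: "sets M = sets borel" by (simp add: M_def)
  define P where "P n = closure X \<inter> {x. 1 / real (Suc n) \<le> p x}" for n
  have P [measurable]: "P n \<in> sets borel" for n unfolding P_def by measurable
  have "\<exists>n. emeasure M (P n) \<noteq> 0"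
  proof (rule ccontr)
    assume "\<not> ?thesis"
    then have "P n \<in> null_sets M" for n by (auto simp: null_sets_def)
    then have "(\<Union>n. P n) \<in> null_sets M" by (intro null_sets_UN) auto
    \<comment> \<open>\<open>X\<close> need not be a Borel set, its closure is\<close>
    moreover have "- closure X \<in> null_sets M"
    proof -
      have "(\<lambda>x. x) -` (- closure X) \<inter> space \<nu> = {}" using closure_subset by (auto simp: space)
      then show ?thesis by (auto simp: null_sets_def M_def emeasure_distr[OF id])
    qed
    moreover have "{x. p x = 0} \<in> null_sets M"
    proof -
      have "emeasure M {x. p x = 0} = (\<integral>\<^sup>+x. ennreal (p x) * indicator {x. p x = 0} x \<partial>lborel)"
        unfolding M_def M by (subst emeasure_density) auto
      also have "\<dots> = (\<integral>\<^sup>+x. 0 \<partial>(lborel :: 'a measure))" by (intro nn_integral_cong) (auto simp: indicator_def)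
      finally show ?thesis by (auto simp: null_sets_def)
    qed
    ultimately have "(\<Union>n. P n) \<union> (- closure X) \<union> {x. p x = 0} \<in> null_sets M" by (intro null_sets.Un)
    moreover have "(\<Union>n. P n) \<union> (- closure X) \<union> {x. p x = 0} = UNIV"
    proof -
      have "x \<in> (\<Union>n. P n)" if "x \<in> closure X" "p x \<noteq> 0" for x
      proof -
        have "0 < p x" using p0[of x] that by simp
        then obtain n where "1 / real (Suc n) < p x" using nat_approx_posE by blast
        then show ?thesis using that by (auto simp: P_def intro!: exI[of _ n])
      qed
      then show ?thesis by blast
    qed
    ultimately have "emeasure M (space M) = 0" by (simp add: M_def null_sets_def)
    with M.emeasure_space_1 show False by simp
  qed
  then obtain n where n: "emeasure M (P n) \<noteq> 0" by blast
  have "emeasure M (P n) = (SUP C\<in>{C. C \<subseteq> P n \<and> compact C}. emeasure M C)"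
    by (rule inner_regular) auto
  with n have "0 < (SUP C\<in>{C. C \<subseteq> P n \<and> compact C}. emeasure M C)"
    by (simp add: zero_less_iff_neq_zero)
  then have "\<exists>C\<in>{C. C \<subseteq> P n \<and> compact C}. 0 < emeasure M C"
    by (simp only: less_SUP_iff)
  then obtain C where C: "C \<subseteq> P n" "compact C" "0 < emeasure M C" by blast
  have "emeasure lborel C \<noteq> 0"
  proof
    assume "emeasure lborel C = 0"
    then have "C \<in> null_sets lborel" using C by (auto simp: null_sets_def borel_compact)
    then have "AE x in lborel. x \<notin> C" by (rule AE_not_in)
    moreover have "emeasure M C = (\<integral>\<^sup>+x. ennreal (p x) * indicator C x \<partial>lborel)"
      unfolding M_def M using C(2) by (subst emeasure_density) (auto simp: borel_compact)
    moreover have "(\<lambda>x. ennreal (p x) * indicator C x) \<in> borel_measurable lborel"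
      using borel_compact[OF C(2)] by measurable
    ultimately have "emeasure M C = 0"
      by (simp add: nn_integral_0_iff_AE) (auto elim: eventually_mono)
    with C show False by simp
  qed
  then have "0 < measure lborel C"
    using emeasure_compact_finite[OF C(2)] by (simp add: measure_def enn2real_positive_iff zero_less_iff_neq_zero)
  with C show ?thesis
    by (intro that[of C "1 / real (Suc n)"]) (auto simp: P_def)
qed

lemma integral_radon_density:
  fixes g :: "'a::euclidean_space \<Rightarrow> real"
  assumes radon: "radon_prob_on X \<nu>"
    and p [measurable]: "p \<in> borel_measurable borel" and p0: "\<And>x. 0 \<le> p x"
    and M: "distr \<nu> borel (\<lambda>x. x) = density lborel (\<lambda>x. ennreal (p x))"
    and g [measurable]: "g \<in> borel_measurable borel"
  shows "integrable \<nu> g \<longleftrightarrow> integrable lborel (\<lambda>x. p x * g x)"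
    and "(\<integral>x. g x \<partial>\<nu>) = (\<integral>x. p x * g x \<partial>lborel)"
proof -
  note id = radon_prob_on_basic(2)[OF radon]
  have "integrable \<nu> g \<longleftrightarrow> integrable (distr \<nu> borel (\<lambda>x. x)) g"
    using integrable_distr_eq[OF id g] by simp
  also have "\<dots> \<longleftrightarrow> integrable lborel (\<lambda>x. p x * g x)"
    unfolding M using p0 by (subst integrable_real_density) auto
  finally show "integrable \<nu> g \<longleftrightarrow> integrable lborel (\<lambda>x. p x * g x)" .
  have "(\<integral>x. g x \<partial>\<nu>) = (\<integral>x. g x \<partial>distr \<nu> borel (\<lambda>x. x))"
    using integral_distr[OF id g] by simp
  also have "\<dots> = (\<integral>x. p x * g x \<partial>lborel)"
    unfolding M using p0 by (subst integral_real_density) auto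
  finally show "(\<integral>x. g x \<partial>\<nu>) = (\<integral>x. p x * g x \<partial>lborel)" .
qed

lemma AE_radon_if_AE_lborel:
  assumes radon: "radon_prob_on X \<nu>"
    and ac: "absolutely_continuous lborel (distr \<nu> borel (\<lambda>x. x))"
    and AE: "AE x in lborel. P x"
  shows "AE x in \<nu>. P x"
proof -
  have "AE x in distr \<nu> borel (\<lambda>x. x). P x"
    by (rule absolutely_continuous_AE[OF _ ac AE]) simp
  from AE_distrD[OF radon_prob_on_basic(2)[OF radon] this] show ?thesis .
qed

lemma quotient_by_density_in_L2:
  fixes h :: "'a::euclidean_space \<Rightarrow> real"
  assumes radon: "radon_prob_on X \<nu>"
    and p [measurable]: "p \<in> borel_measurable borel" and p0: "\<And>x. 0 \<le> p x"
    and M: "distr \<nu> borel (\<lambda>x. x) = density lborel (\<lambda>x. ennreal (p x))"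
    and h [measurable]: "h \<in> borel_measurable borel" and h2: "integrable lborel (\<lambda>x. (h x)\<^sup>2)"
    and \<delta>: "0 < \<delta>" "\<And>x. h x \<noteq> 0 \<Longrightarrow> \<delta> \<le> p x"
  shows "(\<lambda>x. h x / p x) \<in> L2_space \<nu>"
    and "\<delta> * L2_inner \<nu> (\<lambda>x. h x / p x) (\<lambda>x. h x / p x) \<le> (\<integral>x. (h x)\<^sup>2 \<partial>lborel)"
proof -
  note id = radon_prob_on_basic(2)[OF radon]
  have le: "\<delta> * (p x * (h x / p x)\<^sup>2) \<le> (h x)\<^sup>2" for x
  proof (cases "h x = 0")
    case False
    then have "0 < p x" using \<delta> by (meson less_le_trans)
    then have "\<delta> * (p x * (h x / p x)\<^sup>2) = (h x)\<^sup>2 * (\<delta> / p x)"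
      by (simp add: power2_eq_square)
    also have "\<dots> \<le> (h x)\<^sup>2 * 1"
      using False \<delta>(2)[of x] \<open>0 < p x\<close> by (intro mult_left_mono) auto
    finally show ?thesis by simp
  qed simp
  have int: "integrable lborel (\<lambda>x. p x * (h x / p x)\<^sup>2)"
  proof (rule Bochner_Integration.integrable_bound)
    show "integrable lborel (\<lambda>x. (1 / \<delta>) * (h x)\<^sup>2)" using h2 by simp
    show "AE x in lborel. norm (p x * (h x / p x)\<^sup>2) \<le> norm ((1 / \<delta>) * (h x)\<^sup>2)"
      using le \<delta>(1) p0 by (intro AE_I2) (auto simp: field_simps abs_mult)
  qed measurable
  have [measurable]: "(\<lambda>x. h x / p x) \<in> borel_measurable \<nu>"
    using measurable_compose[OF id, of "\<lambda>x. h x / p x" borel] by simp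
  show "(\<lambda>x. h x / p x) \<in> L2_space \<nu>"
    using int integral_radon_density(1)[OF radon p p0 M, of "\<lambda>x. (h x / p x)\<^sup>2"]
    by (simp add: L2_space_def)
  have "L2_inner \<nu> (\<lambda>x. h x / p x) (\<lambda>x. h x / p x) = (\<integral>x. p x * (h x / p x)\<^sup>2 \<partial>lborel)"
    using integral_radon_density(2)[OF radon p p0 M, of "\<lambda>x. (h x / p x)\<^sup>2"]
    by (simp add: L2_inner_def power2_eq_square)
  then have "\<delta> * L2_inner \<nu> (\<lambda>x. h x / p x) (\<lambda>x. h x / p x) = (\<integral>x. \<delta> * (p x * (h x / p x)\<^sup>2) \<partial>lborel)"
    by simp
  also have "\<dots> \<le> (\<integral>x. (h x)\<^sup>2 \<partial>lborel)"
    using int h2 by (intro integral_mono le) auto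
  finally show "\<delta> * L2_inner \<nu> (\<lambda>x. h x / p x) (\<lambda>x. h x / p x) \<le> (\<integral>x. (h x)\<^sup>2 \<partial>lborel)" .
qed

text \<open>
  Dividing by the density turns both integrals against \<open>\<nu>\<close> into Lebesgue integrals, so the form of the
  operator becomes translation invariant. The kernel is only known to agree almost everywhere with a
  Borel function of the difference, which is enough by absolute continuity.
\<close>

lemma integral_operator_quadratic_form:
  fixes k h :: "'a::euclidean_space \<Rightarrow> real"
  assumes radon: "radon_prob_on X \<nu>"
    and ac: "absolutely_continuous lborel (distr \<nu> borel (\<lambda>x. x))"
    and p [measurable]: "p \<in> borel_measurable borel" and p0: "\<And>x. 0 \<le> p x"
    and M: "distr \<nu> borel (\<lambda>x. x) = density lborel (\<lambda>x. ennreal (p x))"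
    and K: "\<And>x. x \<in> X \<Longrightarrow> K x \<in> borel_measurable \<nu>"
    and Kk: "\<And>x. x \<in> X \<Longrightarrow> AE y in lborel. y \<in> X \<longrightarrow> K x y = k (x - y)"
    and k: "integrable lborel k"
    and h: "integrable lborel h" and B: "\<And>x. \<bar>h x\<bar> \<le> B"
    and supp: "\<And>x. h x \<noteq> 0 \<Longrightarrow> 0 < p x"
  shows "L2_inner \<nu> (integral_operator \<nu> K (\<lambda>x. h x / p x)) (\<lambda>x. h x / p x) =
     (\<integral>q. k (fst q - snd q) * (h (fst q) * h (snd q)) \<partial>(lborel \<Otimes>\<^sub>M lborel))"
proof -
  note [measurable] = k[THEN borel_measurable_integrable, simplified] h[THEN borel_measurable_integrable, simplified]
  note space = radon_prob_on_basic(1)[OF radon] and id = radon_prob_on_basic(2)[OF radon]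
  have ph: "p x * (a * (h x / p x)) = a * h x" for x a
    using supp[of x] by (cases "h x = 0") auto
  have T: "integral_operator \<nu> K (\<lambda>x. h x / p x) x = (\<integral>y. k (x - y) * h y \<partial>lborel)" if x: "x \<in> X" for x
  proof -
    have [measurable]: "K x \<in> borel_measurable \<nu>" by (rule K[OF x])
    have m: "(\<lambda>y. k (x - y) * (h y / p y)) \<in> borel_measurable borel" by measurable
    from measurable_compose[OF id m] have [measurable]: "(\<lambda>y. k (x - y) * (h y / p y)) \<in> borel_measurable \<nu>" .
    have "(\<lambda>y. h y / p y) \<in> borel_measurable borel" by measurable
    from measurable_compose[OF id this] have [measurable]: "(\<lambda>y. h y / p y) \<in> borel_measurable \<nu>" .
    have "integral_operator \<nu> K (\<lambda>x. h x / p x) x = (\<integral>y. k (x - y) * (h y / p y) \<partial>\<nu>)"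
      unfolding integral_operator_def
    proof (rule integral_cong_AE)
      have "AE y in \<nu>. y \<in> X \<longrightarrow> K x y = k (x - y)"
        by (rule AE_radon_if_AE_lborel[OF radon ac Kk[OF x]])
      then show "AE y in \<nu>. K x y * (h y / p y) = k (x - y) * (h y / p y)"
        using AE_space[of \<nu>] by eventually_elim (simp add: space)
    qed measurable
    also have "\<dots> = (\<integral>y. k (x - y) * h y \<partial>lborel)"
      using integral_radon_density(2)[OF radon p p0 M m] by (simp only: ph)
    finally show ?thesis .
  qed
  have m: "(\<lambda>x. (\<integral>y. k (x - y) * h y \<partial>lborel) * (h x / p x)) \<in> borel_measurable borel"
    by measurable
  have "L2_inner \<nu> (integral_operator \<nu> K (\<lambda>x. h x / p x)) (\<lambda>x. h x / p x) =
      (\<integral>x. (\<integral>y. k (x - y) * h y \<partial>lborel) * (h x / p x) \<partial>\<nu>)"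
    unfolding L2_inner_def by (intro Bochner_Integration.integral_cong refl) (simp add: space T)
  also have "\<dots> = (\<integral>x. (\<integral>y. k (x - y) * h y \<partial>lborel) * h x \<partial>lborel)"
    using integral_radon_density(2)[OF radon p p0 M m] by (simp only: ph)
  also have "\<dots> = (\<integral>x. (\<integral>y. k (x - y) * (h x * h y) \<partial>lborel) \<partial>lborel)"
    unfolding integral_mult_left_zero[symmetric] by (simp only: mult_ac)
  also have "\<dots> = (\<integral>q. k (fst q - snd q) * (h (fst q) * h (snd q)) \<partial>(lborel \<Otimes>\<^sub>M lborel))"
    using lborel_pair.integral_fst'[OF integrable_difference_kernel[OF k h, of h B]] B by simp
  finally show ?thesis .
qed

section \<open>Lower bounds for the eigenvalues\<close>

text \<open>
  The min-max argument: among the functions \<open>h / p\<close> with \<open>h\<close> constant on each of at least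
  \<open>n\<close> separated sets, some nonzero one is orthogonal to the first \<open>n - 1\<close> eigenfunctions, and its
  Rayleigh quotient is estimated from below through the Gaussian form.
\<close>

lemma eigenvalue_ge_of_separated_sets:
  fixes k :: "'a::euclidean_space \<Rightarrow> real" and z :: "'j \<Rightarrow> 'a"
  assumes radon: "radon_prob_on X \<nu>"
    and ac: "absolutely_continuous lborel (distr \<nu> borel (\<lambda>x. x))"
    and p: "p \<in> borel_measurable borel" "\<And>x. 0 \<le> p x"
    and M: "distr \<nu> borel (\<lambda>x. x) = density lborel (\<lambda>x. ennreal (p x))"
    and K: "\<And>x. x \<in> X \<Longrightarrow> K x \<in> borel_measurable \<nu>"
    and Kk: "\<And>x. x \<in> X \<Longrightarrow> AE y in lborel. y \<in> X \<longrightarrow> K x y = k (x - y)"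
    and spec: "spectral_representation \<nu> (integral_operator \<nu> K) \<mu> e"
    and k: "integrable lborel k"
    and fourier: "\<And>\<xi>. (\<integral>z. k z *\<^sub>R cis (- (\<xi> \<bullet> z)) \<partial>lborel) = of_real (F (norm \<xi>))"
    and F: "\<And>r. r \<ge> 0 \<Longrightarrow> F r \<ge> b * exp (- ((r * \<sigma>)\<^sup>2 / 2))" and b: "b > 0"
    and \<sigma>: "\<sigma> > 0" and L: "L > 2"
    and Z: "finite Z" and E: "\<And>j. j \<in> Z \<Longrightarrow> compact (E j)"
    and sub: "\<And>j. j \<in> Z \<Longrightarrow> E j \<subseteq> cball (z j) \<sigma>"
    and sep: "\<And>i j. i \<in> Z \<Longrightarrow> j \<in> Z \<Longrightarrow> i \<noteq> j \<Longrightarrow> dist (z i) (z j) \<ge> L * \<sigma>"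
    and \<theta>: "\<And>j. j \<in> Z \<Longrightarrow> \<theta> \<le> measure lborel (E j)" "\<theta> > 0"
    and mass: "2 * exp 2 * (exp (- ((L - 2)\<^sup>2 / 4)) * (sqrt (4 * pi) * \<sigma>) ^ DIM('a)) \<le> \<theta>"
    and \<delta>: "0 < \<delta>" "\<And>j x. j \<in> Z \<Longrightarrow> x \<in> E j \<Longrightarrow> \<delta> \<le> p x"
    and n: "1 \<le> n" "n \<le> card Z"
  shows "\<delta> * (b * (1 / (\<sigma> * sqrt (2 * pi))) ^ DIM('a) * (exp (-2) / 2 * \<theta>)) \<le> \<mu> n"
proof -
  have e: "e i \<in> L2_space \<nu>" if "i \<ge> 1" for i
    using spec that by (auto simp: spectral_representation_def)
  have "card {1..<n} < card Z" using n by simp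
  from homogeneous_system_has_nonzero_solution[OF finite_atLeastLessThan Z this, of "\<lambda>i j. L2_inner \<nu> (\<lambda>x. indicator (E j) x / p x) (e i)"]
  obtain c where c: "\<exists>j\<in>Z. c j \<noteq> 0"
    "\<And>i. i \<in> {1..<n} \<Longrightarrow> (\<Sum>j\<in>Z. L2_inner \<nu> (\<lambda>x. indicator (E j) x / p x) (e i) * c j) = 0" by blast
  define h where "h = (\<lambda>x. \<Sum>j\<in>Z. c j * indicator (E j) x :: real)"
  define f where "f = (\<lambda>x. h x / p x)"
  have disj: "E i \<inter> E j = {}" if "i \<in> Z" "j \<in> Z" "i \<noteq> j" for i j
  proof (rule ccontr)
    assume "E i \<inter> E j \<noteq> {}"
    then obtain x where "x \<in> E i" "x \<in> E j" by blast
    then have "dist (z i) x \<le> \<sigma>" "dist (z j) x \<le> \<sigma>" using sub[OF that(1)] sub[OF that(2)] by auto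
    then have "dist (z i) (z j) \<le> 2 * \<sigma>" using dist_triangle2[of "z i" "z j" x] by linarith
    moreover have "2 * \<sigma> < L * \<sigma>" using L \<sigma> by simp
    ultimately show False using sep[OF that] by linarith
  qed
  have h2: "(h x)\<^sup>2 = (\<Sum>j\<in>Z. (c j)\<^sup>2 * indicator (E j) x)" for x
  proof (cases "\<exists>j\<in>Z. x \<in> E j")
    case True
    then obtain j where j: "j \<in> Z" "x \<in> E j" by blast
    have *: "(\<Sum>i\<in>Z. u i * indicator (E i) x) = (u j :: real)" for u
    proof -
      have "(\<Sum>i\<in>Z. u i * indicator (E i) x) = (\<Sum>i\<in>{j}. u i * indicator (E i) x)"
        using j Z disj by (intro sum.mono_neutral_right) (auto simp: indicator_def)
      then show ?thesis using j by simp
    qed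
    show ?thesis by (simp add: h_def *)
  next
    case False
    then show ?thesis by (simp add: h_def indicator_def)
  qed
  have inth: "integrable lborel h" unfolding h_def by (rule integrable_step[OF E])
  have inth2: "integrable lborel (\<lambda>x. (h x)\<^sup>2)" unfolding h2 by (rule integrable_step[OF E])
  have hm: "h \<in> borel_measurable borel" using inth borel_measurable_integrable by fastforce
  have supp: "\<delta> \<le> p x" if hx: "h x \<noteq> 0" for x
  proof -
    obtain j where j: "j \<in> Z" "c j * indicat_real (E j) x \<noteq> 0"
      using hx sum.neutral[of Z "\<lambda>j. c j * indicat_real (E j) x"] unfolding h_def by blast
    then have "x \<in> E j" by (auto simp: indicator_def split: if_splits)
    from \<delta>(2)[OF j(1) this] show ?thesis .
  qed
  have fL2: "f \<in> L2_space \<nu>" "\<delta> * L2_inner \<nu> f f \<le> (\<integral>x. (h x)\<^sup>2 \<partial>lborel)"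
    unfolding f_def using quotient_by_density_in_L2[OF radon p M hm inth2 \<delta>(1)] supp by blast+
  have indL2: "(\<lambda>x. indicator (E j) x / p x) \<in> L2_space \<nu>" if "j \<in> Z" for j
  proof (rule quotient_by_density_in_L2(1)[OF radon p M _ _ \<delta>(1)])
    show "indicat_real (E j) \<in> borel_measurable borel"
      using borel_compact[OF E[OF that]] by (rule borel_measurable_indicator)
    have "(\<lambda>x. (indicat_real (E j) x)\<^sup>2) = indicat_real (E j)"
      by (auto simp: fun_eq_iff indicator_def)
    then show "integrable lborel (\<lambda>x. (indicat_real (E j) x)\<^sup>2)"
      using integrable_indicator_compact[OF E[OF that]] by (simp only:)
    show "\<delta> \<le> p x" if "indicat_real (E j) x \<noteq> 0" for x
      using \<delta>(2)[OF \<open>j \<in> Z\<close>] that by (auto simp: indicator_def split: if_splits)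
  qed
  have f_sum: "f = (\<lambda>x. \<Sum>j\<in>Z. c j * (indicator (E j) x / p x))"
    by (simp add: f_def h_def sum_divide_distrib)
  have orth: "L2_inner \<nu> (e i) f = 0" if "i \<in> {1..<n}" for i
  proof -
    have "L2_inner \<nu> f (e i) = (\<Sum>j\<in>Z. c j * L2_inner \<nu> (\<lambda>x. indicator (E j) x / p x) (e i))"
      unfolding f_sum by (rule L2_inner_sum_left) (use indL2 e that in auto)
    then show ?thesis using c(2)[OF that] by (simp add: L2_inner_commute mult.commute)
  qed
  define S where "S = (\<Sum>j\<in>Z. (c j)\<^sup>2 * measure lborel (E j))"
  have S: "S > 0"
  proof -
    obtain j where j: "j \<in> Z" "c j \<noteq> 0" using c(1) by blast
    have "0 < (c j)\<^sup>2 * measure lborel (E j)" using j \<theta>(1)[OF j(1)] \<theta>(2) by simp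
    also have "\<dots> \<le> S" unfolding S_def using Z j by (intro member_le_sum) auto
    finally show ?thesis .
  qed
  have inth2_eq: "(\<integral>x. (h x)\<^sup>2 \<partial>lborel) = S"
  proof -
    have "integrable lborel (\<lambda>x. (c j)\<^sup>2 * indicat_real (E j) x)" if "j \<in> Z" for j
      using integrable_indicator_compact[OF E[OF that]] by simp
    moreover have "E j \<in> sets lborel" if "j \<in> Z" for j using E[OF that] by (simp add: borel_compact)
    ultimately show ?thesis unfolding h2 S_def by (simp add: Bochner_Integration.integral_sum)
  qed
  define C where "C = b * (1 / (\<sigma> * sqrt (2 * pi))) ^ DIM('a)"
  have C: "C > 0" using b \<sigma> by (simp add: C_def)
  have "C * (exp (-2) / 2 * (\<theta> * S)) \<le> C * (exp (-2) / 2 * (\<Sum>j\<in>Z. (c j)\<^sup>2 * (measure lborel (E j))\<^sup>2))"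
  proof -
    have "\<theta> * S \<le> (\<Sum>j\<in>Z. (c j)\<^sup>2 * (measure lborel (E j))\<^sup>2)"
      unfolding S_def sum_distrib_left
    proof (rule sum_mono)
      fix j assume "j \<in> Z"
      then have "\<theta> * ((c j)\<^sup>2 * measure lborel (E j)) \<le> measure lborel (E j) * ((c j)\<^sup>2 * measure lborel (E j))"
        using \<theta>(1) by (intro mult_right_mono) auto
      then show "\<theta> * ((c j)\<^sup>2 * measure lborel (E j)) \<le> (c j)\<^sup>2 * (measure lborel (E j))\<^sup>2"
        by (simp add: power2_eq_square mult_ac)
    qed
    then show ?thesis using C by simp
  qed
  also have "\<dots> \<le> C * (\<integral>q. gauss (1 / \<sigma>) (fst q - snd q) * (h (fst q) * h (snd q)) \<partial>(lborel \<Otimes>\<^sub>M lborel))"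
    using C \<theta>(1) mass
    by (intro mult_left_mono gauss_form_step_ge[OF \<sigma> L Z E sub sep _ h_def]) (auto intro: order_trans)
  also have "\<dots> \<le> (\<integral>q. k (fst q - snd q) * (h (fst q) * h (snd q)) \<partial>(lborel \<Otimes>\<^sub>M lborel))"
    using quadratic_form_ge_gauss[OF k fourier, of "1 / \<sigma>" b, OF _ _ Z E h_def] \<sigma> F
    by (simp add: C_def)
  also have "\<dots> = L2_inner \<nu> (integral_operator \<nu> K f) f"
    unfolding f_def
  proof (rule integral_operator_quadratic_form[OF radon ac p M K Kk k inth, symmetric])
    show "\<bar>h x\<bar> \<le> (\<Sum>j\<in>Z. \<bar>c j\<bar>)" for x
      unfolding h_def by (rule order_trans[OF sum_abs]) (auto simp: abs_mult indicator_def intro!: sum_mono)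
    show "0 < p x" if "h x \<noteq> 0" for x using supp[OF that] \<delta>(1) by simp
  qed
  also have "\<dots> \<le> \<mu> n * L2_inner \<nu> f f"
    by (rule rayleigh_quotient_le_eigenvalue[OF spec n(1) fL2(1) orth])
  finally have "\<delta> * (C * (exp (-2) / 2 * (\<theta> * S))) \<le> \<delta> * (\<mu> n * L2_inner \<nu> f f)"
    using \<delta>(1) by simp
  also have "\<dots> = \<mu> n * (\<delta> * L2_inner \<nu> f f)" by simp
  also have "\<dots> \<le> \<mu> n * S"
    using fL2(2) spec n unfolding inth2_eq
    by (intro mult_left_mono) (auto simp: spectral_representation_def less_imp_le)
  finally have "(\<delta> * (C * (exp (-2) / 2 * \<theta>))) * S \<le> \<mu> n * S" by (simp add: mult_ac)
  then show ?thesis using S by (simp add: C_def)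
qed

text \<open>
  Boundedness of \<open>F (s * t) / F s\<close> for a single \<open>t < 1 / 2\<close> already forces \<open>F\<close> to decay at most
  polynomially: \<open>F\<close> loses at most a factor \<open>M\<close> when its argument grows by \<open>T = 1 / t\<close>. A Gaussian
  decays faster, and the constant \<open>b\<close> comes from completing the square in \<open>(k + 1) * ln M - k\<^sup>2 / 2\<close>.
\<close>

lemma ex_gaussian_minorant:
  fixes F :: "real \<Rightarrow> real"
  assumes pos: "\<And>t. t > 0 \<Longrightarrow> F t > 0" and mono: "antimono_on {0..} F"
    and index: "has_dilation_index F (at_right 0) a"
  obtains b where "0 < b" "\<And>R r. 1 \<le> R \<Longrightarrow> 0 \<le> r \<Longrightarrow> b * F R * exp (- ((r / R)\<^sup>2 / 2)) \<le> F r"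
proof -
  have "\<forall>\<^sub>F t in at_right 0. bdd_above ((\<lambda>s. F (s * t) / F s) ` {1<..})"
    using index by (simp add: has_dilation_index_def)
  moreover have "\<forall>\<^sub>F t in at_right (0::real). t < 1 / 2"
    unfolding eventually_at_right_field by (intro exI[of _ "1 / 2"]) auto
  moreover have "\<forall>\<^sub>F t in at_right (0::real). 0 < t"
    by (rule eventually_at_right_less)
  ultimately have "\<forall>\<^sub>F t in at_right (0::real). bdd_above ((\<lambda>s. F (s * t) / F s) ` {1<..}) \<and> t < 1 / 2 \<and> 0 < t"
    by eventually_elim simp
  then have "\<exists>t. bdd_above ((\<lambda>s. F (s * t) / F s) ` {1<..}) \<and> t < 1 / 2 \<and> 0 < t"
    by (rule eventually_happens'[rotated]) simp
  then obtain t where t: "bdd_above ((\<lambda>s. F (s * t) / F s) ` {1<..})" "t < 1 / 2" "0 < t"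
    by blast
  then obtain M0 where M0: "\<And>s. s > 1 \<Longrightarrow> F (s * t) / F s \<le> M0"
    by (auto simp: bdd_above_def)
  define M where "M = max 1 M0"
  define T where "T = 1 / t"
  have T: "2 < T" using t by (simp add: T_def field_simps)
  have M: "1 \<le> M" by (simp add: M_def)
  have step: "F s \<le> M * F (T * s)" if "1 \<le> s" for s
  proof -
    have "1 * 1 < T * s" using T that by (intro mult_less_le_imp_less) auto
    then have Ts: "1 < T * s" by simp
    have "F s / F (T * s) \<le> M0" using M0[OF Ts] t by (simp add: T_def)
    also have "M0 \<le> M" by (simp add: M_def)
    finally show ?thesis using pos[of "T * s"] Ts by (simp add: field_simps)
  qed
  have iter: "F R \<le> M ^ k * F (T ^ k * R)" if "1 \<le> R" for R k
  proof (induction k)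
    case (Suc k)
    have "1 * 1 \<le> T ^ k * R" using T that by (intro mult_mono one_le_power) auto
    then have "F (T ^ k * R) \<le> M * F (T * (T ^ k * R))" by (intro step) simp
    then have "M ^ k * F (T ^ k * R) \<le> M ^ k * (M * F (T * (T ^ k * R)))"
      using M by (intro mult_left_mono) auto
    with Suc show ?case by (simp add: mult_ac)
  qed simp
  define m where "m = ln M"
  have m: "0 \<le> m" "M = exp m" using M by (simp_all add: m_def)
  define b where "b = exp (- (m\<^sup>2 / 2 + m))"
  show ?thesis
  proof (rule that[of b])
    show "0 < b" by (simp add: b_def)
    fix R r :: real assume R: "1 \<le> R" and r: "0 \<le> r"
    have FR: "0 < F R" using R pos by simp
    show "b * F R * exp (- ((r / R)\<^sup>2 / 2)) \<le> F r"
    proof (cases "r \<le> R")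
      case True
      have "0 \<le> m\<^sup>2" by simp
      with m(1) have "- (m\<^sup>2 / 2 + m) \<le> 0" by linarith
      then have "b \<le> 1" unfolding b_def by (simp only: exp_le_one_iff)
      then have "b * exp (- ((r / R)\<^sup>2 / 2)) \<le> 1 * 1" by (intro mult_mono) auto
      then have "F R * (b * exp (- ((r / R)\<^sup>2 / 2))) \<le> F R * 1"
        using FR by (intro mult_left_mono) auto
      also have "\<dots> \<le> F r" using True r R mono by (auto simp: monotone_on_def)
      finally show ?thesis by (simp add: mult_ac)
    next
      case False
      obtain n where "r / R < T ^ n" using real_arch_pow[of T "r / R"] T by auto
      moreover have "T ^ n \<le> T ^ Suc n" using T by simp
      ultimately have ex: "\<exists>k. r / R < T ^ Suc k" by (meson less_le_trans)
      \<comment> \<open>\<open>k\<close> is the integer part of the logarithm of \<open>r / R\<close> to the base \<open>T\<close>\<close>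
      define k where "k = (LEAST k. r / R < T ^ Suc k)"
      have k: "r / R < T ^ Suc k" unfolding k_def using ex by (rule LeastI_ex)
      have k': "T ^ k \<le> r / R"
      proof (cases k)
        case 0
        then show ?thesis using False R by simp
      next
        case (Suc l)
        then have "\<not> r / R < T ^ Suc l" using not_less_Least[of l "\<lambda>k. r / R < T ^ Suc k"] by (simp add: k_def)
        then show ?thesis using Suc by simp
      qed
      have "real k \<le> 2 ^ k" by (metis less_exp less_imp_le of_nat_le_iff of_nat_numeral of_nat_power)
      also have "\<dots> \<le> T ^ k" using T by (intro power_mono) auto
      also note k'
      finally have "(real k)\<^sup>2 \<le> (r / R)\<^sup>2" by (intro power_mono) auto
      moreover have "0 \<le> (real k - m)\<^sup>2" by simp
      ultimately have "- (m\<^sup>2 / 2 + m) + - ((r / R)\<^sup>2 / 2) \<le> - (real (Suc k) * m)"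
        by (simp add: power2_diff algebra_simps)
      then have "b * exp (- ((r / R)\<^sup>2 / 2)) \<le> exp (- (real (Suc k) * m))"
        unfolding b_def exp_add[symmetric] by simp
      also have "\<dots> = 1 / M ^ Suc k"
        unfolding m(2) exp_of_nat_mult[symmetric] by (simp only: exp_minus inverse_eq_divide)
      finally have "F R * (b * exp (- ((r / R)\<^sup>2 / 2))) \<le> F R * (1 / M ^ Suc k)"
        using FR by (intro mult_left_mono) auto
      also have "\<dots> \<le> F (T ^ Suc k * R)"
        using iter[OF R, of "Suc k"] M by (simp add: field_simps)
      also have "\<dots> \<le> F r"
      proof -
        have "r \<le> T ^ Suc k * R" using k R by (simp add: field_simps)
        then show ?thesis using r R T mono by (auto simp: monotone_on_def)
      qed
      finally show ?thesis by (simp add: mult_ac)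
    qed
  qed
qed

lemma AE_lborel_reflect:
  fixes x :: "'a::euclidean_space"
  assumes "AE z in lborel. P z"
  shows "AE y in lborel. P (x - y)"
proof -
  have "distr lborel borel (\<lambda>y. x - y) = (lborel :: 'a measure)"
    using lborel_affine[of "-1" x] by (simp add: density_1)
  then have "AE z in distr lborel borel (\<lambda>y. x - y). P z"
    by (simp only: assms)
  from AE_distrD[OF _ this] show ?thesis by simp
qed

text \<open>
  The radial kernel is only Lebesgue measurable; it is replaced by a Borel function that agrees with it
  almost everywhere, which has the same Fourier transform.
\<close>

lemma ex_borel_kernel:
  fixes \<kappa> F :: "real \<Rightarrow> real"
  assumes "radial_fourier TYPE('a::euclidean_space) \<kappa> F"
  obtains k :: "'a::euclidean_space \<Rightarrow> real" where "integrable lborel k"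
    "AE z in lborel. \<kappa> (norm z) = k z"
    "\<And>\<xi>. (\<integral>z. k z *\<^sub>R cis (- (\<xi> \<bullet> z)) \<partial>lborel) = of_real (F (norm \<xi>))"
proof -
  have int: "integrable lebesgue (\<lambda>x::'a. \<kappa> (norm x))"
    and F: "\<And>\<xi>::'a. of_real (F (norm \<xi>)) = (\<integral>x. of_real (\<kappa> (norm x)) * exp (- \<i> * complex_of_real (\<xi> \<bullet> x)) \<partial>lebesgue)"
    using assms by (auto simp: radial_fourier_def)
  have "\<exists>k\<in>borel_measurable lborel. AE z::'a in lborel. \<kappa> (norm z) = k z"
    by (rule completion_ex_borel_measurable_real) (use borel_measurable_integrable[OF int] in simp)
  then obtain k :: "'a \<Rightarrow> real" where [measurable]: "k \<in> borel_measurable borel" and k: "AE z in lborel. \<kappa> (norm z) = k z"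
    by auto
  have meas: "k \<in> borel_measurable lebesgue" by (rule measurable_completion) simp
  have int_k: "integrable lborel k"
  proof -
    have "integrable lebesgue k"
      using int integrable_cong_AE[OF borel_measurable_integrable[OF int] meas AE_completion[OF k]] by simp
    then show ?thesis by (simp add: integrable_completion)
  qed
  show ?thesis
  proof (rule that[OF int_k k])
    fix \<xi> :: 'a
    have "of_real (F (norm \<xi>)) = (\<integral>x. k x *\<^sub>R cis (- (\<xi> \<bullet> x)) \<partial>lebesgue)"
      unfolding F
    proof (rule integral_cong_AE)
      have [measurable]: "(\<lambda>x. exp (- \<i> * complex_of_real (\<xi> \<bullet> x))) \<in> borel_measurable lebesgue"
        by (rule measurable_completion) measurable
      note [measurable] = borel_measurable_integrable[OF int]
      show "(\<lambda>x. complex_of_real (\<kappa> (norm x)) * exp (- \<i> * complex_of_real (\<xi> \<bullet> x))) \<in> borel_measurable lebesgue"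
        by measurable
      show "(\<lambda>x. k x *\<^sub>R cis (- (\<xi> \<bullet> x))) \<in> borel_measurable lebesgue"
        by (rule measurable_completion) measurable
      show "AE x in lebesgue. complex_of_real (\<kappa> (norm x)) * exp (- \<i> * complex_of_real (\<xi> \<bullet> x)) = k x *\<^sub>R cis (- (\<xi> \<bullet> x))"
        using AE_completion[OF k] by eventually_elim (simp add: cis_conv_exp scaleR_conv_of_real)
    qed
    also have "\<dots> = (\<integral>x. k x *\<^sub>R cis (- (\<xi> \<bullet> x)) \<partial>lborel)"
      by (rule integral_completion) measurable
    finally show "(\<integral>z. k z *\<^sub>R cis (- (\<xi> \<bullet> z)) \<partial>lborel) = of_real (F (norm \<xi>))" ..
  qed
qed

lemma ex_cover_at_optimal_scale:
  fixes Y :: "'a::metric_space set" and d :: real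
  assumes Y: "compact Y" "Y \<noteq> {}"
    and covering: "covering_radius Y \<in> O(\<lambda>n. real n powr (- 1 / d))"
  obtains C where "0 < C"
    "\<forall>\<^sub>F N in sequentially. \<exists>z::nat \<Rightarrow> 'a. Y \<subseteq> (\<Union>i<N. cball (z i) (C * real N powr (- 1 / d)))"
proof -
  obtain C where C: "0 < C" "\<forall>\<^sub>F N in sequentially. norm (covering_radius Y N) \<le> C * norm (real N powr (- 1 / d))"
    using covering by (rule landau_o.bigE)
  obtain y0 where y0: "y0 \<in> Y" using Y(2) by blast
  have "bounded Y" using Y(1) by (rule compact_imp_bounded)
  then obtain r where r: "\<And>y. y \<in> Y \<Longrightarrow> dist y0 y \<le> r" by (auto simp: bounded_any_center[of _ y0])
  define S where "S N = {\<epsilon>. \<epsilon> > 0 \<and> (\<exists>c :: nat \<Rightarrow> 'a. (\<forall>i<N. c i \<in> Y) \<and> Y \<subseteq> (\<Union>i<N. cball (c i) \<epsilon>))}" for N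
  have S: "\<bar>r\<bar> + 1 \<in> S N" if "1 \<le> N" for N
  proof -
    have "Y \<subseteq> (\<Union>i<N. cball y0 (\<bar>r\<bar> + 1))"
    proof
      fix y assume "y \<in> Y"
      then have "dist y0 y \<le> \<bar>r\<bar> + 1" using r[of y] by linarith
      then show "y \<in> (\<Union>i<N. cball y0 (\<bar>r\<bar> + 1))" using that by (intro UN_I[of 0]) auto
    qed
    then show ?thesis using y0 by (auto simp: S_def intro!: exI[of _ "\<lambda>_. y0"])
  qed
  show ?thesis
  proof (rule that[of "C + 1"])
    show "\<forall>\<^sub>F N in sequentially. \<exists>z::nat \<Rightarrow> 'a. Y \<subseteq> (\<Union>i<N. cball (z i) ((C + 1) * real N powr (- 1 / d)))"
      using C(2) eventually_ge_at_top[of 1]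
    proof eventually_elim
      case (elim N)
      have "Inf (S N) \<le> C * real N powr (- 1 / d)"
        using elim by (simp add: covering_radius_def S_def)
      also have "\<dots> < (C + 1) * real N powr (- 1 / d)" using elim by simp
      finally obtain \<epsilon> where "\<epsilon> \<in> S N" "\<epsilon> < (C + 1) * real N powr (- 1 / d)"
        using cInf_lessD[of "S N"] S[OF elim(2)] by blast
      then obtain c where "Y \<subseteq> (\<Union>i<N. cball (c i) \<epsilon>)" by (auto simp: S_def)
      also have "\<dots> \<subseteq> (\<Union>i<N. cball (c i) ((C + 1) * real N powr (- 1 / d)))"
        using \<open>\<epsilon> < _\<close> by (intro UN_mono subset_cball) auto
      finally show ?case by blast
    qed
  qed (use C in simp)
qed

text \<open>
  The radius \<open>\<sigma>\<close> of the covering balls, the mass bound \<open>t * \<sigma> ^ d\<close> and the separation \<open>L\<close> are tied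
  together: \<open>t\<close> is fixed by the measure of \<open>A\<close>, and \<open>L\<close> is then taken large enough, depending on
  \<open>t\<close> and \<open>d\<close>, for the Gaussian tail to be negligible. This yields \<open>\<gamma> * N\<close> sets at scale
  \<open>N powr (- 1 / d)\<close>, and \<open>N\<close> is finally chosen of order \<open>n / \<gamma>\<close>.
\<close>

lemma eigenvalue_ge_fourier:
  fixes k :: "'a::euclidean_space \<Rightarrow> real" and F :: "real \<Rightarrow> real"
  assumes radon: "radon_prob_on X \<nu>"
    and ac: "absolutely_continuous lborel (distr \<nu> borel (\<lambda>x. x))"
    and X: "compact (closure X)"
    and covering: "covering_radius (closure X) \<in> O(\<lambda>n. real n powr (- 1 / real DIM('a)))"
    and K: "\<And>x. x \<in> X \<Longrightarrow> K x \<in> borel_measurable \<nu>"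
    and Kk: "\<And>x. x \<in> X \<Longrightarrow> AE y in lborel. y \<in> X \<longrightarrow> K x y = k (x - y)"
    and spec: "spectral_representation \<nu> (integral_operator \<nu> K) \<mu> e"
    and k: "integrable lborel k"
    and fourier: "\<And>\<xi>. (\<integral>z. k z *\<^sub>R cis (- (\<xi> \<bullet> z)) \<partial>lborel) = of_real (F (norm \<xi>))"
    and pos: "\<And>t. t > 0 \<Longrightarrow> F t > 0" and mono: "antimono_on {0..} F"
    and index: "has_dilation_index F (at_right 0) \<alpha>"
  obtains c where "0 < c" "\<forall>\<^sub>F n in sequentially. c * F (real n powr (1 / real DIM('a))) \<le> \<mu> n"
proof -
  let ?d = "real DIM('a)"
  have d: "0 < ?d" by simp
  obtain p where p: "p \<in> borel_measurable borel" "\<And>x. 0 \<le> p x"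
    and M: "distr \<nu> borel (\<lambda>x. x) = density lborel (\<lambda>x. ennreal (p x))"
    using radon_prob_on_density[OF radon ac] by blast
  obtain A \<delta> where A: "compact A" "A \<subseteq> closure X" "0 < \<delta>" "\<And>x. x \<in> A \<Longrightarrow> \<delta> \<le> p x" "0 < measure lborel A"
    using ex_compact_positive_density[OF radon p M] by blast
  obtain b where b: "0 < b" "\<And>R r. 1 \<le> R \<Longrightarrow> 0 \<le> r \<Longrightarrow> b * F R * exp (- ((r / R)\<^sup>2 / 2)) \<le> F r"
    using ex_gaussian_minorant[OF pos mono index] by blast
  have "closure X \<noteq> {}" using A by auto
  from ex_cover_at_optimal_scale[OF X this covering] obtain C where C: "0 < C"
    "\<forall>\<^sub>F N in sequentially. \<exists>z::nat \<Rightarrow> 'a. closure X \<subseteq> (\<Union>i<N. cball (z i) (C * real N powr (- 1 / ?d)))"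
    by blast
  define a where "a = measure lborel A"
  have a: "0 < a" using A(5) by (simp add: a_def)
  \<comment> \<open>chosen such that \<open>N * (t * \<sigma> ^ d) = a / 2\<close> for the radius \<open>\<sigma>\<close> below\<close>
  define t where "t = a / (2 * C ^ DIM('a))"
  have t: "0 < t" using a C(1) by (simp add: t_def)
  \<comment> \<open>\<open>y\<close> is the exponent \<open>(L - 2)\<^sup>2 / 4\<close> that the mass condition asks for\<close>
  define y where "y = max 1 (ln (2 * exp 2 * sqrt (4 * pi) ^ DIM('a) / t))"
  define L where "L = 2 + 2 * sqrt y"
  have y: "1 \<le> y" by (simp add: y_def)
  have L: "2 < L" using y by (simp add: L_def)
  have Ly: "(L - 2)\<^sup>2 / 4 = y" using y by (simp add: L_def power_mult_distrib)
  have mass: "2 * exp 2 * (exp (- ((L - 2)\<^sup>2 / 4)) * sqrt (4 * pi) ^ DIM('a)) \<le> t"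
  proof -
    define Q where "Q = 2 * exp 2 * sqrt (4 * pi) ^ DIM('a)"
    have Q: "0 < Q" by (simp add: Q_def)
    have "exp (ln (Q / t)) \<le> exp y" by (simp add: y_def Q_def)
    then have "Q / t \<le> exp y" using Q t by simp
    then show ?thesis unfolding Ly using t by (simp add: Q_def exp_minus field_simps)
  qed
  define v where "v = unit_ball_vol ?d"
  have v: "0 < v" by (simp add: v_def)
  define \<gamma> where "\<gamma> = a / (2 * v * ((L + 1) * C) ^ DIM('a))"
  have \<gamma>: "0 < \<gamma>" using a v L C(1) by (simp add: \<gamma>_def)
  define c1 where "c1 = \<delta> * b * exp (-2) * t / (2 * sqrt (2 * pi) ^ DIM('a))"
  have c1: "0 < c1" using A(3) b(1) t by (simp add: c1_def)
  have "\<forall>\<^sub>F N in sequentially. C \<le> real N powr (1 / ?d)"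
    by real_asymp
  then have "\<forall>\<^sub>F N in sequentially. \<forall>n\<ge>1. real n \<le> \<gamma> * real N \<longrightarrow> c1 * F (real N powr (1 / ?d) / C) \<le> \<mu> n"
    using C(2) eventually_ge_at_top[of 1]
  proof eventually_elim
    case (elim N)
    define \<sigma> where "\<sigma> = C * real N powr (- 1 / ?d)"
    have \<sigma>: "0 < \<sigma>" using elim C(1) by (simp add: \<sigma>_def)
    have \<sigma>_inv: "1 / \<sigma> = real N powr (1 / ?d) / C"
      by (simp add: \<sigma>_def powr_minus_divide)
    have \<sigma>1: "1 \<le> 1 / \<sigma>" unfolding \<sigma>_inv using elim(1) C(1) by simp
    have \<sigma>_pow: "\<sigma> ^ DIM('a) = C ^ DIM('a) / real N"
    proof -
      have "(real N powr (- 1 / ?d)) ^ DIM('a) = real N powr (- 1)"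
        using elim by (simp add: powr_powr flip: powr_realpow)
      then show ?thesis unfolding \<sigma>_def power_mult_distrib using elim by (simp add: powr_minus_divide power_divide)
    qed
    define \<theta> where "\<theta> = t * \<sigma> ^ DIM('a)"
    have \<theta>: "0 < \<theta>" using t \<sigma> by (simp add: \<theta>_def)
    have \<theta>N: "real N * \<theta> = a / 2" using elim C(1) by (simp add: \<theta>_def \<sigma>_pow t_def)
    obtain z :: "nat \<Rightarrow> 'a" where z: "closure X \<subseteq> (\<Union>i<N. cball (z i) \<sigma>)"
      using elim(2) by (auto simp: \<sigma>_def)
    have "A \<subseteq> (\<Union>i<N. cball (z i) \<sigma>)" using A(2) z by blast
    moreover have "0 < L" "real N * \<theta> \<le> measure lborel A / 2" using L \<theta>N by (simp_all add: a_def)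
    ultimately obtain Z where Z: "Z \<subseteq> {..<N}"
      "\<And>i j. i \<in> Z \<Longrightarrow> j \<in> Z \<Longrightarrow> i \<noteq> j \<Longrightarrow> L * \<sigma> \<le> dist (z i) (z j)"
      "\<And>j. j \<in> Z \<Longrightarrow> \<theta> \<le> measure lborel (A \<inter> cball (z j) \<sigma>)"
      "measure lborel A / 2 \<le> real (card Z) * (v * ((L + 1) * \<sigma>) ^ DIM('a))"
      using ex_separated_balls_with_mass[OF A(1) _ \<sigma>, of z N L \<theta>] unfolding v_def by blast
    have card: "\<gamma> * real N \<le> real (card Z)"
    proof -
      define q where "q = v * ((L + 1) * C) ^ DIM('a)"
      have q: "0 < q" using v L C(1) by (simp add: q_def)
      have "v * ((L + 1) * \<sigma>) ^ DIM('a) = q / real N"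
        by (simp add: q_def power_mult_distrib \<sigma>_pow)
      then have "a / 2 \<le> real (card Z) * (q / real N)" using Z(4) by (simp add: a_def)
      then have "a / (2 * q) * real N \<le> real (card Z)" using q elim by (simp add: field_simps)
      then show ?thesis by (simp add: \<gamma>_def q_def mult.assoc)
    qed
    show ?case
    proof (intro allI impI)
      fix n :: nat assume n: "1 \<le> n" "real n \<le> \<gamma> * real N"
      then have n': "n \<le> card Z" using card by linarith
      have "\<delta> * (b * F (1 / \<sigma>) * (1 / (\<sigma> * sqrt (2 * pi))) ^ DIM('a) * (exp (-2) / 2 * \<theta>)) \<le> \<mu> n"
      proof (rule eigenvalue_ge_of_separated_sets[OF radon ac p M K Kk spec k fourier])
        show "b * F (1 / \<sigma>) * exp (- ((r * \<sigma>)\<^sup>2 / 2)) \<le> F r" if "0 \<le> r" for r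
          using b(2)[OF \<sigma>1 that] by simp
        show "0 < b * F (1 / \<sigma>)" using b(1) pos[of "1 / \<sigma>"] \<sigma> by simp
        show "finite Z" using Z(1) finite_subset by blast
        show "compact (A \<inter> cball (z j) \<sigma>)" if "j \<in> Z" for j using A(1) by (simp add: compact_Int)
        show "2 * exp 2 * (exp (- ((L - 2)\<^sup>2 / 4)) * (sqrt (4 * pi) * \<sigma>) ^ DIM('a)) \<le> \<theta>"
          using mult_right_mono[OF mass, of "\<sigma> ^ DIM('a)"] \<sigma> by (simp add: \<theta>_def power_mult_distrib mult_ac)
        show "L * \<sigma> \<le> dist (z i) (z j)" if "i \<in> Z" "j \<in> Z" "i \<noteq> j" for i j
          by (rule Z(2)[OF that])
        show "\<theta> \<le> measure lborel (A \<inter> cball (z j) \<sigma>)" if "j \<in> Z" for j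
          by (rule Z(3)[OF that])
        show "\<delta> \<le> p x" if "x \<in> A \<inter> cball (z j) \<sigma>" for j x
          using that by (intro A(4)) simp
        show "1 \<le> n" by (rule n(1))
      qed (simp_all add: \<sigma> L \<theta> A(3) n')
      also have "\<delta> * (b * F (1 / \<sigma>) * (1 / (\<sigma> * sqrt (2 * pi))) ^ DIM('a) * (exp (-2) / 2 * \<theta>)) = c1 * F (1 / \<sigma>)"
        using \<sigma> by (simp add: c1_def \<theta>_def power_mult_distrib power_divide field_simps)
      finally show "c1 * F (real N powr (1 / ?d) / C) \<le> \<mu> n" by (simp add: \<sigma>_inv)
    qed
  qed
  then obtain N0 where N0: "\<And>N n. N \<ge> N0 \<Longrightarrow> n \<ge> 1 \<Longrightarrow> real n \<le> \<gamma> * real N \<Longrightarrow> c1 * F (real N powr (1 / ?d) / C) \<le> \<mu> n"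
    by (auto simp: eventually_sequentially)
  \<comment> \<open>replacing \<open>N\<close> by \<open>n\<close> changes the argument of \<open>F\<close> by at most the factor \<open>q\<close>, which costs only a
    constant by the Gaussian minorant\<close>
  define q where "q = max 1 ((1 / \<gamma> + 1) powr (1 / ?d) / C)"
  have "1 \<le> q" by (simp add: q_def)
  define c where "c = c1 * b * exp (- (q\<^sup>2 / 2))"
  show ?thesis
  proof (rule that[of c])
    show "0 < c" using c1 b(1) by (simp add: c_def)
    have "\<forall>\<^sub>F n in sequentially. real N0 \<le> real n / \<gamma>"
      using \<gamma> by real_asymp
    then show "\<forall>\<^sub>F n in sequentially. c * F (real n powr (1 / ?d)) \<le> \<mu> n"
      using eventually_ge_at_top[of 1]
    proof eventually_elim
      case (elim n)
      define N where "N = nat \<lceil>real n / \<gamma>\<rceil>"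
      have N: "real n / \<gamma> \<le> real N" "real N \<le> real n / \<gamma> + 1"
        using \<gamma> by (auto simp: N_def)
      have "real N0 \<le> real N" using elim(1) N(1) by linarith
      then have N_ge: "N0 \<le> N" by simp
      have nN: "real n \<le> \<gamma> * real N" using N(1) \<gamma> by (simp add: field_simps)
      have R: "1 \<le> real n powr (1 / ?d)" using elim(2) by (intro ge_one_powr_ge_zero) auto
      have "real N powr (1 / ?d) / C \<le> q * real n powr (1 / ?d)"
      proof -
        have "real N \<le> (1 / \<gamma> + 1) * real n" using N(2) elim(2) by (simp add: algebra_simps)
        then have "real N powr (1 / ?d) \<le> ((1 / \<gamma> + 1) * real n) powr (1 / ?d)"
          by (intro powr_mono2) auto
        also have "\<dots> = (1 / \<gamma> + 1) powr (1 / ?d) * real n powr (1 / ?d)"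
          using \<gamma> by (simp add: powr_mult)
        finally have "real N powr (1 / ?d) / C \<le> (1 / \<gamma> + 1) powr (1 / ?d) / C * real n powr (1 / ?d)"
          using C(1) by (simp add: divide_right_mono)
        also have "\<dots> \<le> q * real n powr (1 / ?d)"
          by (intro mult_right_mono) (auto simp: q_def)
        finally show ?thesis .
      qed
      then have "F (q * real n powr (1 / ?d)) \<le> F (real N powr (1 / ?d) / C)"
        using mono C(1) by (auto simp: monotone_on_def q_def)
      moreover have "b * F (real n powr (1 / ?d)) * exp (- (q\<^sup>2 / 2)) \<le> F (q * real n powr (1 / ?d))"
        using b(2)[OF R, of "q * real n powr (1 / ?d)"] elim(2) \<open>1 \<le> q\<close> by simp
      ultimately have "c1 * (b * F (real n powr (1 / ?d)) * exp (- (q\<^sup>2 / 2))) \<le> c1 * F (real N powr (1 / ?d) / C)"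
        using c1 by (intro mult_left_mono) auto
      also have "\<dots> \<le> \<mu> n" by (rule N0[OF N_ge elim(2) nN])
      finally show ?case by (simp add: c_def mult_ac)
    qed
  qed
qed

section \<open>Index functions and generalized inverses\<close>

lemma Delta2_power_le:
  assumes "Delta2 \<psi> D1 D2" "D1 > 1" "t > 0"
  shows "D1 ^ k * \<psi> t \<le> \<psi> (2 ^ k * t)"
proof (induction k)
  case (Suc k)
  have "D1 * (D1 ^ k * \<psi> t) \<le> D1 * \<psi> (2 ^ k * t)" using Suc assms by simp
  also have "\<dots> \<le> \<psi> (2 * (2 ^ k * t))" using assms by (simp add: Delta2_def)
  finally show ?case by (simp add: mult_ac)
qed simp

lemma generalized_inverse_le:
  assumes "0 \<le> t" "y \<le> \<psi> t"
  shows "generalized_inverse \<psi> y \<le> t"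
  unfolding generalized_inverse_def
  using assms by (intro cInf_lower) (auto intro: bdd_belowI[of _ 0])

lemma generalized_inverse_ge:
  assumes "index_function \<psi>" "0 \<le> u" "\<psi> u < y" "0 \<le> t" "y \<le> \<psi> t"
  shows "u \<le> generalized_inverse \<psi> y"
  unfolding generalized_inverse_def
proof (rule cInf_greatest)
  show "{t. 0 \<le> t \<and> y \<le> \<psi> t} \<noteq> {}" using assms by auto
  fix x assume "x \<in> {t. 0 \<le> t \<and> y \<le> \<psi> t}"
  then have "0 \<le> x" "\<psi> u < \<psi> x" using assms by auto
  with assms show "u \<le> x"
    by (metis (no_types, lifting) atLeast_iff index_function_def monotone_onD not_less linear order.strict_iff_not)
qed

section \<open>Growth of the sup-norm on spans of eigenfunctions\<close>

lemma ex_rational_sequence: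
  fixes v :: real
  shows "\<exists>q. (\<forall>k::nat. q k \<in> \<rat>) \<and> q \<longlonglongrightarrow> v"
  using closure_sequential[of v "\<rat>"] by (simp add: Rats_closure_real)

text \<open>
  For almost every \<open>x\<close> the bound \<open>\<bar>\<Sum>i. c i * e i x\<bar> \<le> M * \<bar>c\<bar>\<close> holds simultaneously for the countably many
  rational vectors \<open>c\<close>, hence by continuity for the vector \<open>c i = e i x\<close>, which gives
  \<open>(\<Sum>i. (e i x)\<^sup>2) \<le> M\<^sup>2\<close>. The integral of the left-hand side is \<open>n\<close>.
\<close>

lemma dim_le_sup_norm_growth_squared:
  assumes prob: "prob_space \<nu>" and n: "n \<ge> 1"
    and e: "\<And>j. j \<ge> 1 \<Longrightarrow> e j \<in> L2_space \<nu>"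
    and on: "\<And>i j. i \<ge> 1 \<Longrightarrow> j \<ge> 1 \<Longrightarrow> L2_inner \<nu> (e i) (e j) = (if i = j then 1 else 0)"
    and M: "sup_norm_growth \<nu> e n \<le> ereal M"
  shows "0 \<le> M" "real n \<le> M\<^sup>2"
proof -
  interpret prob_space \<nu> by (rule prob)
  have unit: "AE x in \<nu>. \<bar>\<Sum>i=1..n. c i * e i x\<bar> \<le> M" if "(\<Sum>i=1..n. (c i)\<^sup>2) = 1" for c :: "nat \<Rightarrow> real"
  proof -
    have "Linf_enorm \<nu> (\<lambda>x. \<Sum>i=1..n. c i * e i x) \<le> sup_norm_growth \<nu> e n"
      unfolding sup_norm_growth_def using that by (intro SUP_upper) auto
    also note M
    finally have "esssup \<nu> (\<lambda>x. ereal \<bar>\<Sum>i=1..n. c i * e i x\<bar>) \<le> ereal M" by (simp add: Linf_enorm_def)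
    with esssup_AE[of "\<lambda>x. ereal \<bar>\<Sum>i=1..n. c i * e i x\<bar>" \<nu>]
    show ?thesis by (auto elim!: eventually_mono dest: order_trans)
  qed
  have "(\<Sum>i=1..n. (if i = 1 then 1 else 0 :: real)\<^sup>2) = 1"
    using n by (simp add: if_distrib[of "\<lambda>x. x\<^sup>2"] sum.delta cong: if_cong)
  from unit[OF this] have "AE x in \<nu>. 0 \<le> M" by eventually_elim (meson abs_ge_zero order_trans)
  then show M0: "0 \<le> M" by simp
  have bound: "AE x in \<nu>. \<bar>\<Sum>i=1..n. c i * e i x\<bar> \<le> M * sqrt (\<Sum>i=1..n. (c i)\<^sup>2)" for c :: "nat \<Rightarrow> real"
  proof -
    define r where "r = sqrt (\<Sum>i=1..n. (c i)\<^sup>2)"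
    have r2: "r\<^sup>2 = (\<Sum>i=1..n. (c i)\<^sup>2)" by (simp add: r_def sum_nonneg)
    have r0: "0 \<le> r" by (simp add: r_def sum_nonneg)
    show ?thesis
    proof (cases "r = 0")
      case True
      then have "(\<Sum>i=1..n. (c i)\<^sup>2) = 0" using r2 by simp
      then have "\<forall>i\<in>{1..n}. (c i)\<^sup>2 = 0" by (simp add: sum_nonneg_eq_0_iff)
      then have "(\<Sum>i=1..n. c i * e i x) = 0" for x by (intro sum.neutral) auto
      then show ?thesis using True r_def by simp
    next
      case False
      then have "(\<Sum>i=1..n. (c i / r)\<^sup>2) = 1"
        by (simp add: power_divide r2 flip: sum_divide_distrib) (use r2 in auto)
      from unit[OF this] show ?thesis
      proof eventually_elim
        case (elim x)
        have "(\<Sum>i=1..n. c i / r * e i x) = (\<Sum>i=1..n. c i * e i x) / r"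
          by (simp add: sum_divide_distrib)
        with elim have "\<bar>\<Sum>i=1..n. c i * e i x\<bar> / r \<le> M" using r0 by (simp only: abs_divide abs_of_nonneg)
        then show ?case unfolding r_def[symmetric] using False r0 by (simp add: pos_divide_le_eq)
      qed
    qed
  qed
  define Q where "Q = PiE {1..n} (\<lambda>_. \<rat> :: real set)"
  have Q: "countable Q" unfolding Q_def by (intro countable_PiE) (auto simp: countable_rat)
  have "AE x in \<nu>. \<forall>c\<in>Q. \<bar>\<Sum>i=1..n. c i * e i x\<bar> \<le> M * sqrt (\<Sum>i=1..n. (c i)\<^sup>2)"
    using bound by (simp only: AE_ball_countable[OF Q]) blast
  then have ae: "AE x in \<nu>. (\<Sum>i=1..n. (e i x)\<^sup>2) \<le> M\<^sup>2"
  proof eventually_elim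
    case (elim x)
    have "\<exists>q. \<forall>i. (\<forall>k::nat. q i k \<in> \<rat>) \<and> q i \<longlonglongrightarrow> e i x"
      using ex_rational_sequence by (intro choice) auto
    then obtain q where q: "\<And>i k. q i k \<in> \<rat>" "\<And>i. q i \<longlonglongrightarrow> e i x" by blast
    have "\<bar>\<Sum>i=1..n. q i k * e i x\<bar> \<le> M * sqrt (\<Sum>i=1..n. (q i k)\<^sup>2)" for k
    proof -
      have "restrict (\<lambda>i. q i k) {1..n} \<in> Q" using q(1) by (auto simp: Q_def)
      from elim[rule_format, OF this] show ?thesis by simp
    qed
    moreover have "(\<lambda>k. \<bar>\<Sum>i=1..n. q i k * e i x\<bar>) \<longlonglongrightarrow> \<bar>\<Sum>i=1..n. e i x * e i x\<bar>"
      by (intro tendsto_intros q(2))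
    moreover have "(\<lambda>k. M * sqrt (\<Sum>i=1..n. (q i k)\<^sup>2)) \<longlonglongrightarrow> M * sqrt (\<Sum>i=1..n. (e i x)\<^sup>2)"
      by (intro tendsto_intros q(2))
    ultimately have "\<bar>\<Sum>i=1..n. e i x * e i x\<bar> \<le> M * sqrt (\<Sum>i=1..n. (e i x)\<^sup>2)"
      by (intro LIMSEQ_le[of "\<lambda>k. \<bar>\<Sum>i=1..n. q i k * e i x\<bar>" _ "\<lambda>k. M * sqrt (\<Sum>i=1..n. (q i k)\<^sup>2)"]) auto
    moreover define r where "r = sqrt (\<Sum>i=1..n. (e i x)\<^sup>2)"
    moreover have r2: "r\<^sup>2 = (\<Sum>i=1..n. (e i x)\<^sup>2)" by (simp add: r_def sum_nonneg)
    ultimately have "r * r \<le> M * r" by (simp add: sum_nonneg power2_eq_square)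
    moreover have "0 \<le> r" by (simp add: r_def sum_nonneg)
    ultimately have "r \<le> M" using M0 by (cases "r = 0") auto
    then show ?case unfolding r2[symmetric] using \<open>0 \<le> r\<close> by (intro power_mono)
  qed
  have "real n = (\<Sum>i=1..n. L2_inner \<nu> (e i) (e i))" by (simp add: on)
  also have "\<dots> = (\<integral>x. (\<Sum>i=1..n. (e i x)\<^sup>2) \<partial>\<nu>)"
    using e by (subst Bochner_Integration.integral_sum) (auto simp: L2_inner_def power2_eq_square L2_mult_integrable)
  also have "\<dots> \<le> M\<^sup>2"
  proof (rule integral_le_const[OF _ ae])
    show "integrable \<nu> (\<lambda>x. \<Sum>i=1..n. (e i x)\<^sup>2)"
      using e by (intro Bochner_Integration.integrable_sum) (auto simp: L2_space_def)
  qed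
  finally show "real n \<le> M\<^sup>2" .
qed

lemma sup_norm_growth_le_of_embedding:
  assumes spec: "spectral_representation \<nu> T \<mu> e"
    and emb: "bounded_embedding (scale_space \<nu> \<mu> e w) (scale_norm \<nu> \<mu> e w) (Linf_space \<nu>) (Linf_norm \<nu>)"
    and w: "\<And>t. t > 0 \<Longrightarrow> w t > 0" "mono_on {0<..} w"
  obtains C where "0 \<le> C" "\<And>n. n \<ge> 1 \<Longrightarrow> sup_norm_growth \<nu> e n \<le> ereal (C / sqrt (w (\<mu> n)))"
proof -
  obtain C where sub: "scale_space \<nu> \<mu> e w \<subseteq> Linf_space \<nu>"
    and C: "\<And>f. f \<in> scale_space \<nu> \<mu> e w \<Longrightarrow> Linf_norm \<nu> f \<le> C * scale_norm \<nu> \<mu> e w f"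
    using emb by (auto simp: bounded_embedding_def)
  have e: "e j \<in> L2_space \<nu>" and on: "L2_inner \<nu> (e i) (e j) = (if i = j then 1 else 0)"
    and \<mu>: "0 < \<mu> j" if "i \<ge> 1" "j \<ge> 1" for i j
    using spec that by (auto simp: spectral_representation_def)
  show ?thesis
  proof (rule that[of "\<bar>C\<bar>"])
    fix n :: nat assume n: "n \<ge> 1"
    show "sup_norm_growth \<nu> e n \<le> ereal (\<bar>C\<bar> / sqrt (w (\<mu> n)))"
      unfolding sup_norm_growth_def
    proof (rule SUP_least)
      fix c :: "nat \<Rightarrow> real" assume "c \<in> {c. (\<Sum>i=1..n. (c i)\<^sup>2) = 1}"
      then have c: "(\<Sum>i=1..n. (c i)\<^sup>2) = 1" by simp
      define f where "f = (\<lambda>x. \<Sum>i=1..n. c i * e i x)"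
      have coeff: "L2_inner \<nu> f (e i) = (if i \<in> {1..n} then c i else 0)" if "i \<ge> 1" for i
      proof -
        have "L2_inner \<nu> f (e i) = (\<Sum>j=1..n. c j * L2_inner \<nu> (e j) (e i))"
          unfolding f_def by (rule L2_inner_sum_left) (use e that in auto)
        also have "\<dots> = (\<Sum>j=1..n. if j = i then c j else 0)"
          using that by (intro sum.cong) (auto simp: on)
        finally show ?thesis by simp
      qed
      have hs: "((\<lambda>i. (L2_inner \<nu> f (e i))\<^sup>2 / w (\<mu> i)) has_sum (\<Sum>i=1..n. (c i)\<^sup>2 / w (\<mu> i))) {1..}"
        by (rule has_sum_finite_neutralI[of "{1..n}"]) (auto simp: coeff)
      have fV: "f \<in> scale_space \<nu> \<mu> e w"
        unfolding scale_space_def f_def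
        using e hs by (auto simp: f_def summable_on_def intro!: L2_sum L2_cmult)
      have norm: "scale_norm \<nu> \<mu> e w f = sqrt (\<Sum>i=1..n. (c i)\<^sup>2 / w (\<mu> i))"
        using infsumI[OF hs] by (simp add: scale_norm_def scale_inner_def power2_eq_square)
      have "(\<Sum>i=1..n. (c i)\<^sup>2 / w (\<mu> i)) \<le> (\<Sum>i=1..n. (c i)\<^sup>2 / w (\<mu> n))"
      proof (rule sum_mono)
        fix i assume i: "i \<in> {1..n}"
        have "\<mu> n \<le> \<mu> i" using spec n i by (auto simp: spectral_representation_def monotone_on_def)
        then have "w (\<mu> n) \<le> w (\<mu> i)" using w(2) \<mu>[of i i] \<mu>[of n n] i n by (auto simp: monotone_on_def)
        then show "(c i)\<^sup>2 / w (\<mu> i) \<le> (c i)\<^sup>2 / w (\<mu> n)"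
          using w(1)[OF \<mu>[of n n]] n by (intro divide_left_mono) (auto intro!: mult_pos_pos)
      qed
      also have "\<dots> = 1 / w (\<mu> n)" using c by (simp flip: sum_divide_distrib)
      finally have "scale_norm \<nu> \<mu> e w f \<le> 1 / sqrt (w (\<mu> n))"
        unfolding norm by (metis real_sqrt_divide real_sqrt_le_mono real_sqrt_one)
      then have "\<bar>C\<bar> * scale_norm \<nu> \<mu> e w f \<le> \<bar>C\<bar> * (1 / sqrt (w (\<mu> n)))" by (intro mult_left_mono) auto
      moreover have "C * scale_norm \<nu> \<mu> e w f \<le> \<bar>C\<bar> * scale_norm \<nu> \<mu> e w f"
        unfolding norm using w(1) \<mu>
        by (intro mult_right_mono) (auto intro!: real_sqrt_ge_zero sum_nonneg divide_nonneg_nonneg simp: less_imp_le)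
      ultimately have "Linf_norm \<nu> f \<le> \<bar>C\<bar> / sqrt (w (\<mu> n))" using C[OF fV] by simp
      moreover have "Linf_enorm \<nu> f < \<infinity>" using fV sub by (auto simp: Linf_space_def)
      ultimately show "Linf_enorm \<nu> (\<lambda>x. \<Sum>i=1..n. c i * e i x) \<le> ereal (\<bar>C\<bar> / sqrt (w (\<mu> n)))"
        unfolding f_def[symmetric] Linf_norm_def by (cases "Linf_enorm \<nu> f") auto
    qed
  qed simp
qed

section \<open>Two-sided estimate of the eigenvalues\<close>

theorem corollaryC2p1:
  fixes X :: "'a::euclidean_space set"
    and \<nu> :: "'a measure"
    and K :: "'a \<Rightarrow> 'a \<Rightarrow> real"
    and H :: "('a \<Rightarrow> real) set"
    and ip :: "('a \<Rightarrow> real) \<Rightarrow> ('a \<Rightarrow> real) \<Rightarrow> real"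
    and \<mu> :: "nat \<Rightarrow> real"
    and e :: "nat \<Rightarrow> 'a \<Rightarrow> real"
    and \<phi> \<psi> s \<kappa> F :: "real \<Rightarrow> real"
    and D1\<phi> D2\<phi> D1\<psi> D2\<psi> D1s D2s :: real
  assumes radon: "radon_prob_on X \<nu>"
    and abs_cont: "absolutely_continuous lborel (distr \<nu> borel (\<lambda>x. x))"
    and support: "measure_support \<nu> = closure X"
    and rkhs: "rkhs X K H ip" "separable_fun_space H ip"
    and embedding: "bounded_embedding H (\<lambda>f. sqrt (ip f f)) (L2_space \<nu>) (L2_norm \<nu>)"
    and injective: "\<And>f. f \<in> H \<Longrightarrow> (AE x in \<nu>. f x = 0) \<Longrightarrow> f = (\<lambda>x. 0)"
    and nuclear: "L2_nuclear \<nu> (integral_operator \<nu> K)"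
    and spectral: "spectral_representation \<nu> (integral_operator \<nu> K) \<mu> e"
    and index_functions: "index_function \<phi>" "index_function \<psi>"
    and compact_K_phi: "compact_embedding H (\<lambda>f. sqrt (ip f f))
          (scale_space \<nu> \<mu> e \<phi>) (scale_norm \<nu> \<mu> e \<phi>)"
    and compact_phi_psi: "compact_embedding (scale_space \<nu> \<mu> e \<phi>) (scale_norm \<nu> \<mu> e \<phi>)
          (scale_space \<nu> \<mu> e \<psi>) (scale_norm \<nu> \<mu> e \<psi>)"
    and weak_psi: "weakly_embedded \<nu> \<mu> e \<psi> (Linf_space \<nu>) (Linf_norm \<nu>)"
    and positive: "\<And>t. t > 0 \<Longrightarrow> \<phi> t > 0" "\<And>t. t > 0 \<Longrightarrow> \<psi> t > 0"
    and ratio_phi: "mono_on {0<..} (\<lambda>t. t / \<phi> t)"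
    and ratio_phi_psi: "mono_on {0<..} (\<lambda>t. \<phi> t / \<psi> t)"
    and concave_psi: "concave_on {0<..} (\<lambda>t. t / \<psi> t)"
    and Delta2_phi: "Delta2 \<phi> D1\<phi> D2\<phi>" "D1\<phi> > 1" "D2\<phi> > 1"
    and Delta2_psi: "Delta2 \<psi> D1\<psi> D2\<psi>" "D1\<psi> > 1" "D2\<psi> > 1"
    and growth: "\<exists>c>0. \<exists>C>0. \<forall>\<^sub>F n in sequentially.
          ereal (c * sqrt (s (real n))) \<le> sup_norm_growth \<nu> e n \<and>
          sup_norm_growth \<nu> e n \<le> ereal (C * sqrt (s (real n)))"
    and s_increasing: "mono_on {0<..} s"
    and Delta2_s: "Delta2 s D1s D2s" "D1s > 1" "D2s > 1"
    and domain: "connected X" "compact (closure X)"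
    and covering: "covering_radius (closure X) \<in> \<Theta>(\<lambda>n. real n powr (- 1 / real DIM('a)))"
    and radial: "\<And>x y. x \<in> X \<Longrightarrow> y \<in> X \<Longrightarrow> K x y = \<kappa> (norm (x - y))"
    and kappa_spd: "strictly_pos_def_radial TYPE('a) \<kappa>"
    and kappa_L1: "integrable lebesgue \<kappa>"
    and fourier: "radial_fourier TYPE('a) \<kappa> F"
    and fourier_pos: "\<And>t. t > 0 \<Longrightarrow> F t > 0"
    and fourier_mono: "antimono_on {0..} F"
    and fourier_cont: "continuous_on {0..} F"
    and fourier_alpha: "\<exists>a. has_dilation_index F (at_right 0) a"
    and fourier_beta: "\<exists>b. has_dilation_index F at_top b"
    and psi_s: "(\<lambda>t. \<psi> (t * F (t powr (1 / real DIM('a))) / s t)) \<in> \<Theta>[at_top](\<lambda>t. 1 / s t)"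
  shows "\<forall>\<epsilon>>0.
           (\<lambda>n. generalized_inverse \<psi> (1 / s (real n))) \<in> O(\<mu>) \<and>
           \<mu> \<in> O(\<lambda>n. generalized_inverse \<psi> (s (real n) powr (- 1 / (1 + \<epsilon>))))"
proof -
  note space = radon_prob_on_basic(1)[OF radon] and prob = radon_prob_on_basic(3)[OF radon]
  let ?d = "real DIM('a)"
  obtain k :: "'a \<Rightarrow> real" where k: "integrable lborel k" "AE z in lborel. \<kappa> (norm z) = k z"
    "\<And>\<xi>. (\<integral>z. k z *\<^sub>R cis (- (\<xi> \<bullet> z)) \<partial>lborel) = of_real (F (norm \<xi>))"
    using ex_borel_kernel[OF fourier] by blast
  have K_meas: "K x \<in> borel_measurable \<nu>" if "x \<in> X" for x
  proof -
    have "kernel_section X K x \<in> L2_space \<nu>"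
      using rkhs(1) embedding that by (auto simp: rkhs_def bounded_embedding_def)
    then have "kernel_section X K x \<in> borel_measurable \<nu>" by (simp add: L2_space_def)
    then show ?thesis
      by (rule measurable_cong[THEN iffD1, rotated]) (simp add: space kernel_section_def)
  qed
  have K_k: "AE y in lborel. y \<in> X \<longrightarrow> K x y = k (x - y)" if "x \<in> X" for x
    using AE_lborel_reflect[OF k(2), of x] by eventually_elim (simp add: radial[OF that])
  obtain \<alpha> where \<alpha>: "has_dilation_index F (at_right 0) \<alpha>" using fourier_alpha by blast
  obtain c0 where c0: "0 < c0" "\<forall>\<^sub>F n in sequentially. c0 * F (real n powr (1 / ?d)) \<le> \<mu> n"
    using eigenvalue_ge_fourier[OF radon abs_cont domain(2) bigthetaD1[OF covering] K_meas K_k spectral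
        k(1,3) fourier_pos fourier_mono \<alpha>] by blast
  have e: "e j \<in> L2_space \<nu>" and on: "L2_inner \<nu> (e i) (e j) = (if i = j then 1 else 0)"
    and \<mu>: "0 < \<mu> j" if "i \<ge> 1" "j \<ge> 1" for i j
    using spectral that by (auto simp: spectral_representation_def)
  obtain c C where cC: "0 < c" "0 < C" and growth':
    "\<forall>\<^sub>F n in sequentially. ereal (c * sqrt (s (real n))) \<le> sup_norm_growth \<nu> e n \<and>
       sup_norm_growth \<nu> e n \<le> ereal (C * sqrt (s (real n)))"
    using growth by blast
  \<comment> \<open>the growth bound makes \<open>s\<close> nonnegative, as otherwise \<open>sqrt\<close> would be negative\<close>
  have s_ge: "\<forall>\<^sub>F n in sequentially. 0 < s (real n) \<and> real n \<le> C\<^sup>2 * s (real n)"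
    using growth' eventually_ge_at_top[of 1]
  proof eventually_elim
    case (elim n)
    have "0 \<le> C * sqrt (s (real n))" "real n \<le> (C * sqrt (s (real n)))\<^sup>2"
      using dim_le_sup_norm_growth_squared[OF prob elim(2), of e "C * sqrt (s (real n))"] e on elim by auto
    moreover from this have "0 \<le> s (real n)" using cC by (simp add: zero_le_mult_iff)
    ultimately have "real n \<le> C\<^sup>2 * s (real n)" by (simp add: power_mult_distrib)
    moreover from this have "0 < C\<^sup>2 * s (real n)" using elim(2) by linarith
    ultimately show ?case using cC by (simp add: zero_less_mult_iff)
  qed
  have unbounded: "\<exists>t\<ge>0. y \<le> \<psi> t" for y
  proof -
    obtain m where "y / \<psi> 1 < D1\<psi> ^ m" using real_arch_pow[OF Delta2_psi(2)] by blast
    then have "y < D1\<psi> ^ m * \<psi> 1" using positive(2)[of 1] by (simp add: field_simps)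
    also have "\<dots> \<le> \<psi> (2 ^ m * 1)" by (rule Delta2_power_le[OF Delta2_psi(1,2)]) simp
    finally show ?thesis by (intro exI[of _ "2 ^ m"]) simp
  qed
  have lower: "(\<lambda>n. generalized_inverse \<psi> (1 / s (real n))) \<in> O(\<mu>)"
  proof -
    obtain C1 where C1: "0 < C1"
      "\<forall>\<^sub>F t in at_top. norm (1 / s t) \<le> C1 * norm (\<psi> (t * F (t powr (1 / ?d)) / s t))"
      using bigthetaD2[OF psi_s, unfolded bigomega_iff_bigo] by (rule landau_o.bigE)
    obtain m where m: "C1 < D1\<psi> ^ m" using real_arch_pow[OF Delta2_psi(2)] by blast
    have "\<forall>\<^sub>F n in sequentially. norm (1 / s (real n)) \<le> C1 * norm (\<psi> (real n * F (real n powr (1 / ?d)) / s (real n)))"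
      by (rule eventually_compose_filterlim[OF C1(2) filterlim_real_sequentially])
    then have "\<forall>\<^sub>F n in sequentially. norm (generalized_inverse \<psi> (1 / s (real n))) \<le> (2 ^ m * C\<^sup>2 / c0) * norm (\<mu> n)"
      using s_ge c0(2) eventually_ge_at_top[of 1]
    proof eventually_elim
      case (elim n)
      \<comment> \<open>\<open>u\<close> is of the order of \<open>\<psi>\<^sup>-\<^sup>1 (1 / s n)\<close>, and \<open>n \<le> C\<^sup>2 * s n\<close> compares it with \<open>F (n powr (1 / d))\<close>\<close>
      define u where "u = real n * F (real n powr (1 / ?d)) / s (real n)"
      have F: "0 < F (real n powr (1 / ?d))" using elim(4) by (intro fourier_pos) simp
      have u: "0 < u" using elim F by (simp add: u_def)
      have "1 / s (real n) \<le> C1 * \<psi> u" using elim positive(2)[OF u] by (simp add: u_def)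
      also have "\<dots> \<le> D1\<psi> ^ m * \<psi> u" using m positive(2)[OF u] by (intro mult_right_mono) auto
      also have "\<dots> \<le> \<psi> (2 ^ m * u)" by (rule Delta2_power_le[OF Delta2_psi(1,2) u])
      finally have *: "1 / s (real n) \<le> \<psi> (2 ^ m * u)" .
      have "0 \<le> generalized_inverse \<psi> (1 / s (real n))"
        using u elim index_functions(2)
        by (intro generalized_inverse_ge[OF index_functions(2) _ _ _ *]) (auto simp: index_function_def)
      moreover have "generalized_inverse \<psi> (1 / s (real n)) \<le> 2 ^ m * u"
        using u by (intro generalized_inverse_le *) simp
      moreover have "u \<le> C\<^sup>2 * F (real n powr (1 / ?d))"
      proof -
        have "real n * F (real n powr (1 / ?d)) \<le> (C\<^sup>2 * s (real n)) * F (real n powr (1 / ?d))"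
          using elim F by (intro mult_right_mono) auto
        then show ?thesis using elim by (simp add: u_def field_simps)
      qed
      moreover have "C\<^sup>2 * F (real n powr (1 / ?d)) \<le> C\<^sup>2 * (\<mu> n / c0)"
        using elim c0(1) by (intro mult_left_mono) (auto simp: field_simps)
      ultimately have "generalized_inverse \<psi> (1 / s (real n)) \<le> 2 ^ m * (C\<^sup>2 * (\<mu> n / c0))"
        by (meson mult_left_mono order_trans zero_le_numeral zero_le_power)
      with \<open>0 \<le> generalized_inverse _ _\<close> show ?case using \<mu>[of n n] elim(4) by simp
    qed
    then show ?thesis by (rule bigoI)
  qed
  have upper: "\<mu> \<in> O(\<lambda>n. generalized_inverse \<psi> (s (real n) powr (- 1 / (1 + \<epsilon>))))" if \<epsilon>: "0 < \<epsilon>" for \<epsilon>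
  proof -
    define w where "w t = \<psi> t powr (1 + \<epsilon>)" for t
    have emb: "bounded_embedding (scale_space \<nu> \<mu> e w) (scale_norm \<nu> \<mu> e w) (Linf_space \<nu>) (Linf_norm \<nu>)"
      using weak_psi \<epsilon> by (auto simp: weakly_embedded_def compact_embedding_def w_def[abs_def])
    have w: "0 < w t" if "0 < t" for t using positive(2)[OF that] by (simp add: w_def)
    have w_mono: "mono_on {0<..} w"
    proof (rule monotone_onI)
      fix x y :: real assume xy: "x \<in> {0<..}" "y \<in> {0<..}" "x \<le> y"
      then have "\<psi> x \<le> \<psi> y" using index_functions(2) by (auto simp: index_function_def monotone_on_def)
      then show "w x \<le> w y" using positive(2)[of x] xy \<epsilon> by (auto simp: w_def intro!: powr_mono2)
    qed
    obtain B where B: "0 \<le> B" "\<And>n. n \<ge> 1 \<Longrightarrow> sup_norm_growth \<nu> e n \<le> ereal (B / sqrt (w (\<mu> n)))"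
      using sup_norm_growth_le_of_embedding[OF spectral emb w w_mono] by blast
    define q where "q = ((B / c)\<^sup>2) powr (1 / (1 + \<epsilon>))"
    obtain m where m: "q < D1\<psi> ^ m" using real_arch_pow[OF Delta2_psi(2)] by blast
    have "\<forall>\<^sub>F n in sequentially. norm (\<mu> n) \<le> 2 ^ m * norm (generalized_inverse \<psi> (s (real n) powr (- 1 / (1 + \<epsilon>))))"
      using growth' s_ge eventually_ge_at_top[of 1]
    proof eventually_elim
      case (elim n)
      have \<mu>n: "0 < \<mu> n" using \<mu>[of n n] elim by simp
      define y where "y = s (real n) powr (- 1 / (1 + \<epsilon>))"
      have y: "0 < y" using elim by (simp add: y_def)
      have "ereal (c * sqrt (s (real n))) \<le> ereal (B / sqrt (w (\<mu> n)))"
        using elim B(2)[of n] by (meson order_trans)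
      then have "c * sqrt (s (real n)) \<le> B / sqrt (w (\<mu> n))" by simp
      then have "sqrt (w (\<mu> n)) * sqrt (s (real n)) \<le> B / c"
        using w[OF \<mu>n] cC by (simp add: field_simps)
      then have "(sqrt (w (\<mu> n)) * sqrt (s (real n)))\<^sup>2 \<le> (B / c)\<^sup>2"
        using w[OF \<mu>n] elim by (intro power_mono) auto
      moreover have "(sqrt (w (\<mu> n)) * sqrt (s (real n)))\<^sup>2 = w (\<mu> n) * s (real n)"
        using w[OF \<mu>n] elim by (simp add: power_mult_distrib)
      ultimately have "w (\<mu> n) \<le> (B / c)\<^sup>2 / s (real n)"
        using elim by (simp only: pos_le_divide_eq)
      then have "w (\<mu> n) powr (1 / (1 + \<epsilon>)) \<le> ((B / c)\<^sup>2 / s (real n)) powr (1 / (1 + \<epsilon>))"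
        using w[OF \<mu>n] \<epsilon> by (intro powr_mono2) auto
      also have "w (\<mu> n) powr (1 / (1 + \<epsilon>)) = \<psi> (\<mu> n)"
        using positive(2)[OF \<mu>n] \<epsilon> by (simp add: w_def powr_powr)
      also have "((B / c)\<^sup>2 / s (real n)) powr (1 / (1 + \<epsilon>)) = q * y"
        using elim by (simp add: q_def y_def powr_divide powr_minus_divide)
      finally have \<psi>_le: "\<psi> (\<mu> n) \<le> q * y" .
      \<comment> \<open>dividing the argument by \<open>2 ^ m\<close> makes \<open>\<psi>\<close> small enough to absorb the constant \<open>q\<close>\<close>
      have "D1\<psi> ^ m * \<psi> (\<mu> n / 2 ^ m) \<le> \<psi> (2 ^ m * (\<mu> n / 2 ^ m))"
        using \<mu>n by (intro Delta2_power_le[OF Delta2_psi(1,2)]) simp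
      also have "\<dots> \<le> q * y" using \<psi>_le by simp
      also have "\<dots> < D1\<psi> ^ m * y" using m y by simp
      finally have "\<psi> (\<mu> n / 2 ^ m) < y" using Delta2_psi(2) by simp
      moreover obtain t where "0 \<le> t" "y \<le> \<psi> t" using unbounded by blast
      ultimately have "\<mu> n / 2 ^ m \<le> generalized_inverse \<psi> y"
        using \<mu>n by (intro generalized_inverse_ge[OF index_functions(2)]) auto
      then have "\<mu> n \<le> 2 ^ m * generalized_inverse \<psi> y" by (simp add: field_simps)
      also have "\<dots> \<le> 2 ^ m * \<bar>generalized_inverse \<psi> y\<bar>" by simp
      finally show ?case using \<mu>n by (simp add: y_def)
    qed
    then show ?thesis by (rule bigoI)
  qed
  show ?thesis using lower upper by blast
qed

end
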